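(* Let $i\ge0$ be an integer and let $\mathcal I=(I_n)_{n\ge1}$ be an $\mathrm{Inc}^i$-invariant chain of proper monomial ideals $I_n\subsetneq R_n$. Then there exists an integer $\tilde D(\mathcal I)$ such that $$\operatorname{pd} I_n\ge \Gamma_i(\mathcal I)\,n+\tilde D(\mathcal I)\quad\text{for all } n\gg0 .$$
   Context: Fix an integer $c\ge 1$ and a field $K$; let $\mathbb N$ be the set of positive integers and $[c]=\{1,\dots,c\}$. For $n\ge1$ let $R_n=K[x_{k,j}\mid 1\le k\le c,\ 1\le j\le n]$ and $R=\bigcup_{n\ge1}R_n$. For an integer $i\ge0$ let $\mathrm{Inc}^i$ be the monoid of all strictly increasing maps $\pi:\mathbb N\to\mathbb N$ with $\pi(j)=j$ for all $j\le i$; it acts on $R$ by $K$-algebra endomorphisms via $\pi\cdot x_{k,j}=x_{k,\pi(j)}$. For $m\le n$ put $\mathrm{Inc}^i_{m,n}=\{\pi\in\mathrm{Inc}^i\mid \pi(m)\le n\}$. A chain $\mathcal I=(I_n)_{n\ge1}$ of ideals $I_n\subseteq R_n$ is $\mathrm{Inc}^i$-invariant if $\pi(f)\in I_n$ for all $m\le n$, $f\in I_m$, $\pi\in\mathrm{Inc}^i_{m,n}$. For such a chain there is an integer $r\ge1$ such that for all $n\ge r$ the ideal $I_n$ of $R_n$ is generated by $\{\pi(f)\mid f\in I_r,\ \pi\in\mathrm{Inc}^i_{r,n}\}$ (known); the least such $r$ is denoted $\mathrm{ind}^i(\mathcal I)$. For a monomial $u\ne1$, $\min(u)$ is the smallest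 index $j$ such that some $x_{k,j}$ divides $u$. For a proper monomial ideal $J\subsetneq R_n$ with minimal set of monomial generators $G(J)$, and an integer $j\ge 0$, let $G_j^+(J)=\{u\in G(J)\mid \min(u)>j\}$. A set $C\subseteq[c]$ covers a monomial $u$ if there is $k\in C$ such that $x_{k,l}$ divides $u$ for some $l\ge1$; $C$ is a $j$-cover of $J$ if it covers every element of $G_j^+(J)$. Put $\gamma_j(J)=\min\{\#C\mid C\text{ is a }j\text{-cover of }J\}$, and $\gamma_j(R_n)=\infty$. For an $\mathrm{Inc}^j$-invariant chain $\mathcal J=(J_n)_{n\ge1}$ of monomial ideals, $\gamma_j(J_n)$ is the same for all $n\ge\mathrm{ind}^j(\mathcal J)$, and $\gamma_j(\mathcal J)$ denotes this common value. Definition of $\Gamma_i(\mathcal I)$. For an $\mathrm{Inc}^j$-invariant chain $\mathcal J=(J_n)_{n\ge1}$ of monomial ideals and $\mathbf e=(e_1,\dots,e_c)\in\mathbb Z_{\ge0}^c$, let $\mathcal J_{\mathbf e}=(J_{\mathbf e,n})_{n\ge1}$ be given by $$J_{\mathbf e,n}=\big\langle (J_n:x_{1,j+1}^{e_1}\cdots x_{c,j+1}^{e_c}),\ x_{1,j+1},\dots,x_{c,j+1}\big\rangle ;$$ for $n\le j$, where $x_{k,j+1}\notin R_n$, this is read as the intersection with $R_n$ of the corresponding ideal formed in $R$ from $J_nR$. The chain $\mathcal J_{\mathbf e}$ is $\mathrm{Inc}^{j+1}$-invariant (known). Now fix an integer $r\ge\mathrm{ind}^i(\mathcal I)$. Starting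 from the $\mathrm{Inc}^i$-invariant chain $\mathcal I$, iterate: for $k\ge1$, the $\mathrm{Inc}^{i+k}$-invariant chain $\mathcal I_{\mathbf e_1,\dots,\mathbf e_k}=(I_{\mathbf e_1,\dots,\mathbf e_k,n})_{n\ge1}$ is $(\mathcal I_{\mathbf e_1,\dots,\mathbf e_{k-1}})_{\mathbf e_k}$ (formed with $j=i+k-1$), and $$E(\mathcal I_{\mathbf e_1,\dots,\mathbf e_{k-1}})=\{\mathbf e_k\in\mathbb Z_{\ge0}^c\mid I_{\mathbf e_1,\dots,\mathbf e_k,r+k}\ne R_{r+k}\}$$ (for $k=1$ the chain $\mathcal I_{\mathbf e_1,\dots,\mathbf e_{k-1}}$ is $\mathcal I$). Put $$\gamma_{i+k}^{\max}(\mathcal I)=\max\{\gamma_{i+k}(\mathcal I_{\mathbf e_1,\dots,\mathbf e_k})\mid \mathbf e_1\in E(\mathcal I),\ \mathbf e_2\in E(\mathcal I_{\mathbf e_1}),\dots,\ \mathbf e_k\in E(\mathcal I_{\mathbf e_1,\dots,\mathbf e_{k-1}})\}.$$ These integers form a non-decreasing sequence in $k$ bounded by $c$, and $\Gamma_i(\mathcal I)=\max\{\gamma_{i+k}^{\max}(\mathcal I)\mid k\ge1\}$. $\operatorname{pd} I_n$ is the projective dimension of $I_n$ as an $R_n$-module, so $\operatorname{pd}I_n=\operatorname{pd}(R_n/I_n)-1$; for $I_n=0$ this is read as $-1$. *)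

theory Defs
  imports
    "HOL-Algebra.Ideal"
    "HOL-Algebra.Module"
    "HOL-Library.Poly_Mapping"
    "HOL-Library.Extended_Real"
begin

section \<open>Polynomial rings in the variables $x_{k,j}$\<close>

text \<open>The pair \<open>(k, j)\<close> is the variable $x_{k,j}$; exponent vectors and polynomials are finitely
  supported functions.\<close>

type_synonym expo = "nat \<times> nat \<Rightarrow>\<^sub>0 nat"
type_synonym 'k pol = "expo \<Rightarrow>\<^sub>0 'k"

definition mono_of :: "expo \<Rightarrow> 'k::field pol" where
  "mono_of u = Poly_Mapping.single u 1"

definition var_of :: "nat \<Rightarrow> nat \<Rightarrow> 'k::field pol" where
  "var_of k j = mono_of (Poly_Mapping.single (k, j) 1)"

definition var_poly_ring :: "(nat \<times> nat) set \<Rightarrow> 'k::field pol ring" where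
  "var_poly_ring V =
     \<lparr>carrier = {f. \<forall>u\<in>Poly_Mapping.keys f. Poly_Mapping.keys u \<subseteq> V},
      monoid.mult = (*), one = 1, zero = 0, add = (+)\<rparr>"

definition vars_upto :: "nat \<Rightarrow> nat \<Rightarrow> (nat \<times> nat) set" where
  "vars_upto c n = {1..c} \<times> {1..n}"

definition vars_all :: "nat \<Rightarrow> (nat \<times> nat) set" where
  "vars_all c = {1..c} \<times> {1..}"

abbreviation Rn :: "nat \<Rightarrow> nat \<Rightarrow> 'k::field pol ring" where
  "Rn c n \<equiv> var_poly_ring (vars_upto c n)"

abbreviation Rinf :: "nat \<Rightarrow> 'k::field pol ring" where
  "Rinf c \<equiv> var_poly_ring (vars_all c)"


section \<open>The monoids $\mathrm{Inc}^i$ and invariant chains\<close>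

text \<open>A strictly increasing self-map of the positive integers is encoded as its extension to
  \<open>nat\<close> by $0 \mapsto 0$; the condition below includes \<open>j = 0\<close>.\<close>

definition Inc :: "nat \<Rightarrow> (nat \<Rightarrow> nat) set" where
  "Inc i = {p. strict_mono p \<and> (\<forall>j\<le>i. p j = j)}"

definition Inc_mn :: "nat \<Rightarrow> nat \<Rightarrow> nat \<Rightarrow> (nat \<Rightarrow> nat) set" where
  "Inc_mn i m n = {p \<in> Inc i. p m \<le> n}"

definition act_expo :: "(nat \<Rightarrow> nat) \<Rightarrow> expo \<Rightarrow> expo" where
  "act_expo p u =
     (\<Sum>v\<in>Poly_Mapping.keys u. Poly_Mapping.single (fst v, p (snd v)) (Poly_Mapping.lookup u v))"

definition inc_act :: "(nat \<Rightarrow> nat) \<Rightarrow> 'k::field pol \<Rightarrow> 'k pol" where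
  "inc_act p f =
     (\<Sum>u\<in>Poly_Mapping.keys f. Poly_Mapping.single (act_expo p u) (Poly_Mapping.lookup f u))"

text \<open>A chain $(I_n)_{n\ge1}$ is a function on \<open>nat\<close> whose value at \<open>0\<close> is irrelevant.\<close>

definition invariant_chain :: "nat \<Rightarrow> nat \<Rightarrow> (nat \<Rightarrow> 'k::field pol set) \<Rightarrow> bool" where
  "invariant_chain c i I \<longleftrightarrow>
     (\<forall>n\<ge>1. ideal (I n) (Rn c n)) \<and>
     (\<forall>m n. 1 \<le> m \<longrightarrow> m \<le> n \<longrightarrow> (\<forall>f\<in>I m. \<forall>p\<in>Inc_mn i m n. inc_act p f \<in> I n))"

definition chain_ind :: "nat \<Rightarrow> nat \<Rightarrow> (nat \<Rightarrow> 'k::field pol set) \<Rightarrow> nat" where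
  "chain_ind c i I =
     (LEAST r. 1 \<le> r \<and>
        (\<forall>n\<ge>r. I n = genideal (Rn c n) {inc_act p f |p f. f \<in> I r \<and> p \<in> Inc_mn i r n}))"


section \<open>Monomial ideals and $j$-covers\<close>

definition mono_gens :: "(nat \<times> nat) set \<Rightarrow> 'k::field pol set \<Rightarrow> expo set \<Rightarrow> bool" where
  "mono_gens V J M \<longleftrightarrow>
     (\<forall>u\<in>M. Poly_Mapping.keys u \<subseteq> V) \<and> J = genideal (var_poly_ring V) (mono_of ` M)"

definition monomial_ideal :: "(nat \<times> nat) set \<Rightarrow> 'k::field pol set \<Rightarrow> bool" where
  "monomial_ideal V J \<longleftrightarrow> (\<exists>M. mono_gens V J M)"

definition min_gens :: "(nat \<times> nat) set \<Rightarrow> 'k::field pol set \<Rightarrow> expo set" where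
  "min_gens V J = (THE M. mono_gens V J M \<and> (\<forall>M'. M' \<subset> M \<longrightarrow> \<not> mono_gens V J M'))"

text \<open>The variable $x_{k,l}$ divides the monomial with exponent vector \<open>u\<close> iff \<open>(k, l)\<close> lies in
  the support of \<open>u\<close>.\<close>

definition min_index :: "expo \<Rightarrow> nat" where
  "min_index u = (LEAST j. \<exists>k. (k, j) \<in> Poly_Mapping.keys u)"

definition Gplus :: "(nat \<times> nat) set \<Rightarrow> nat \<Rightarrow> 'k::field pol set \<Rightarrow> expo set" where
  "Gplus V j J = {u \<in> min_gens V J. min_index u > j}"

definition covers :: "nat set \<Rightarrow> expo \<Rightarrow> bool" where
  "covers C u \<longleftrightarrow> (\<exists>k\<in>C. \<exists>l\<ge>1. (k, l) \<in> Poly_Mapping.keys u)"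

definition is_cover :: "nat \<Rightarrow> nat \<Rightarrow> nat \<Rightarrow> 'k::field pol set \<Rightarrow> nat set \<Rightarrow> bool" where
  "is_cover c n j J C \<longleftrightarrow> C \<subseteq> {1..c} \<and> (\<forall>u\<in>Gplus (vars_upto c n) j J. covers C u)"

definition cover_number :: "nat \<Rightarrow> nat \<Rightarrow> nat \<Rightarrow> 'k::field pol set \<Rightarrow> enat" where
  "cover_number c n j J =
     (if J = carrier (Rn c n) then \<infinity> else enat (Min {card C |C. is_cover c n j J C}))"

definition cover_number_chain :: "nat \<Rightarrow> nat \<Rightarrow> (nat \<Rightarrow> 'k::field pol set) \<Rightarrow> enat" where
  "cover_number_chain c j J = (THE g. \<forall>n\<ge>chain_ind c j J. cover_number c n j (J n) = g)"


section \<open>The chains $\mathcal{I}_{\mathbf{e}_1,\dots,\mathbf{e}_k}$ and $\Gamma_i(\mathcal{I})$\<close>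

text \<open>A vector $\mathbf{e} \in \mathbb{Z}_{\ge0}^c$ is given by a function \<open>e\<close>, of which only the
  values on $\{1,\dots,c\}$ are used.\<close>

definition level_mono :: "nat \<Rightarrow> nat \<Rightarrow> (nat \<Rightarrow> nat) \<Rightarrow> expo" where
  "level_mono c j e = (\<Sum>k\<in>{1..c}. Poly_Mapping.single (k, j + 1) (e k))"

definition colon :: "(nat \<times> nat) set \<Rightarrow> 'k::field pol set \<Rightarrow> 'k pol \<Rightarrow> 'k pol set" where
  "colon V J g = {f \<in> carrier (var_poly_ring V). f * g \<in> J}"

definition colon_plus_vars ::
    "(nat \<times> nat) set \<Rightarrow> nat \<Rightarrow> nat \<Rightarrow> (nat \<Rightarrow> nat) \<Rightarrow> 'k::field pol set \<Rightarrow> 'k pol set" where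
  "colon_plus_vars V c j e J =
     genideal (var_poly_ring V)
       (colon V J (mono_of (level_mono c j e)) \<union> {var_of k (j + 1) |k. k \<in> {1..c}})"

definition chain_e ::
    "nat \<Rightarrow> nat \<Rightarrow> (nat \<Rightarrow> nat) \<Rightarrow> (nat \<Rightarrow> 'k::field pol set) \<Rightarrow> nat \<Rightarrow> 'k pol set" where
  "chain_e c j e J n =
     (if j + 1 \<le> n then colon_plus_vars (vars_upto c n) c j e (J n)
      else colon_plus_vars (vars_all c) c j e (genideal (Rinf c) (J n)) \<inter> carrier (Rn c n))"

fun chain_es ::
    "nat \<Rightarrow> nat \<Rightarrow> (nat \<Rightarrow> nat) list \<Rightarrow> (nat \<Rightarrow> 'k::field pol set) \<Rightarrow> nat \<Rightarrow> 'k pol set" where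
  "chain_es c i [] I = I"
| "chain_es c i (e # es) I = chain_es c (i + 1) es (chain_e c i e I)"

definition Eset ::
    "nat \<Rightarrow> nat \<Rightarrow> nat \<Rightarrow> (nat \<Rightarrow> 'k::field pol set) \<Rightarrow> (nat \<Rightarrow> nat) list \<Rightarrow> (nat \<Rightarrow> nat) set" where
  "Eset c i r I es =
     {e. let k = length es + 1 in chain_es c i (es @ [e]) I (r + k) \<noteq> carrier (Rn c (r + k))}"

definition admissible ::
    "nat \<Rightarrow> nat \<Rightarrow> nat \<Rightarrow> (nat \<Rightarrow> 'k::field pol set) \<Rightarrow> (nat \<Rightarrow> nat) list \<Rightarrow> bool" where
  "admissible c i r I es \<longleftrightarrow> (\<forall>l<length es. es ! l \<in> Eset c i r I (take l es))"

definition gamma_max_level :: "nat \<Rightarrow> nat \<Rightarrow> nat \<Rightarrow> (nat \<Rightarrow> 'k::field pol set) \<Rightarrow> nat \<Rightarrow> enat" where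
  "gamma_max_level c i r I k =
     Max {cover_number_chain c (i + k) (chain_es c i es I) |es. length es = k \<and> admissible c i r I es}"

definition Gamma_chain :: "nat \<Rightarrow> nat \<Rightarrow> nat \<Rightarrow> (nat \<Rightarrow> 'k::field pol set) \<Rightarrow> enat" where
  "Gamma_chain c i r I = Max {gamma_max_level c i r I k |k. 1 \<le> k}"


section \<open>Projective dimension\<close>

definition mod_hom ::
    "'a ring \<Rightarrow> ('a, 'b) module \<Rightarrow> ('a, 'd) module \<Rightarrow> ('b \<Rightarrow> 'd) set" where
  "mod_hom R M N =
     {f \<in> carrier M \<rightarrow> carrier N.
        (\<forall>x\<in>carrier M. \<forall>y\<in>carrier M. f (x \<oplus>\<^bsub>M\<^esub> y) = f x \<oplus>\<^bsub>N\<^esub> f y) \<and>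
        (\<forall>a\<in>carrier R. \<forall>x\<in>carrier M. f (a \<odot>\<^bsub>M\<^esub> x) = a \<odot>\<^bsub>N\<^esub> f x)}"

definition mod_ker :: "('a, 'b) module \<Rightarrow> ('a, 'd) module \<Rightarrow> ('b \<Rightarrow> 'd) \<Rightarrow> 'b set" where
  "mod_ker M N f = {x \<in> carrier M. f x = \<zero>\<^bsub>N\<^esub>}"

text \<open>Lifting property against surjections \<open>g: N \<rightarrow> L\<close>. HOL cannot quantify over the types of
  \<open>N\<close> and \<open>L\<close>; the types chosen here suffice, since they allow \<open>L = P\<close> and \<open>N\<close> the free module
  on the set \<open>carrier P\<close> (finitely supported functions \<open>'b \<Rightarrow> 'a\<close>). Hence such a \<open>P\<close> is a direct
  summand of a free module and lifts against all surjections.\<close>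

definition projective_module :: "'a ring \<Rightarrow> ('a, 'b) module \<Rightarrow> bool" where
  "projective_module R P \<longleftrightarrow>
     Module.module R P \<and>
     (\<forall>(N :: ('a, 'b \<Rightarrow> 'a) module) (L :: ('a, 'b) module) g f.
        Module.module R N \<longrightarrow> Module.module R L \<longrightarrow>
        g \<in> mod_hom R N L \<longrightarrow> g ` carrier N = carrier L \<longrightarrow> f \<in> mod_hom R P L \<longrightarrow>
        (\<exists>h\<in>mod_hom R P N. \<forall>x\<in>carrier P. g (h x) = f x))"

text \<open>A projective resolution
  $\cdots \to P_1 \stackrel{\delta_0}{\to} P_0 \stackrel{\varepsilon}{\to} M \to 0$
  with $P_k = 0$ for $k > d$. The modules live on the type \<open>nat \<Rightarrow> 'a\<close>, which contains a copy of
  every projective module with countably many generators (as a summand of the finitely supported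
  sequences in \<open>R\<close>); this is enough for a countably generated module over a noetherian
  ring, such as an ideal of a polynomial ring in finitely many variables.\<close>

definition proj_resolution ::
    "'a ring \<Rightarrow> ('a, 'b) module \<Rightarrow> nat \<Rightarrow> (nat \<Rightarrow> ('a, nat \<Rightarrow> 'a) module) \<Rightarrow>
     (nat \<Rightarrow> (nat \<Rightarrow> 'a) \<Rightarrow> (nat \<Rightarrow> 'a)) \<Rightarrow> ((nat \<Rightarrow> 'a) \<Rightarrow> 'b) \<Rightarrow> bool" where
  "proj_resolution R M d P \<delta> \<epsilon> \<longleftrightarrow>
     (\<forall>k. projective_module R (P k)) \<and>
     (\<forall>k>d. carrier (P k) = {\<zero>\<^bsub>P k\<^esub>}) \<and>
     \<epsilon> \<in> mod_hom R (P 0) M \<and>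
     (\<forall>k. \<delta> k \<in> mod_hom R (P (Suc k)) (P k)) \<and>
     \<epsilon> ` carrier (P 0) = carrier M \<and>
     mod_ker (P 0) M \<epsilon> = \<delta> 0 ` carrier (P (Suc 0)) \<and>
     (\<forall>k. mod_ker (P (Suc k)) (P k) (\<delta> k) = \<delta> (Suc k) ` carrier (P (Suc (Suc k))))"

text \<open>The zero module gets $-1$; the value is \<open>\<infinity>\<close> if there is no finite resolution.\<close>

definition proj_dim :: "'a ring \<Rightarrow> ('a, 'b) module \<Rightarrow> ereal" where
  "proj_dim R M =
     (if carrier M = {\<zero>\<^bsub>M\<^esub>} then -1
      else INF d\<in>{d. \<exists>P \<delta> \<epsilon>. proj_resolution R M d P \<delta> \<epsilon>}. ereal (real d))"

text \<open>An ideal as a module over its ring; the \<open>mult\<close> and \<open>one\<close> fields of a module record play no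
  role.\<close>

definition ideal_module :: "'a ring \<Rightarrow> 'a set \<Rightarrow> ('a, 'a) module" where
  "ideal_module R I =
     \<lparr>carrier = I, monoid.mult = monoid.mult R, one = one R, zero = zero R, add = add R,
      smult = monoid.mult R\<rparr>"

end

theory Submission
  imports Defs "HOL-Library.Sublist"
begin

text \<open>The length of a projective resolution of a monomial ideal \<open>J\<close> is at least \<open>card T - 1\<close> as soon
  as some monomial \<open>w\<close> outside \<open>J\<close> is multiplied into \<open>J\<close> by all variables in \<open>T\<close>. Indeed, the variables
  in \<open>T\<close> form a regular sequence on every projective module, and reducing the resolution modulo one
  of them after the other shifts the socle element \<open>w\<close> one step further to the left each time.

  Such a \<open>T\<close> is found as a minimal prime of a colon ideal \<open>I n : m\<close>, where \<open>m\<close> is the product of the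
  monomials belonging to exponent vectors \<open>e\<^sub>1, \<dots>, e\<^sub>k\<close> at which \<open>\<Gamma>\<close> is attained. The generators of
  the iterated chain with \<open>min > i + k\<close>, together with their shifts, lie in \<open>I n : m\<close>, hence \<open>T\<close> hits
  all of them. If \<open>T\<close> had fewer than \<open>\<Gamma>\<close> variables in many columns, then by the pigeonhole principle
  many columns would meet \<open>T\<close> in the same set of fewer than \<open>\<Gamma>\<close> rows; this set is not a cover, and an
  uncovered generator shifted into these columns would avoid \<open>T\<close>. Hence \<open>card T \<ge> \<Gamma> n - const\<close>.

  Higman's lemma guarantees that the minima and the common values in the definitions of the index
  and of the cover number of a chain exist.\<close>


section \<open>Weakly regular sequences and exact complexes\<close>

text \<open>An associated prime of \<open>I n : m\<close> is also associated to \<open>I n\<close>.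
  The monomial \<open>m\<close> collecting all exponent vectors can therefore be divided out in one
  stroke, and neither exact sequences between the iterated chains nor an induction over
  \<open>n\<close> is needed to bound the projective dimension. Two obstacles shape the rest.
  Quotient modules would leave the types on which resolutions live, so reduction modulo a sequence
  is expressed by congruences between elements of the original modules. And an exponent vector is
  tested at the single level \<open>r + k\<close> only, whereas \<open>m\<close> has to stay outside
  \<open>I n\<close> for every large \<open>n\<close>; this rests on generation of the chain from
  level \<open>r\<close> and on \<open>m\<close> living in the columns
  \<open>i + 1, \<dots>, i + k\<close>. The additive loss is
  \<open>g * (i + k + 2 ^ c * Q) + 1\<close>, where \<open>g\<close> is the value of
  \<open>\<Gamma>\<close> and \<open>Q\<close> a level containing the uncovered monomials: the first
  \<open>i + k\<close> columns are given up, each of at most \<open>2 ^ c\<close> small row sets may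
  occur in at most \<open>Q\<close> further columns, and \<open>1\<close> is the shift between an
  ideal and its residue ring.\<close>

definition lin_closed :: "('a, 'm) ring_scheme \<Rightarrow> ('a, 'b, 'n) module_scheme \<Rightarrow> 'b set \<Rightarrow> bool" where
  "lin_closed R M H \<longleftrightarrow> H \<subseteq> carrier M \<and> \<zero>\<^bsub>M\<^esub> \<in> H \<and>
     (\<forall>a\<in>H. \<forall>b\<in>H. a \<oplus>\<^bsub>M\<^esub> b \<in> H) \<and> (\<forall>r\<in>carrier R. \<forall>a\<in>H. r \<odot>\<^bsub>M\<^esub> a \<in> H)"

text \<open>This is the submodule \<open>(x1, ..., xs) M\<close>, unfolded one congruence at a time.
  The head acts modulo the tail, so the last entry of the list comes first in the regular
  sequence.\<close>

fun seq_mult :: "('a, 'b, 'n) module_scheme \<Rightarrow> 'a list \<Rightarrow> 'b set" where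
  "seq_mult M [] = {\<zero>\<^bsub>M\<^esub>}"
| "seq_mult M (x # xs) = {a \<in> carrier M. \<exists>b\<in>carrier M. a \<ominus>\<^bsub>M\<^esub> x \<odot>\<^bsub>M\<^esub> b \<in> seq_mult M xs}"

text \<open>No properness condition is imposed, so zero modules qualify; this is essential for the
  vanishing terms of a finite resolution.\<close>

fun weakly_regular :: "('a, 'b, 'n) module_scheme \<Rightarrow> 'a list \<Rightarrow> bool" where
  "weakly_regular M [] = True"
| "weakly_regular M (x # xs) = (weakly_regular M xs \<and>
     (\<forall>b\<in>carrier M. x \<odot>\<^bsub>M\<^esub> b \<in> seq_mult M xs \<longrightarrow> b \<in> seq_mult M xs))"

section \<open>Arithmetic in modules modulo a sequence\<close>

context Module.module
begin

lemma neg_smult: "x \<in> carrier M \<Longrightarrow> \<ominus>\<^bsub>M\<^esub> x = (\<ominus>\<^bsub>R\<^esub> \<one>\<^bsub>R\<^esub>) \<odot>\<^bsub>M\<^esub> x"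
  by (simp add: smult_l_minus)

lemma lin_closed_minus:
  assumes "lin_closed R M H" "a \<in> H" "b \<in> H" shows "a \<ominus>\<^bsub>M\<^esub> b \<in> H"
proof -
  have "(\<ominus>\<^bsub>R\<^esub> \<one>\<^bsub>R\<^esub>) \<odot>\<^bsub>M\<^esub> b \<in> H" using assms unfolding lin_closed_def by simp
  then show ?thesis using assms neg_smult[of b] unfolding lin_closed_def a_minus_def by auto
qed

lemma smult_minus_distr:
  assumes "r \<in> carrier R" "a \<in> carrier M" "b \<in> carrier M"
  shows "r \<odot>\<^bsub>M\<^esub> (a \<ominus>\<^bsub>M\<^esub> b) = r \<odot>\<^bsub>M\<^esub> a \<ominus>\<^bsub>M\<^esub> r \<odot>\<^bsub>M\<^esub> b"
  using assms by (simp add: a_minus_def smult_r_distr smult_r_minus)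

lemma smult_left_commute:
  assumes "r \<in> carrier R" "s \<in> carrier R" "a \<in> carrier M"
  shows "r \<odot>\<^bsub>M\<^esub> (s \<odot>\<^bsub>M\<^esub> a) = s \<odot>\<^bsub>M\<^esub> (r \<odot>\<^bsub>M\<^esub> a)"
  using assms by (metis smult_assoc1 R.m_comm)

lemma minus_zero_M: "\<ominus>\<^bsub>M\<^esub> \<zero>\<^bsub>M\<^esub> = \<zero>\<^bsub>M\<^esub>"
  using M.r_neg[of "\<zero>\<^bsub>M\<^esub>"] by simp

lemma minus_zero_right [simp]: "a \<in> carrier M \<Longrightarrow> a \<ominus>\<^bsub>M\<^esub> \<zero>\<^bsub>M\<^esub> = a"
  by (simp add: a_minus_def minus_zero_M)

lemma minus_eq_zero_iff:
  assumes "a \<in> carrier M" "b \<in> carrier M"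
  shows "a \<ominus>\<^bsub>M\<^esub> b = \<zero>\<^bsub>M\<^esub> \<longleftrightarrow> a = b"
  using assms by (metis M.add.inv_closed M.minus_equality M.minus_minus M.r_neg a_minus_def)

lemma add_minus_swap:
  assumes "a \<in> carrier M" "b \<in> carrier M" "c \<in> carrier M" "d \<in> carrier M"
  shows "(a \<oplus>\<^bsub>M\<^esub> b) \<ominus>\<^bsub>M\<^esub> (c \<oplus>\<^bsub>M\<^esub> d) = (a \<ominus>\<^bsub>M\<^esub> c) \<oplus>\<^bsub>M\<^esub> (b \<ominus>\<^bsub>M\<^esub> d)"
  using assms by (simp add: a_minus_def M.minus_add M.a_ac)

lemma minus_minus_comm:
  assumes "a \<in> carrier M" "b \<in> carrier M" "c \<in> carrier M"
  shows "(a \<ominus>\<^bsub>M\<^esub> b) \<ominus>\<^bsub>M\<^esub> c = (a \<ominus>\<^bsub>M\<^esub> c) \<ominus>\<^bsub>M\<^esub> b"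
  using assms by (simp add: a_minus_def M.a_ac)

lemma minus_plus_minus:
  assumes "a \<in> carrier M" "b \<in> carrier M" "c \<in> carrier M"
  shows "(a \<ominus>\<^bsub>M\<^esub> b) \<oplus>\<^bsub>M\<^esub> (b \<ominus>\<^bsub>M\<^esub> c) = a \<ominus>\<^bsub>M\<^esub> c"
proof -
  have "(a \<ominus>\<^bsub>M\<^esub> b) \<oplus>\<^bsub>M\<^esub> (b \<ominus>\<^bsub>M\<^esub> c) = a \<oplus>\<^bsub>M\<^esub> ((\<ominus>\<^bsub>M\<^esub> b) \<oplus>\<^bsub>M\<^esub> (b \<oplus>\<^bsub>M\<^esub> (\<ominus>\<^bsub>M\<^esub> c)))"
    using assms by (simp add: a_minus_def M.a_assoc)
  then show ?thesis using assms by (simp add: a_minus_def M.r_neg2 M.r_neg1)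
qed

lemma seq_mult_lin_closed:
  assumes "set xs \<subseteq> carrier R"
  shows "lin_closed R M (seq_mult M xs)"
  using assms
proof (induction xs)
  case Nil
  then show ?case by (simp add: lin_closed_def)
next
  case (Cons x xs)
  then have IH: "lin_closed R M (seq_mult M xs)" and x: "x \<in> carrier R" by auto
  have add: "a \<oplus>\<^bsub>M\<^esub> a' \<in> seq_mult M (x # xs)"
    if aa: "a \<in> seq_mult M (x # xs)" "a' \<in> seq_mult M (x # xs)" for a a'
  proof -
    obtain b where b: "b \<in> carrier M" "a \<ominus>\<^bsub>M\<^esub> x \<odot>\<^bsub>M\<^esub> b \<in> seq_mult M xs" "a \<in> carrier M" using aa by auto
    obtain b' where b': "b' \<in> carrier M" "a' \<ominus>\<^bsub>M\<^esub> x \<odot>\<^bsub>M\<^esub> b' \<in> seq_mult M xs" "a' \<in> carrier M" using aa by auto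
    have "(a \<oplus>\<^bsub>M\<^esub> a') \<ominus>\<^bsub>M\<^esub> x \<odot>\<^bsub>M\<^esub> (b \<oplus>\<^bsub>M\<^esub> b') \<in> seq_mult M xs"
      using IH b b' x by (simp add: smult_r_distr add_minus_swap lin_closed_def)
    then show ?thesis using b b' by (auto intro!: bexI[of _ "b \<oplus>\<^bsub>M\<^esub> b'"])
  qed
  have sm: "r \<odot>\<^bsub>M\<^esub> a \<in> seq_mult M (x # xs)" if ar: "a \<in> seq_mult M (x # xs)" "r \<in> carrier R" for a r
  proof -
    obtain b where b: "b \<in> carrier M" "a \<ominus>\<^bsub>M\<^esub> x \<odot>\<^bsub>M\<^esub> b \<in> seq_mult M xs" "a \<in> carrier M" using ar by auto
    have "r \<odot>\<^bsub>M\<^esub> (a \<ominus>\<^bsub>M\<^esub> x \<odot>\<^bsub>M\<^esub> b) = r \<odot>\<^bsub>M\<^esub> a \<ominus>\<^bsub>M\<^esub> x \<odot>\<^bsub>M\<^esub> (r \<odot>\<^bsub>M\<^esub> b)"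
      using b ar x by (simp add: smult_minus_distr smult_left_commute)
    moreover have "r \<odot>\<^bsub>M\<^esub> (a \<ominus>\<^bsub>M\<^esub> x \<odot>\<^bsub>M\<^esub> b) \<in> seq_mult M xs"
      using IH b ar by (simp add: lin_closed_def)
    ultimately show ?thesis using b ar by (auto intro!: bexI[of _ "r \<odot>\<^bsub>M\<^esub> b"])
  qed
  have "\<zero>\<^bsub>M\<^esub> \<in> seq_mult M (x # xs)"
    using IH x by (auto simp: lin_closed_def intro!: bexI[of _ "\<zero>\<^bsub>M\<^esub>"])
  then show ?case using add sm unfolding lin_closed_def by auto
qed

end

section \<open>Homomorphisms and retracts\<close>

lemma mod_hom_closed: "f \<in> mod_hom R M N \<Longrightarrow> a \<in> carrier M \<Longrightarrow> f a \<in> carrier N"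
  by (auto simp: mod_hom_def)

lemma mod_hom_zero:
  assumes "Module.module R M" "Module.module R N" "f \<in> mod_hom R M N"
  shows "f \<zero>\<^bsub>M\<^esub> = \<zero>\<^bsub>N\<^esub>"
proof -
  interpret M: Module.module R M by fact
  interpret N: Module.module R N by fact
  have "f (\<zero>\<^bsub>R\<^esub> \<odot>\<^bsub>M\<^esub> \<zero>\<^bsub>M\<^esub>) = \<zero>\<^bsub>R\<^esub> \<odot>\<^bsub>N\<^esub> f \<zero>\<^bsub>M\<^esub>"
    using assms(3) unfolding mod_hom_def by blast
  then show ?thesis using mod_hom_closed[OF assms(3), of "\<zero>\<^bsub>M\<^esub>"] by simp
qed

lemma mod_hom_minus:
  assumes "Module.module R M" "Module.module R N" "f \<in> mod_hom R M N" "a \<in> carrier M" "b \<in> carrier M"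
  shows "f (a \<ominus>\<^bsub>M\<^esub> b) = f a \<ominus>\<^bsub>N\<^esub> f b"
proof -
  interpret M: Module.module R M by fact
  interpret N: Module.module R N by fact
  have "f (a \<oplus>\<^bsub>M\<^esub> ((\<ominus>\<^bsub>R\<^esub> \<one>\<^bsub>R\<^esub>) \<odot>\<^bsub>M\<^esub> b)) = f a \<oplus>\<^bsub>N\<^esub> ((\<ominus>\<^bsub>R\<^esub> \<one>\<^bsub>R\<^esub>) \<odot>\<^bsub>N\<^esub> f b)"
    using assms unfolding mod_hom_def by simp
  then show ?thesis
    using assms mod_hom_closed[OF assms(3)] M.neg_smult N.neg_smult unfolding a_minus_def by metis
qed

lemma mod_hom_smult:
  "f \<in> mod_hom R M N \<Longrightarrow> r \<in> carrier R \<Longrightarrow> a \<in> carrier M \<Longrightarrow> f (r \<odot>\<^bsub>M\<^esub> a) = r \<odot>\<^bsub>N\<^esub> f a"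
  by (auto simp: mod_hom_def)

lemma mod_hom_seq_mult:
  assumes "Module.module R M" "Module.module R N" "f \<in> mod_hom R M N" "set xs \<subseteq> carrier R"
    "a \<in> seq_mult M xs"
  shows "f a \<in> seq_mult N xs"
  using assms(4,5)
proof (induction xs arbitrary: a)
  case Nil
  then show ?case using mod_hom_zero[OF assms(1-3)] by simp
next
  case (Cons x xs)
  then obtain b where b: "b \<in> carrier M" "a \<ominus>\<^bsub>M\<^esub> x \<odot>\<^bsub>M\<^esub> b \<in> seq_mult M xs" "a \<in> carrier M" by auto
  interpret M: Module.module R M by fact
  have "f (a \<ominus>\<^bsub>M\<^esub> x \<odot>\<^bsub>M\<^esub> b) = f a \<ominus>\<^bsub>N\<^esub> x \<odot>\<^bsub>N\<^esub> f b"
    using b Cons.prems mod_hom_minus[OF assms(1-3)] mod_hom_smult[OF assms(3)] by simp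
  then show ?case using b Cons mod_hom_closed[OF assms(3)] by auto (metis)
qed

text \<open>Homomorphisms respect \<open>seq_mult\<close>, so a relation
  \<open>x b \<in> (xs) P\<close> can be carried to \<open>N\<close> by \<open>h\<close>, cancelled
  there, and brought back by \<open>g\<close>.\<close>

lemma weakly_regular_retract:
  assumes "Module.module R P" "Module.module R N" "h \<in> mod_hom R P N" "g \<in> mod_hom R N P"
    "\<And>x. x \<in> carrier P \<Longrightarrow> g (h x) = x" "set xs \<subseteq> carrier R" "weakly_regular N xs"
  shows "weakly_regular P xs"
  using assms(6,7)
proof (induction xs)
  case (Cons x xs)
  have "b \<in> seq_mult P xs" if b: "b \<in> carrier P" "x \<odot>\<^bsub>P\<^esub> b \<in> seq_mult P xs" for b
  proof -
    have "h (x \<odot>\<^bsub>P\<^esub> b) \<in> seq_mult N xs"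
      using b Cons.prems by (intro mod_hom_seq_mult[OF assms(1-3)]) auto
    then have "x \<odot>\<^bsub>N\<^esub> h b \<in> seq_mult N xs"
      using b Cons.prems mod_hom_smult[OF assms(3)] by simp
    then have "h b \<in> seq_mult N xs" using Cons.prems mod_hom_closed[OF assms(3)] b by simp
    then have "g (h b) \<in> seq_mult P xs"
      using Cons.prems by (intro mod_hom_seq_mult[OF assms(2,1,4)]) auto
    then show ?thesis using assms(5) b by simp
  qed
  then show ?case using Cons by simp
qed simp

text \<open>Exactness is required in positive degrees only; the cokernel of \<open>d 0\<close> is
  the module under study. All terms share one carrier type, so a ring placed in degree zero has to
  be encoded on the type of the other terms.\<close>

locale mod_complex =
  fixes R :: "'a ring" and F :: "nat \<Rightarrow> ('a, 'b) module" and d :: "nat \<Rightarrow> 'b \<Rightarrow> 'b"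
  assumes mods: "Module.module R (F q)"
    and homs: "d q \<in> mod_hom R (F (Suc q)) (F q)"
    and exact: "mod_ker (F (Suc q)) (F q) (d q) = d (Suc q) ` carrier (F (Suc (Suc q)))"
begin

lemma d_closed [simp]: "a \<in> carrier (F (Suc q)) \<Longrightarrow> d q a \<in> carrier (F q)"
  using mod_hom_closed[OF homs] .

lemma d_d: "a \<in> carrier (F (Suc (Suc q))) \<Longrightarrow> d q (d (Suc q) a) = \<zero>\<^bsub>F q\<^esub>"
  using exact[of q] by (auto simp: mod_ker_def)

lemma d_minus: "a \<in> carrier (F (Suc q)) \<Longrightarrow> b \<in> carrier (F (Suc q)) \<Longrightarrow>
    d q (a \<ominus>\<^bsub>F (Suc q)\<^esub> b) = d q a \<ominus>\<^bsub>F q\<^esub> d q b"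
  using mod_hom_minus[OF mods mods homs] .

lemma d_smult: "r \<in> carrier R \<Longrightarrow> a \<in> carrier (F (Suc q)) \<Longrightarrow>
    d q (r \<odot>\<^bsub>F (Suc q)\<^esub> a) = r \<odot>\<^bsub>F q\<^esub> d q a"
  using mod_hom_smult[OF homs] .

lemma F_closed [simp]:
  "r \<in> carrier R \<Longrightarrow> a \<in> carrier (F q) \<Longrightarrow> r \<odot>\<^bsub>F q\<^esub> a \<in> carrier (F q)"
  "a \<in> carrier (F q) \<Longrightarrow> b \<in> carrier (F q) \<Longrightarrow> a \<ominus>\<^bsub>F q\<^esub> b \<in> carrier (F q)"
  by (fact module.smult_closed[OF mods], fact abelian_group.minus_closed[OF module.axioms(2)[OF mods]])

definition boundary_mod :: "nat \<Rightarrow> 'a list \<Rightarrow> 'b set" where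
  "boundary_mod q xs = {a \<in> carrier (F q). \<exists>p\<in>carrier (F (Suc q)). a \<ominus>\<^bsub>F q\<^esub> d q p \<in> seq_mult (F q) xs}"

text \<open>Each further regular element costs one degree of exactness, as in the long exact
  sequence of multiplication by \<open>x\<close>. The chase solves \<open>d a \<equiv> x b\<close>,
  corrects \<open>b\<close> to a boundary \<open>d b'\<close>, and applies the induction hypothesis
  to \<open>a - x b'\<close>.\<close>

lemma exact_mod:
  assumes "\<And>q. weakly_regular (F q) xs" "set xs \<subseteq> carrier R" "length xs \<le> q"
    "a \<in> carrier (F (Suc q))" "d q a \<in> seq_mult (F q) xs"
  shows "a \<in> boundary_mod (Suc q) xs"
  using assms
proof (induction xs arbitrary: q a)
  case Nil
  then have "a \<in> mod_ker (F (Suc q)) (F q) (d q)" by (simp add: mod_ker_def)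
  then obtain p where "p \<in> carrier (F (Suc (Suc q)))" "a = d (Suc q) p" using exact by auto
  then show ?case using Nil module.minus_eq_zero_iff[OF mods]
    by (auto simp: boundary_mod_def)
next
  case (Cons x xs)
  obtain q' where q: "q = Suc q'" "length xs \<le> q'" using Cons.prems(3) by (cases q) auto
  have wr: "weakly_regular (F q) xs" for q
    using Cons.prems(1)[of q] by (simp only: weakly_regular.simps)
  have reg: "b \<in> carrier (F q) \<Longrightarrow> x \<odot>\<^bsub>F q\<^esub> b \<in> seq_mult (F q) xs \<Longrightarrow> b \<in> seq_mult (F q) xs" for b q
    using Cons.prems(1)[of q] by (simp only: weakly_regular.simps)
  interpret G0: Module.module R "F q'" by (rule mods)
  interpret G1: Module.module R "F q" by (rule mods)
  interpret G2: Module.module R "F (Suc q)" by (rule mods)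
  have xs: "set xs \<subseteq> carrier R" and x: "x \<in> carrier R" using Cons.prems(2) by auto
  note S1 = G1.seq_mult_lin_closed[OF xs]
  note IH = Cons.IH[OF wr xs]
  note prems = Cons.prems(2-)
  obtain b where b: "b \<in> carrier (F q)" "d q a \<ominus>\<^bsub>F q\<^esub> x \<odot>\<^bsub>F q\<^esub> b \<in> seq_mult (F q) xs"
    using prems by auto
  \<comment> \<open>Applying the differential to \<open>d a \<equiv> x b\<close> leaves only the
    term with \<open>x b\<close>, so \<open>x d b\<close>, and by regularity \<open>d b\<close>,
    vanishes modulo \<open>xs\<close>.\<close>
  have "d q' (d q a \<ominus>\<^bsub>F q\<^esub> x \<odot>\<^bsub>F q\<^esub> b) \<in> seq_mult (F q') xs"
    using b(2) mod_hom_seq_mult[OF mods mods homs xs] q by simp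
  moreover have "d q' (d q a \<ominus>\<^bsub>F q\<^esub> x \<odot>\<^bsub>F q\<^esub> b) = \<ominus>\<^bsub>F q'\<^esub> (x \<odot>\<^bsub>F q'\<^esub> d q' b)"
  proof -
    have "d q' (d q a \<ominus>\<^bsub>F q\<^esub> x \<odot>\<^bsub>F q\<^esub> b) = d q' (d q a) \<ominus>\<^bsub>F q'\<^esub> x \<odot>\<^bsub>F q'\<^esub> d q' b"
      using b x prems q by (simp add: d_minus d_smult)
    moreover have "d q' (d q a) = \<zero>\<^bsub>F q'\<^esub>" using d_d[of a q'] prems q by simp
    ultimately show ?thesis using b x q by (simp add: a_minus_def)
  qed
  ultimately have "x \<odot>\<^bsub>F q'\<^esub> d q' b \<in> seq_mult (F q') xs"
    using G0.lin_closed_minus[OF G0.seq_mult_lin_closed[OF xs], of "\<zero>\<^bsub>F q'\<^esub>"]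
      G0.seq_mult_lin_closed[OF xs] b x q
    by (metis G0.M.minus_minus G0.neg_smult G0.smult_closed lin_closed_def d_closed
        G0.R.add.inv_closed G0.R.one_closed G0.M.add.inv_closed)
  then have "d q' b \<in> seq_mult (F q') xs" using reg[of "d q' b" q'] b q by simp
  then have "b \<in> boundary_mod (Suc q') xs" using IH[of q' b] b q by simp
  then obtain b' where b': "b' \<in> carrier (F (Suc q))" "b \<ominus>\<^bsub>F q\<^esub> d q b' \<in> seq_mult (F q) xs"
    using q by (auto simp: boundary_mod_def)
  have "x \<odot>\<^bsub>F q\<^esub> (b \<ominus>\<^bsub>F q\<^esub> d q b') \<in> seq_mult (F q) xs"
    using b' S1 x by (auto simp: lin_closed_def)
  then have "(d q a \<ominus>\<^bsub>F q\<^esub> x \<odot>\<^bsub>F q\<^esub> b) \<oplus>\<^bsub>F q\<^esub> (x \<odot>\<^bsub>F q\<^esub> b \<ominus>\<^bsub>F q\<^esub> x \<odot>\<^bsub>F q\<^esub> d q b') \<in> seq_mult (F q) xs"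
    using b b' S1 x by (auto simp: lin_closed_def G1.smult_minus_distr)
  then have "d q (a \<ominus>\<^bsub>F (Suc q)\<^esub> x \<odot>\<^bsub>F (Suc q)\<^esub> b') \<in> seq_mult (F q) xs"
    using b b' x prems by (simp add: G1.minus_plus_minus d_minus d_smult)
  then have "a \<ominus>\<^bsub>F (Suc q)\<^esub> x \<odot>\<^bsub>F (Suc q)\<^esub> b' \<in> boundary_mod (Suc q) xs"
    using IH[of q] prems b' x q by simp
  then obtain c where c: "c \<in> carrier (F (Suc (Suc q)))"
    "(a \<ominus>\<^bsub>F (Suc q)\<^esub> x \<odot>\<^bsub>F (Suc q)\<^esub> b') \<ominus>\<^bsub>F (Suc q)\<^esub> d (Suc q) c \<in> seq_mult (F (Suc q)) xs"
    by (auto simp: boundary_mod_def)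
  then have "a \<ominus>\<^bsub>F (Suc q)\<^esub> d (Suc q) c \<in> seq_mult (F (Suc q)) (x # xs)"
    using prems b' x G2.minus_minus_comm by (auto intro!: bexI[of _ b'])
  then show ?case using c prems by (auto simp: boundary_mod_def)
qed

text \<open>A connecting homomorphism made explicit: if \<open>x y\<close> is the boundary of
  \<open>y'\<close> modulo \<open>xs\<close>, then \<open>y'\<close> replaces \<open>y\<close> one
  degree further left. Annihilation by all of \<open>T\<close>, not just by \<open>xs\<close>, is
  carried through the induction because the next element must again kill the class.\<close>

lemma socle_element:
  assumes "\<And>q. weakly_regular (F q) xs" "set xs \<subseteq> T" "T \<subseteq> carrier R"
    "y0 \<in> carrier (F 0)" "y0 \<notin> d 0 ` carrier (F 1)"
    "\<And>x. x \<in> T \<Longrightarrow> x \<odot>\<^bsub>F 0\<^esub> y0 \<in> d 0 ` carrier (F 1)"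
  shows "\<exists>y\<in>carrier (F (length xs)). y \<notin> boundary_mod (length xs) xs \<and>
    (\<forall>x\<in>T. x \<odot>\<^bsub>F (length xs)\<^esub> y \<in> boundary_mod (length xs) xs)"
  using assms(1,2)
proof (induction xs)
  case Nil
  interpret Module.module R "F 0" by (rule mods)
  have "boundary_mod 0 [] = d 0 ` carrier (F 1)"
  proof
    show "boundary_mod 0 [] \<subseteq> d 0 ` carrier (F 1)" using minus_eq_zero_iff by (auto simp: boundary_mod_def)
    show "d 0 ` carrier (F 1) \<subseteq> boundary_mod 0 []" 
    proof
      fix a assume "a \<in> d 0 ` carrier (F 1)"
      then obtain p where p: "p \<in> carrier (F 1)" "a = d 0 p" by auto
      then have "a \<ominus>\<^bsub>F 0\<^esub> d 0 p = \<zero>\<^bsub>F 0\<^esub>" by (simp add: a_minus_def M.r_neg)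
      then show "a \<in> boundary_mod 0 []" using p by (auto simp: boundary_mod_def)
    qed
  qed
  then show ?case using assms by auto
next
  case (Cons x xs)
  define s where "s = length xs"
  have wr: "weakly_regular (F q) xs" for q
    using Cons.prems(1)[of q] by (simp only: weakly_regular.simps)
  have reg: "b \<in> carrier (F q) \<Longrightarrow> x \<odot>\<^bsub>F q\<^esub> b \<in> seq_mult (F q) xs \<Longrightarrow> b \<in> seq_mult (F q) xs" for b q
    using Cons.prems(1)[of q] by (simp only: weakly_regular.simps)
  obtain y where y: "y \<in> carrier (F s)" "y \<notin> boundary_mod s xs" "\<And>x. x \<in> T \<Longrightarrow> x \<odot>\<^bsub>F s\<^esub> y \<in> boundary_mod s xs"
    using Cons.IH wr Cons.prems(2) s_def by auto
  have xs: "set xs \<subseteq> carrier R" and x: "x \<in> carrier R" and xT: "x \<in> T" using Cons.prems(2) assms(3) by auto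
  then have xxs: "set (x # xs) \<subseteq> carrier R" by simp
  interpret G0: Module.module R "F s" by (rule mods)
  interpret G1: Module.module R "F (Suc s)" by (rule mods)
  note S0 = G0.seq_mult_lin_closed[OF xs]
  obtain y' where y': "y' \<in> carrier (F (Suc s))" "x \<odot>\<^bsub>F s\<^esub> y \<ominus>\<^bsub>F s\<^esub> d s y' \<in> seq_mult (F s) xs"
    using y(3)[OF xT] by (auto simp: boundary_mod_def)
  \<comment> \<open>From \<open>y' \<equiv> d p + x b\<close> it would follow that
    \<open>x (y - d b) \<equiv> 0\<close> modulo \<open>xs\<close>, and regularity of
    \<open>x\<close> would make \<open>y\<close> a boundary.\<close>
  have "y' \<notin> boundary_mod (Suc s) (x # xs)"
  proof
    assume "y' \<in> boundary_mod (Suc s) (x # xs)"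
    then obtain p b where p: "p \<in> carrier (F (Suc (Suc s)))" and b: "b \<in> carrier (F (Suc s))"
      and *: "(y' \<ominus>\<^bsub>F (Suc s)\<^esub> d (Suc s) p) \<ominus>\<^bsub>F (Suc s)\<^esub> x \<odot>\<^bsub>F (Suc s)\<^esub> b \<in> seq_mult (F (Suc s)) xs"
      by (auto simp: boundary_mod_def)
    from mod_hom_seq_mult[OF mods mods homs xs *]
    have "d s y' \<ominus>\<^bsub>F s\<^esub> x \<odot>\<^bsub>F s\<^esub> d s b \<in> seq_mult (F s) xs"
      using p b x y' by (simp add: d_minus d_smult d_d)
    then have "(x \<odot>\<^bsub>F s\<^esub> y \<ominus>\<^bsub>F s\<^esub> d s y') \<oplus>\<^bsub>F s\<^esub> (d s y' \<ominus>\<^bsub>F s\<^esub> x \<odot>\<^bsub>F s\<^esub> d s b) \<in> seq_mult (F s) xs"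
      using S0 y' by (auto simp: lin_closed_def)
    then have "x \<odot>\<^bsub>F s\<^esub> (y \<ominus>\<^bsub>F s\<^esub> d s b) \<in> seq_mult (F s) xs"
      using y y' b x by (simp add: G0.minus_plus_minus G0.smult_minus_distr)
    then have "y \<ominus>\<^bsub>F s\<^esub> d s b \<in> seq_mult (F s) xs" using reg y b by simp
    then show False using y b by (auto simp: boundary_mod_def)
  qed
  \<comment> \<open>With \<open>v y \<equiv> d p\<close> the element \<open>v y' - x p\<close> is a
    cycle modulo \<open>xs\<close>, its differential being \<open>v x y - x v y\<close>. Then
    \<open>exact_mod\<close> applies, its bound \<open>length xs \<le> s\<close> holding with
    equality.\<close>
  moreover have "v \<odot>\<^bsub>F (Suc s)\<^esub> y' \<in> boundary_mod (Suc s) (x # xs)" if vT: "v \<in> T" for v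
  proof -
    have v: "v \<in> carrier R" using vT assms by auto
    obtain p where p: "p \<in> carrier (F (Suc s))" "v \<odot>\<^bsub>F s\<^esub> y \<ominus>\<^bsub>F s\<^esub> d s p \<in> seq_mult (F s) xs"
      using y(3)[OF vT] by (auto simp: boundary_mod_def)
    have 1: "v \<odot>\<^bsub>F s\<^esub> (x \<odot>\<^bsub>F s\<^esub> y \<ominus>\<^bsub>F s\<^esub> d s y') \<in> seq_mult (F s) xs"
      using S0 y' v by (auto simp: lin_closed_def)
    have 2: "x \<odot>\<^bsub>F s\<^esub> (v \<odot>\<^bsub>F s\<^esub> y \<ominus>\<^bsub>F s\<^esub> d s p) \<in> seq_mult (F s) xs"
      using S0 p x by (auto simp: lin_closed_def)
    let ?m = "v \<odot>\<^bsub>F s\<^esub> (x \<odot>\<^bsub>F s\<^esub> y)"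
    have m1: "?m \<ominus>\<^bsub>F s\<^esub> v \<odot>\<^bsub>F s\<^esub> d s y' \<in> seq_mult (F s) xs"
      using 1 v x y y' by (simp add: G0.smult_minus_distr)
    have m2: "?m \<ominus>\<^bsub>F s\<^esub> x \<odot>\<^bsub>F s\<^esub> d s p \<in> seq_mult (F s) xs"
      using 2 v x y p by (simp add: G0.smult_minus_distr G0.smult_left_commute[of x v y])
    have neg: "v \<odot>\<^bsub>F s\<^esub> d s y' \<ominus>\<^bsub>F s\<^esub> ?m \<in> seq_mult (F s) xs"
    proof -
      have "\<zero>\<^bsub>F s\<^esub> \<ominus>\<^bsub>F s\<^esub> (?m \<ominus>\<^bsub>F s\<^esub> v \<odot>\<^bsub>F s\<^esub> d s y') = v \<odot>\<^bsub>F s\<^esub> d s y' \<ominus>\<^bsub>F s\<^esub> ?m"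
        using v x y y' by (simp add: a_minus_def G0.M.minus_add G0.M.a_ac)
      then show ?thesis using G0.lin_closed_minus[OF S0 _ m1, of "\<zero>\<^bsub>F s\<^esub>"] S0
        by (simp add: lin_closed_def)
    qed
    then have "(v \<odot>\<^bsub>F s\<^esub> d s y' \<ominus>\<^bsub>F s\<^esub> ?m) \<oplus>\<^bsub>F s\<^esub> (?m \<ominus>\<^bsub>F s\<^esub> x \<odot>\<^bsub>F s\<^esub> d s p) \<in> seq_mult (F s) xs"
      using m2 S0 by (auto simp: lin_closed_def)
    then have "d s (v \<odot>\<^bsub>F (Suc s)\<^esub> y' \<ominus>\<^bsub>F (Suc s)\<^esub> x \<odot>\<^bsub>F (Suc s)\<^esub> p) \<in> seq_mult (F s) xs"
      using v x y y' p by (simp add: G0.minus_plus_minus d_minus d_smult)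
    then have "v \<odot>\<^bsub>F (Suc s)\<^esub> y' \<ominus>\<^bsub>F (Suc s)\<^esub> x \<odot>\<^bsub>F (Suc s)\<^esub> p \<in> boundary_mod (Suc s) xs"
      using exact_mod[of xs s] wr xs v x y' p s_def by simp
    then obtain c where c: "c \<in> carrier (F (Suc (Suc s)))" 
      "(v \<odot>\<^bsub>F (Suc s)\<^esub> y' \<ominus>\<^bsub>F (Suc s)\<^esub> x \<odot>\<^bsub>F (Suc s)\<^esub> p) \<ominus>\<^bsub>F (Suc s)\<^esub> d (Suc s) c \<in> seq_mult (F (Suc s)) xs"
      by (auto simp: boundary_mod_def)
    then have "v \<odot>\<^bsub>F (Suc s)\<^esub> y' \<ominus>\<^bsub>F (Suc s)\<^esub> d (Suc s) c \<in> seq_mult (F (Suc s)) (x # xs)"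
      using v y' p x G1.minus_minus_comm by (auto intro!: bexI[of _ p])
    then show ?thesis using c v y' by (auto simp: boundary_mod_def)
  qed
  ultimately show ?case using y' s_def by auto
qed

lemma complex_length:
  assumes "\<And>q. weakly_regular (F q) xs" "set xs \<subseteq> T" "T \<subseteq> carrier R"
    "y0 \<in> carrier (F 0)" "y0 \<notin> d 0 ` carrier (F 1)"
    "\<And>x. x \<in> T \<Longrightarrow> x \<odot>\<^bsub>F 0\<^esub> y0 \<in> d 0 ` carrier (F 1)"
  shows "carrier (F (length xs)) \<noteq> {\<zero>\<^bsub>F (length xs)\<^esub>}"
proof
  let ?s = "length xs"
  assume *: "carrier (F ?s) = {\<zero>\<^bsub>F ?s\<^esub>}"
  obtain y where y: "y \<in> carrier (F ?s)" "y \<notin> boundary_mod ?s xs"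
    using socle_element[of xs T y0] assms by blast
  interpret G0: Module.module R "F ?s" by (rule mods)
  interpret G1: Module.module R "F (Suc ?s)" by (rule mods)
  have "y \<ominus>\<^bsub>F ?s\<^esub> d ?s \<zero>\<^bsub>F (Suc ?s)\<^esub> = \<zero>\<^bsub>F ?s\<^esub>"
    using mod_hom_zero[OF mods mods homs, of ?s] y * by (auto simp: a_minus_def)
  moreover have "\<zero>\<^bsub>F ?s\<^esub> \<in> seq_mult (F ?s) xs"
    using G0.seq_mult_lin_closed[of xs] assms(2,3) unfolding lin_closed_def by blast
  ultimately show False
    using y G1.M.zero_closed unfolding boundary_mod_def by (metis (no_types, lifting) mem_Collect_eq)
qed

end


section \<open>Projective modules and lengths of resolutions\<close>

definition fun_module :: "'a ring \<Rightarrow> ('i \<Rightarrow> 'a) set \<Rightarrow> ('a, 'i \<Rightarrow> 'a) module" where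
  "fun_module R C = \<lparr>carrier = C, monoid.mult = (\<lambda>f g. f), one = (\<lambda>_. \<zero>\<^bsub>R\<^esub>), zero = (\<lambda>_. \<zero>\<^bsub>R\<^esub>),
     add = (\<lambda>f g x. f x \<oplus>\<^bsub>R\<^esub> g x), smult = (\<lambda>r f x. r \<otimes>\<^bsub>R\<^esub> f x)\<rparr>"

lemma fun_module_simps [simp]:
  "carrier (fun_module R C) = C"
  "\<zero>\<^bsub>fun_module R C\<^esub> = (\<lambda>_. \<zero>\<^bsub>R\<^esub>)"
  "f \<oplus>\<^bsub>fun_module R C\<^esub> g = (\<lambda>x. f x \<oplus>\<^bsub>R\<^esub> g x)"
  "r \<odot>\<^bsub>fun_module R C\<^esub> f = (\<lambda>x. r \<otimes>\<^bsub>R\<^esub> f x)"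
  by (simp_all add: fun_module_def)

lemma ideal_module_simps [simp]:
  "carrier (ideal_module R J) = J"
  "\<zero>\<^bsub>ideal_module R J\<^esub> = \<zero>\<^bsub>R\<^esub>"
  "f \<oplus>\<^bsub>ideal_module R J\<^esub> g = f \<oplus>\<^bsub>R\<^esub> g"
  "r \<odot>\<^bsub>ideal_module R J\<^esub> f = r \<otimes>\<^bsub>R\<^esub> f"
  by (simp_all add: ideal_module_def)

lemma ideal_module_module:
  assumes "cring R" "ideal J R" shows "Module.module R (ideal_module R J)"
proof -
  interpret cring R by fact
  interpret J: ideal J R by fact
  have "abelian_group (ideal_module R J)"
    by (rule abelian_groupI)
      (auto simp: a_ac J.a_Hcarr J.a_closed intro!: bexI[of _ "\<ominus>\<^bsub>R\<^esub> x" for x] r_neg)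
  then show ?thesis
    using assms(1) by (intro moduleI) (auto simp: J.I_l_closed J.a_Hcarr l_distr r_distr m_assoc)
qed

text \<open>Closure under composition with pointed self-maps of \<open>R\<close> makes it possible to solve
  equations over \<open>R\<close> componentwise without leaving \<open>C\<close>.\<close>

locale fun_space = cring R for R :: "'a ring" (structure) +
  fixes C :: "('i \<Rightarrow> 'a) set"
  assumes in_carrier: "f \<in> C \<Longrightarrow> f x \<in> carrier R"
    and zero_mem: "(\<lambda>_. \<zero>) \<in> C"
    and add_mem: "f \<in> C \<Longrightarrow> g \<in> C \<Longrightarrow> (\<lambda>x. f x \<oplus> g x) \<in> C"
    and comp_mem: "f \<in> C \<Longrightarrow> h \<in> carrier R \<rightarrow> carrier R \<Longrightarrow> h \<zero> = \<zero> \<Longrightarrow> (\<lambda>x. h (f x)) \<in> C"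
begin

lemma neg_mem: "f \<in> C \<Longrightarrow> (\<lambda>x. \<ominus> f x) \<in> C"
  using comp_mem[of f "a_inv R"] by simp

lemma minus_mem: "f \<in> C \<Longrightarrow> g \<in> C \<Longrightarrow> (\<lambda>x. f x \<ominus> g x) \<in> C"
  using add_mem[of f "\<lambda>x. \<ominus> g x"] neg_mem by (simp add: a_minus_def)

lemma smult_mem: "r \<in> carrier R \<Longrightarrow> f \<in> C \<Longrightarrow> (\<lambda>x. r \<otimes> f x) \<in> C"
  using comp_mem[of f "\<lambda>y. r \<otimes> y"] by simp

lemma abelian_group_fun: "abelian_group (fun_module R C)"
proof (rule abelian_groupI)
  fix f assume f: "f \<in> carrier (fun_module R C)"
  then show "\<exists>g\<in>carrier (fun_module R C). g \<oplus>\<^bsub>fun_module R C\<^esub> f = \<zero>\<^bsub>fun_module R C\<^esub>"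
    by (intro bexI[of _ "\<lambda>x. \<ominus> f x"]) (auto simp: neg_mem in_carrier l_neg)
qed (auto simp: zero_mem add_mem in_carrier a_ac)

lemma module_fun: "Module.module R (fun_module R C)"
  by (intro moduleI abelian_group_fun is_cring)
    (auto simp: smult_mem in_carrier l_distr r_distr m_assoc)

lemma minus_fun:
  assumes "f \<in> C" "g \<in> C"
  shows "f \<ominus>\<^bsub>fun_module R C\<^esub> g = (\<lambda>x. f x \<ominus> g x)"
proof -
  interpret M: Module.module R "fun_module R C" by (rule module_fun)
  have "\<ominus>\<^bsub>fun_module R C\<^esub> g = (\<lambda>x. \<ominus> g x)"
    using assms by (intro M.M.minus_equality) (auto simp: neg_mem in_carrier l_neg)
  then show ?thesis by (simp add: a_minus_def)
qed

abbreviation "Rmod \<equiv> ideal_module R (carrier R)"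

lemma minus_Rmod: "a \<in> carrier R \<Longrightarrow> b \<in> carrier R \<Longrightarrow> a \<ominus>\<^bsub>Rmod\<^esub> b = a \<ominus> b"
proof -
  assume *: "a \<in> carrier R" "b \<in> carrier R"
  interpret M: Module.module R Rmod by (rule ideal_module_module[OF is_cring oneideal])
  have "\<ominus>\<^bsub>Rmod\<^esub> b = \<ominus> b" using * by (intro M.M.minus_equality) (auto simp: l_neg)
  then show ?thesis by (simp add: a_minus_def)
qed

lemma seq_mult_fun:
  assumes "set xs \<subseteq> carrier R"
  shows "seq_mult (fun_module R C) xs = {f \<in> C. \<forall>x. f x \<in> seq_mult Rmod xs}"
  using assms
proof (induction xs)
  case Nil
  then show ?case by (auto simp: zero_mem)
next
  case (Cons y ys)
  interpret M: Module.module R Rmod by (rule ideal_module_module[OF is_cring oneideal])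
  have y: "y \<in> carrier R" and ys: "set ys \<subseteq> carrier R" using Cons.prems by auto
  have IH: "seq_mult (fun_module R C) ys = {f \<in> C. \<forall>x. f x \<in> seq_mult Rmod ys}" using Cons by simp
  show ?case
  proof (intro equalityI subsetI)
    fix f assume "f \<in> seq_mult (fun_module R C) (y # ys)"
    then obtain g where "f \<in> C" "g \<in> C" "\<And>x. f x \<ominus> y \<otimes> g x \<in> seq_mult Rmod ys"
      using y by (auto simp: IH minus_fun smult_mem)
    then show "f \<in> {f \<in> C. \<forall>x. f x \<in> seq_mult Rmod (y # ys)}"
      using y by (auto simp: in_carrier minus_Rmod intro!: bexI[of _ "g x" for x])
  next
    fix f assume f: "f \<in> {f \<in> C. \<forall>x. f x \<in> seq_mult Rmod (y # ys)}"
    \<comment> \<open>The solution is chosen as a function of the value \<open>a\<close>, not of the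
      index, and sends zero to zero; hence \<open>comp_mem\<close> keeps its composition with
      \<open>f\<close> inside \<open>C\<close>.\<close>
    define h where "h a = (if a = \<zero> \<or> a \<notin> seq_mult Rmod (y # ys) then \<zero>
      else SOME b. b \<in> carrier R \<and> a \<ominus> y \<otimes> b \<in> seq_mult Rmod ys)" for a
    have zero: "\<zero> \<in> seq_mult Rmod ys"
      using M.seq_mult_lin_closed[OF ys] by (simp add: lin_closed_def)
    have h: "h a \<in> carrier R \<and> a \<ominus> y \<otimes> h a \<in> seq_mult Rmod ys"
      if a: "a \<in> seq_mult Rmod (y # ys)" for a
    proof (cases "a = \<zero>")
      case True
      then show ?thesis using zero y r_neg[of \<zero>] by (simp add: h_def a_minus_def)
    next
      case False
      have "\<exists>b. b \<in> carrier R \<and> a \<ominus> y \<otimes> b \<in> seq_mult Rmod ys"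
        using a y by (auto simp: minus_Rmod)
      from someI_ex[OF this] show ?thesis using False a by (simp add: h_def)
    qed
    have hc: "h \<in> carrier R \<rightarrow> carrier R"
    proof
      show "h a \<in> carrier R" for a
        using h[of a] by (cases "a \<in> seq_mult Rmod (y # ys)") (auto simp: h_def)
    qed
    have h0: "h \<zero> = \<zero>" by (simp add: h_def)
    have "(\<lambda>x. h (f x)) \<in> C" using comp_mem[OF _ hc h0] f by blast
    moreover have "\<And>x. f x \<ominus> y \<otimes> h (f x) \<in> seq_mult Rmod ys" using h f by blast
    ultimately show "f \<in> seq_mult (fun_module R C) (y # ys)"
      using f y by (auto simp: IH minus_fun smult_mem minus_mem intro!: bexI[of _ "\<lambda>x. h (f x)"])
  qed
qed

lemma weakly_regular_fun:
  assumes "set xs \<subseteq> carrier R" "weakly_regular Rmod xs"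
  shows "weakly_regular (fun_module R C) xs"
  using assms by (induction xs) (auto simp: seq_mult_fun in_carrier)

end

section \<open>Free modules, and projective modules as their retracts\<close>

definition free_space :: "'a ring \<Rightarrow> 'b set \<Rightarrow> ('b \<Rightarrow> 'a) set" where
  "free_space R B = {f. (\<forall>x. f x \<in> carrier R) \<and> finite {x. f x \<noteq> \<zero>\<^bsub>R\<^esub>} \<and> {x. f x \<noteq> \<zero>\<^bsub>R\<^esub>} \<subseteq> B}"

lemma fun_space_free: "cring R \<Longrightarrow> fun_space R (free_space R B)"
proof -
  assume "cring R"
  then interpret cring R .
  show ?thesis
  proof
    fix f g assume f: "f \<in> free_space R B" and g: "g \<in> free_space R B"
    have "{x. f x \<oplus>\<^bsub>R\<^esub> g x \<noteq> \<zero>\<^bsub>R\<^esub>} \<subseteq> {x. f x \<noteq> \<zero>\<^bsub>R\<^esub>} \<union> {x. g x \<noteq> \<zero>\<^bsub>R\<^esub>}" by auto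
    then show "(\<lambda>x. f x \<oplus>\<^bsub>R\<^esub> g x) \<in> free_space R B"
      using f g unfolding free_space_def by (auto intro: finite_subset)
  next
    fix f and h :: "'a \<Rightarrow> 'a"
    assume f: "f \<in> free_space R B" and h: "h \<in> carrier R \<rightarrow> carrier R" "h \<zero>\<^bsub>R\<^esub> = \<zero>\<^bsub>R\<^esub>"
    have "{x. h (f x) \<noteq> \<zero>\<^bsub>R\<^esub>} \<subseteq> {x. f x \<noteq> \<zero>\<^bsub>R\<^esub>}" using h by auto
    then show "(\<lambda>x. h (f x)) \<in> free_space R B"
      using f h unfolding free_space_def by (auto intro: finite_subset)
  qed (auto simp: free_space_def)
qed

text \<open>Constant functions form a copy of \<open>R\<close> on a function type, which lets
  \<open>R\<close> serve as degree zero of a complex whose other terms come from a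
  resolution.\<close>

lemma fun_space_const: "cring R \<Longrightarrow> fun_space R ((\<lambda>a _. a) ` carrier R)"
proof -
  assume "cring R"
  then interpret cring R .
  show ?thesis by unfold_locales (auto simp: image_iff)
qed

text \<open>The canonical surjection onto \<open>P\<close> from the free module on its underlying
  set, sending the basis element of \<open>x\<close> to \<open>x\<close>.\<close>

definition eval_free :: "'a ring \<Rightarrow> ('a, 'b) module \<Rightarrow> ('b \<Rightarrow> 'a) \<Rightarrow> 'b" where
  "eval_free R P f = finsum P (\<lambda>x. f x \<odot>\<^bsub>P\<^esub> x) {x \<in> carrier P. f x \<noteq> \<zero>\<^bsub>R\<^esub>}"

lemma eval_free_superset:
  assumes "Module.module R P" "f \<in> free_space R (carrier P)" "finite A" "A \<subseteq> carrier P"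
    "{x. f x \<noteq> \<zero>\<^bsub>R\<^esub>} \<subseteq> A"
  shows "eval_free R P f = finsum P (\<lambda>x. f x \<odot>\<^bsub>P\<^esub> x) A"
proof -
  interpret Module.module R P by fact
  show ?thesis unfolding eval_free_def
    using assms
    by (intro M.add.finprod_mono_neutral_cong_left) (auto simp: free_space_def subset_iff)
qed

lemma eval_free_hom:
  assumes "Module.module R P"
  shows "eval_free R P \<in> mod_hom R (fun_module R (free_space R (carrier P))) P"
proof -
  interpret Module.module R P by fact
  interpret fun_space R "free_space R (carrier P)" by (rule fun_space_free[OF R.is_cring])
  let ?C = "free_space R (carrier P)"
  have fin: "finite {x. f x \<noteq> \<zero>\<^bsub>R\<^esub>}" "{x. f x \<noteq> \<zero>\<^bsub>R\<^esub>} \<subseteq> carrier P" if "f \<in> ?C" for f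
    using that by (auto simp: free_space_def)
  have closed: "eval_free R P f \<in> carrier P" if "f \<in> ?C" for f
    unfolding eval_free_def using that in_carrier by (intro M.finsum_closed) auto
  have add: "eval_free R P (\<lambda>x. f x \<oplus>\<^bsub>R\<^esub> g x) = eval_free R P f \<oplus>\<^bsub>P\<^esub> eval_free R P g"
    if f: "f \<in> ?C" and g: "g \<in> ?C" for f g
  proof -
    let ?A = "{x. f x \<noteq> \<zero>\<^bsub>R\<^esub>} \<union> {x. g x \<noteq> \<zero>\<^bsub>R\<^esub>}"
    have A: "finite ?A" "?A \<subseteq> carrier P" using fin[OF f] fin[OF g] by auto
    have "eval_free R P (\<lambda>x. f x \<oplus>\<^bsub>R\<^esub> g x) = finsum P (\<lambda>x. (f x \<oplus>\<^bsub>R\<^esub> g x) \<odot>\<^bsub>P\<^esub> x) ?A"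
      using A f g by (intro eval_free_superset[OF assms add_mem]) auto
    also have "\<dots> = finsum P (\<lambda>x. f x \<odot>\<^bsub>P\<^esub> x \<oplus>\<^bsub>P\<^esub> g x \<odot>\<^bsub>P\<^esub> x) ?A"
      using A in_carrier[OF f] in_carrier[OF g]
      by (intro M.finsum_cong') (auto simp: smult_l_distr subset_iff)
    also have "\<dots> = finsum P (\<lambda>x. f x \<odot>\<^bsub>P\<^esub> x) ?A \<oplus>\<^bsub>P\<^esub> finsum P (\<lambda>x. g x \<odot>\<^bsub>P\<^esub> x) ?A"
      using A in_carrier[OF f] in_carrier[OF g] by (intro M.finsum_addf) auto
    also have "\<dots> = eval_free R P f \<oplus>\<^bsub>P\<^esub> eval_free R P g"
      using A by (subst (1 2) eval_free_superset[OF assms, of _ ?A]) (auto simp: f g)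
    finally show ?thesis .
  qed
  have smult: "eval_free R P (\<lambda>x. r \<otimes>\<^bsub>R\<^esub> f x) = r \<odot>\<^bsub>P\<^esub> eval_free R P f"
    if f: "f \<in> ?C" and r: "r \<in> carrier R" for f r
  proof -
    let ?A = "{x. f x \<noteq> \<zero>\<^bsub>R\<^esub>}"
    have "eval_free R P (\<lambda>x. r \<otimes>\<^bsub>R\<^esub> f x) = finsum P (\<lambda>x. (r \<otimes>\<^bsub>R\<^esub> f x) \<odot>\<^bsub>P\<^esub> x) ?A"
      using fin[OF f] r by (intro eval_free_superset[OF assms smult_mem[OF r f]]) auto
    also have "\<dots> = finsum P (\<lambda>x. r \<odot>\<^bsub>P\<^esub> (f x \<odot>\<^bsub>P\<^esub> x)) ?A"
      using fin[OF f] in_carrier[OF f] r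
      by (intro M.finsum_cong') (auto simp: smult_assoc1 subset_iff)
    also have "\<dots> = r \<odot>\<^bsub>P\<^esub> finsum P (\<lambda>x. f x \<odot>\<^bsub>P\<^esub> x) ?A"
      using fin[OF f] in_carrier[OF f] r by (intro finsum_smult_ldistr[symmetric]) auto
    also have "\<dots> = r \<odot>\<^bsub>P\<^esub> eval_free R P f"
      using fin[OF f] by (subst eval_free_superset[OF assms f, of ?A]) auto
    finally show ?thesis .
  qed
  show ?thesis unfolding mod_hom_def using closed add smult by auto
qed

lemma eval_free_surj:
  assumes "Module.module R P"
  shows "eval_free R P ` free_space R (carrier P) = carrier P"
proof -
  interpret Module.module R P by fact
  have "x \<in> eval_free R P ` free_space R (carrier P)" if x: "x \<in> carrier P" for x
  proof -
    define f where "f = (\<lambda>y. if y = x then \<one>\<^bsub>R\<^esub> else \<zero>\<^bsub>R\<^esub>)"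
    have f: "f \<in> free_space R (carrier P)"
      using x by (auto simp: f_def free_space_def intro: finite_subset[of _ "{x}"])
    have "eval_free R P f = finsum P (\<lambda>y. f y \<odot>\<^bsub>P\<^esub> y) {x}"
      using x by (intro eval_free_superset[OF assms f]) (auto simp: f_def)
    also have "\<dots> = x" using x by (simp add: f_def)
    finally show ?thesis using f by (metis image_eqI)
  qed
  then show ?thesis using mod_hom_closed[OF eval_free_hom[OF assms]] by auto
qed

lemma projective_weakly_regular:
  fixes P :: "('a, 'b) module"
  assumes "projective_module R P" "set xs \<subseteq> carrier R" "weakly_regular (ideal_module R (carrier R)) xs"
  shows "weakly_regular P xs"
proof -
  have P: "Module.module R P" using assms(1) by (simp add: projective_module_def)
  interpret Module.module R P by (rule P)
  interpret C: fun_space R "free_space R (carrier P)" by (rule fun_space_free[OF R.is_cring])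
  let ?N = "fun_module R (free_space R (carrier P))"
  have "(\<lambda>x. x) \<in> mod_hom R P P" by (auto simp: mod_hom_def)
  then have "\<exists>h\<in>mod_hom R P ?N. \<forall>x\<in>carrier P. eval_free R P (h x) = x"
    using assms(1) C.module_fun eval_free_hom[OF P] eval_free_surj[OF P] P
    unfolding projective_module_def by (metis (no_types, lifting) fun_module_simps(1))
  then obtain h where h: "h \<in> mod_hom R P ?N" "\<And>x. x \<in> carrier P \<Longrightarrow> eval_free R P (h x) = x" by auto
  show ?thesis
    by (rule weakly_regular_retract[OF P C.module_fun h(1) eval_free_hom[OF P]])
      (use h(2) C.weakly_regular_fun assms(2,3) in auto)
qed

text \<open>The resolution is prolonged by \<open>R\<close>, so that the cokernel becomes
  \<open>R / J\<close> and \<open>w\<close> a nonzero class killed by the sequence. The prolongation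
  shifts degrees by one, whence \<open>d + 1\<close>.\<close>

lemma proj_resolution_length:
  fixes R :: "'a ring"
  assumes "cring R" "ideal J R" "proj_resolution R (ideal_module R J) d P \<delta> \<epsilon>"
    "set xs \<subseteq> carrier R" "weakly_regular (ideal_module R (carrier R)) xs"
    "w \<in> carrier R" "w \<notin> J" "\<And>x. x \<in> set xs \<Longrightarrow> x \<otimes>\<^bsub>R\<^esub> w \<in> J"
  shows "length xs \<le> d + 1"
proof -
  interpret cring R by fact
  interpret J: ideal J R by fact
  define E :: "(nat \<Rightarrow> 'a) set" where "E = (\<lambda>a _. a) ` carrier R"
  interpret E: fun_space R E unfolding E_def by (rule fun_space_const[OF assms(1)])
  define F where "F q = (case q of 0 \<Rightarrow> fun_module R E | Suc k \<Rightarrow> P k)" for q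
  define dd where "dd q = (case q of 0 \<Rightarrow> (\<lambda>y _. \<epsilon> y) | Suc k \<Rightarrow> \<delta> k)" for q
  note res = assms(3)[unfolded proj_resolution_def]
  have eps: "\<epsilon> \<in> mod_hom R (P 0) (ideal_module R J)" using res by blast
  have epsJ: "\<epsilon> ` carrier (P 0) = J" using res by simp
  interpret mod_complex R F dd
  proof (rule mod_complex.intro)
    fix q
    show "Module.module R (F q)"
      using res E.module_fun by (auto simp: F_def projective_module_def split: nat.split)
    show "dd q \<in> mod_hom R (F (Suc q)) (F q)"
      using res eps J.a_Hcarr by (cases q) (auto simp: F_def dd_def mod_hom_def E_def)
    show "mod_ker (F (Suc q)) (F q) (dd q) = dd (Suc q) ` carrier (F (Suc (Suc q)))"
      using res by (cases q) (auto simp: F_def dd_def mod_ker_def fun_eq_iff)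
  qed
  have im: "dd 0 ` carrier (F 1) = (\<lambda>a _. a) ` J"
    using epsJ by (auto simp: F_def dd_def)
  have "carrier (F (length xs)) \<noteq> {\<zero>\<^bsub>F (length xs)\<^esub>}"
  proof (rule complex_length)
    show "weakly_regular (F q) xs" for q
    proof (cases q)
      case 0
      then show ?thesis using E.weakly_regular_fun[OF assms(4,5)] by (simp add: F_def)
    next
      case (Suc k)
      have "projective_module R (P k)" using res[THEN conjunct1] by simp
      from projective_weakly_regular[OF this assms(4,5)] show ?thesis by (simp add: F_def Suc)
    qed
    show "(\<lambda>_. w) \<in> carrier (F 0)" using assms(6) by (auto simp: F_def E_def)
    show "(\<lambda>_. w) \<notin> dd 0 ` carrier (F 1)" unfolding im using assms(7) by (auto simp: fun_eq_iff)
    show "x \<odot>\<^bsub>F 0\<^esub> (\<lambda>_. w) \<in> dd 0 ` carrier (F 1)" if "x \<in> set xs" for x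
      unfolding im using assms(8)[OF that] by (auto simp: F_def)
  qed (use assms(4) in auto)
  then show ?thesis using res by (cases "length xs") (auto simp: F_def not_less_eq_eq)
qed

text \<open>The last assumption serves the zero ideal: there no \<open>x\<close> can meet both
  conditions, so \<open>xs\<close> is empty and the conventional value \<open>-1\<close> equals
  \<open>length xs - 1\<close>.\<close>

lemma proj_dim_ge:
  fixes R :: "'a ring"
  assumes "cring R" "ideal J R" "set xs \<subseteq> carrier R" "weakly_regular (ideal_module R (carrier R)) xs"
    "w \<in> carrier R" "w \<notin> J" "\<And>x. x \<in> set xs \<Longrightarrow> x \<otimes>\<^bsub>R\<^esub> w \<in> J"
    "\<And>x. x \<in> set xs \<Longrightarrow> x \<otimes>\<^bsub>R\<^esub> w \<noteq> \<zero>\<^bsub>R\<^esub>"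
  shows "proj_dim R (ideal_module R J) \<ge> ereal (real (length xs)) - 1"
proof (cases "J = {\<zero>\<^bsub>R\<^esub>}")
  case True
  then have "xs = []" using assms(7,8) by (cases xs) auto
  then show ?thesis using True by (simp add: proj_dim_def one_ereal_def)
next
  case False
  have "ereal (real (length xs)) - 1 \<le> ereal (real d)"
    if "proj_resolution R (ideal_module R J) d P \<delta> \<epsilon>" for d P \<delta> \<epsilon>
  proof -
    have "length xs \<le> d + 1" using proj_resolution_length[OF assms(1,2) that assms(3-7)] by simp
    then show ?thesis by (simp add: one_ereal_def)
  qed
  then show ?thesis using False by (auto simp: proj_dim_def intro!: INF_greatest)
qed


section \<open>Monomial ideals\<close>

abbreviation keys where "keys \<equiv> Poly_Mapping.keys"
abbreviation lookup where "lookup \<equiv> Poly_Mapping.lookup"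
abbreviation single where "single \<equiv> Poly_Mapping.single"

lemma keys_plus_expo: "keys (u + v :: expo) = keys u \<union> keys v"
  by (auto simp: in_keys_iff lookup_add)

lemma expo_diff:
  assumes "\<And>x. lookup m x \<le> lookup (u :: expo) x"
  shows "u = m + (u - m)" "keys (u - m) \<subseteq> keys u"
  using assms by (auto intro!: poly_mapping_eqI simp: lookup_add lookup_minus in_keys_iff)

lemma expo_split_var:
  assumes "x \<in> keys (u :: expo)"
  shows "u = single x 1 + (u - single x 1)" "keys (u - single x 1) \<subseteq> keys u"
proof -
  have "lookup (single x 1) y \<le> lookup u y" for y
    using assms by (auto simp: lookup_single when_def in_keys_iff)
  then show "u = single x 1 + (u - single x 1)" "keys (u - single x 1) \<subseteq> keys u"
    using expo_diff by blast+
qed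

definition expo_deg :: "expo \<Rightarrow> nat" where "expo_deg u = (\<Sum>x\<in>keys u. lookup u x)"

lemma expo_deg_plus: "expo_deg (u + v) = expo_deg u + expo_deg v"
  unfolding expo_deg_def by (rule setsum_keys_plus_distrib) auto

lemma expo_deg_eq_0: "expo_deg u = 0 \<longleftrightarrow> u = 0"
  by (auto simp: expo_deg_def in_keys_iff intro!: poly_mapping_eqI)

section \<open>Monomial ideals as upward closed sets of exponents\<close>

definition monomials :: "(nat \<times> nat) set \<Rightarrow> expo set" where
  "monomials V = {u. keys u \<subseteq> V}"

definition mono_span :: "expo set \<Rightarrow> 'k::field pol set" where
  "mono_span U = {f. keys f \<subseteq> U}"

definition upset :: "(nat \<times> nat) set \<Rightarrow> expo set \<Rightarrow> bool" where
  "upset V U \<longleftrightarrow> U \<subseteq> monomials V \<and> (\<forall>u\<in>U. \<forall>v\<in>monomials V. u + v \<in> U)"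

definition upclose :: "(nat \<times> nat) set \<Rightarrow> expo set \<Rightarrow> expo set" where
  "upclose V M = {m + v |m v. m \<in> M \<and> v \<in> monomials V}"

lemma monomials_plus [simp]: "u + v \<in> monomials V \<longleftrightarrow> u \<in> monomials V \<and> v \<in> monomials V"
  by (auto simp: monomials_def keys_plus_expo)

lemma monomials_0 [simp]: "0 \<in> monomials V" by (simp add: monomials_def)

lemma upset_upclose: "M \<subseteq> monomials V \<Longrightarrow> upset V (upclose V M)"
  unfolding upset_def upclose_def by (auto simp: add.assoc) (metis add.assoc monomials_plus)

lemma subset_upclose: "M \<subseteq> upclose V M"
proof
  fix m assume "m \<in> M"
  then show "m \<in> upclose V M"
    unfolding upclose_def by (intro CollectI exI[of _ m] exI[of _ "0::expo"]) simp
qed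

lemma mono_of_mem_span [simp]: "(mono_of u :: 'k::field pol) \<in> mono_span U \<longleftrightarrow> u \<in> U"
  by (simp add: mono_of_def mono_span_def)

lemma mono_of_nonzero: "(mono_of u :: 'k::field pol) \<noteq> 0"
  by (metis keys_single keys_zero mono_of_def insert_not_empty zero_neq_one)

lemma mono_span_inj: "(mono_span U :: 'k::field pol set) = mono_span U' \<longleftrightarrow> U = U'"
  using mono_of_mem_span by blast

lemma mono_span_Int: "mono_span U \<inter> mono_span U' = (mono_span (U \<inter> U') :: 'k::field pol set)"
  by (auto simp: mono_span_def)

lemma mono_span_add: "f \<in> mono_span U \<Longrightarrow> g \<in> mono_span U \<Longrightarrow> f + g \<in> mono_span U"
  using keys_add[of f g] by (auto simp: mono_span_def)

lemma mono_span_zero [simp]: "0 \<in> mono_span U" by (simp add: mono_span_def)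

lemma one_mem_span [simp]: "1 \<in> mono_span (monomials V)"
  by (simp add: mono_span_def)

lemma mono_span_uminus: "f \<in> mono_span U \<Longrightarrow> - f \<in> mono_span U"
  by (auto simp: mono_span_def in_keys_iff subset_iff)

lemma mono_span_sum: "finite A \<Longrightarrow> (\<And>a. a \<in> A \<Longrightarrow> f a \<in> mono_span U) \<Longrightarrow> sum f A \<in> mono_span U"
  by (induction A rule: finite_induct) (auto intro: mono_span_add)

lemma single_mem_span: "u \<in> U \<Longrightarrow> single u c \<in> mono_span U"
  by (auto simp: mono_span_def)

lemma pol_sum_monomials: "(f :: 'k::field pol) = (\<Sum>u\<in>keys f. single u (lookup f u))"
proof (rule poly_mapping_eqI)
  fix k
  have "lookup (\<Sum>u\<in>keys f. single u (lookup f u)) k = (\<Sum>u\<in>keys f. if u = k then lookup f u else 0)"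
    unfolding lookup_sum by (intro sum.cong) (auto simp: lookup_single when_def)
  then show "lookup f k = lookup (\<Sum>u\<in>keys f. single u (lookup f u)) k"
    by (auto simp: in_keys_iff)
qed

text \<open>Translation of exponents is injective, so nothing cancels; colon ideals by monomials can
  therefore be read off from supports.\<close>

lemma keys_mult_mono: "keys (f * mono_of e :: 'k::field pol) = (\<lambda>u. u + e) ` keys f"
proof -
  have "f * mono_of e = (\<Sum>u\<in>keys f. single (u + e) (lookup f u))"
    by (subst pol_sum_monomials[of f])
      (simp add: sum_distrib_right mono_of_def mult_single del: pol_sum_monomials)
  then have *: "lookup (f * mono_of e) k = (\<Sum>u\<in>keys f. if u + e = k then lookup f u else 0)" for k
    unfolding lookup_sum by (auto simp: lookup_sum lookup_single when_def intro!: sum.cong)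
  have 1: "lookup (f * mono_of e) (u + e) = lookup f u" for u
    unfolding * by (auto simp: in_keys_iff)
  show ?thesis
  proof (intro equalityI subsetI)
    fix k assume "k \<in> keys (f * mono_of e)"
    then have "lookup (f * mono_of e) k \<noteq> 0" by (simp add: in_keys_iff)
    then show "k \<in> (\<lambda>u. u + e) ` keys f"
      unfolding * by (rule contrapos_np) (intro sum.neutral, auto)
  next
    fix k assume "k \<in> (\<lambda>u. u + e) ` keys f"
    then show "k \<in> keys (f * mono_of e)" using 1 by (auto simp: in_keys_iff)
  qed
qed

lemma var_poly_ring_simps [simp]:
  "carrier (var_poly_ring V) = mono_span (monomials V)"
  "f \<otimes>\<^bsub>var_poly_ring V\<^esub> g = f * g" "f \<oplus>\<^bsub>var_poly_ring V\<^esub> g = f + g"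
  "\<zero>\<^bsub>var_poly_ring V\<^esub> = 0" "\<one>\<^bsub>var_poly_ring V\<^esub> = 1"
  by (auto simp: var_poly_ring_def mono_span_def monomials_def)

lemma mono_span_mult:
  assumes "upset V U" "f \<in> mono_span U" "g \<in> mono_span (monomials V)"
  shows "f * g \<in> mono_span U"
  using keys_mult[of f g] assms by (fastforce simp: mono_span_def upset_def)

lemma upset_monomials: "upset V (monomials V)" by (simp add: upset_def)

lemma cring_var_poly_ring: "cring (var_poly_ring V :: 'k::field pol ring)"
proof (rule cringI)
  show "abelian_group (var_poly_ring V :: 'k pol ring)"
    by (rule abelian_groupI)
      (auto simp: mono_span_add add.assoc add.commute intro: bexI[of _ "- x" for x] mono_span_uminus)
  show "comm_monoid (var_poly_ring V :: 'k pol ring)"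
    by (rule comm_monoidI)
      (auto simp: mono_span_mult[OF upset_monomials] mult.assoc mult.commute)
qed (auto simp: distrib_right)

lemma ideal_mono_span:
  assumes "upset V U" shows "ideal (mono_span U :: 'k::field pol set) (var_poly_ring V)"
proof -
  interpret R: cring "var_poly_ring V :: 'k pol ring" by (rule cring_var_poly_ring)
  have sub: "(mono_span U :: 'k pol set) \<subseteq> mono_span (monomials V)"
    using assms by (auto simp: upset_def mono_span_def)
  show ?thesis
  proof (rule idealI)
    show "ring (var_poly_ring V :: 'k pol ring)" by (rule R.ring_axioms)
    show "subgroup (mono_span U) (add_monoid (var_poly_ring V :: 'k pol ring))"
    proof (rule R.add.subgroupI)
      fix f :: "'k pol" assume f: "f \<in> mono_span U"
      then have "\<ominus>\<^bsub>var_poly_ring V\<^esub> f = - f"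
        using sub by (intro R.minus_equality) (auto simp: mono_span_uminus)
      then show "\<ominus>\<^bsub>var_poly_ring V\<^esub> f \<in> mono_span U"
        using f by (simp add: mono_span_uminus)
    qed (use sub mono_span_zero[of U] in \<open>auto simp: mono_span_add simp del: mono_span_zero\<close>)
  qed (use assms in \<open>auto simp: mono_span_mult mult.commute[of _ "_ :: 'k pol"]\<close>)
qed

text \<open>\<open>S\<close> is only sandwiched between the monomials and the ideal they span,
  because the generating sets that occur (whole colon ideals, images under \<open>inc_act\<close>)
  also contain other polynomials.\<close>

lemma genideal_mono:
  fixes S :: "'k::field pol set"
  assumes "M \<subseteq> monomials V" "mono_of ` M \<subseteq> S" "S \<subseteq> mono_span (upclose V M)"
  shows "genideal (var_poly_ring V) S = mono_span (upclose V M)"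
proof
  interpret R: cring "var_poly_ring V :: 'k pol ring" by (rule cring_var_poly_ring)
  show "genideal (var_poly_ring V) S \<subseteq> mono_span (upclose V M)"
    using assms by (intro R.genideal_minimal ideal_mono_span upset_upclose)
  have Sc: "S \<subseteq> carrier (var_poly_ring V)"
    using assms(3) upset_upclose[OF assms(1)] by (auto simp: upset_def mono_span_def)
  then interpret I: ideal "genideal (var_poly_ring V) S" "var_poly_ring V"
    by (rule R.genideal_ideal)
  have sums: "finite A \<Longrightarrow> (\<And>a. a \<in> A \<Longrightarrow> g a \<in> genideal (var_poly_ring V) S) \<Longrightarrow>
      sum g A \<in> genideal (var_poly_ring V) S" for A :: "expo set" and g
    by (induction A rule: finite_induct) (use I.a_closed I.zero_closed in auto)
  show "mono_span (upclose V M) \<subseteq> genideal (var_poly_ring V) S"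
  proof
    fix f :: "'k pol" assume f: "f \<in> mono_span (upclose V M)"
    have "single u (lookup f u) \<in> genideal (var_poly_ring V) S" if uf: "u \<in> keys f" for u
    proof -
      obtain m v where mv: "u = m + v" "m \<in> M" "v \<in> monomials V"
        using f uf by (auto simp: mono_span_def upclose_def)
      have "mono_of m \<in> genideal (var_poly_ring V) S"
        using mv assms R.genideal_self[OF Sc] by auto
      then have "single v (lookup f u) * mono_of m \<in> genideal (var_poly_ring V) S"
        using I.I_l_closed mv by (simp add: single_mem_span)
      then show ?thesis using mv by (simp add: mono_of_def mult_single add.commute)
    qed
    then have "(\<Sum>u\<in>keys f. single u (lookup f u)) \<in> genideal (var_poly_ring V) S"
      by (intro sums) auto
    then show "f \<in> genideal (var_poly_ring V) S" using pol_sum_monomials[of f] by simp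
  qed
qed

lemma mono_gens_iff:
  "mono_gens V (J :: 'k::field pol set) M \<longleftrightarrow> M \<subseteq> monomials V \<and> J = mono_span (upclose V M)"
proof -
  have "genideal (var_poly_ring V) (mono_of ` M :: 'k pol set) = mono_span (upclose V M)"
    if "M \<subseteq> monomials V"
    using subset_upclose[of M V] by (intro genideal_mono[OF that]) auto
  then show ?thesis by (auto simp: mono_gens_def monomials_def)
qed

lemma monomial_ideal_span:
  assumes "monomial_ideal V (J :: 'k::field pol set)"
  shows "upset V {u. mono_of u \<in> J}" "J = mono_span {u. mono_of u \<in> J}"
proof -
  obtain M where M: "M \<subseteq> monomials V" "J = mono_span (upclose V M)"
    using assms by (auto simp: monomial_ideal_def mono_gens_iff)
  then have "{u. mono_of u \<in> J} = upclose V M" by auto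
  then show "upset V {u. mono_of u \<in> J}" "J = mono_span {u. mono_of u \<in> J}"
    using M upset_upclose by auto
qed

definition minimals :: "expo set \<Rightarrow> expo set" where
  "minimals U = {u \<in> U. \<forall>v\<in>U. \<forall>w. u = v + w \<longrightarrow> w = 0}"

lemma minimals_below:
  assumes "u \<in> U" shows "\<exists>v\<in>minimals U. \<exists>w. u = v + w"
  using assms
proof (induction "expo_deg u" arbitrary: u rule: less_induct)
  case less
  show ?case
  proof (cases "u \<in> minimals U")
    case True
    then show ?thesis by (auto intro!: bexI[of _ u] exI[of _ "0::expo"])
  next
    case False
    then obtain v w where v: "v \<in> U" "u = v + w" "w \<noteq> 0" using less.prems by (auto simp: minimals_def)
    then have "expo_deg v < expo_deg u" using expo_deg_eq_0[of w] by (simp add: expo_deg_plus)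
    then obtain v' w' where "v' \<in> minimals U" "v = v' + w'" using less v by blast
    then show ?thesis using v by (auto simp: add.assoc)
  qed
qed

text \<open>Every generating set contains the minimal exponents, since \<open>u = m + v\<close> with
  \<open>u\<close> minimal forces \<open>v = 0\<close>, and they generate because degrees cannot
  drop forever. So the definite description in \<open>min_gens\<close> has exactly one
  solution.\<close>

lemma min_gens_span:
  assumes "upset V U"
  shows "min_gens V (mono_span U :: 'k::field pol set) = minimals U"
proof -
  have gens: "mono_gens V (mono_span U :: 'k pol set) M \<longleftrightarrow> M \<subseteq> monomials V \<and> U = upclose V M" for M
    by (simp add: mono_gens_iff mono_span_inj)
  have 1: "minimals U \<subseteq> M" if UM: "U = upclose V M" for M
  proof
    fix u assume u: "u \<in> minimals U"
    then obtain m v where m: "u = m + v" "m \<in> M" using UM by (auto simp: minimals_def upclose_def)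
    then have "m \<in> U" using UM subset_upclose by auto
    then have "v = 0" using u m unfolding minimals_def by blast
    then show "u \<in> M" using m by simp
  qed
  have 2: "mono_gens V (mono_span U :: 'k pol set) (minimals U)"
  proof -
    have "minimals U \<subseteq> U" by (auto simp: minimals_def)
    moreover have "U \<subseteq> upclose V (minimals U)"
    proof
      fix u assume u: "u \<in> U"
      then obtain v w where "v \<in> minimals U" "u = v + w" using minimals_below by blast
      moreover have "u \<in> monomials V" using u assms by (auto simp: upset_def)
      ultimately show "u \<in> upclose V (minimals U)" by (auto simp: upclose_def)
    qed
    ultimately show ?thesis
      using assms unfolding gens by (auto simp: upset_def upclose_def)
  qed
  have 3: "minimals U \<subseteq> M" if "mono_gens V (mono_span U :: 'k pol set) M" for M
    using 1 that gens by simp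
  show ?thesis unfolding min_gens_def
  proof (rule the_equality)
    show "mono_gens V (mono_span U :: 'k pol set) (minimals U) \<and>
      (\<forall>M'. M' \<subset> minimals U \<longrightarrow> \<not> mono_gens V (mono_span U :: 'k pol set) M')"
      using 2 3 by (meson less_le_not_le)
  next
    fix M assume "mono_gens V (mono_span U :: 'k pol set) M \<and>
      (\<forall>M'. M' \<subset> M \<longrightarrow> \<not> mono_gens V (mono_span U :: 'k pol set) M')"
    then show "M = minimals U" using 2 3 by (metis psubsetI)
  qed
qed

section \<open>Colon ideals and one step of the iterated chain\<close>

lemma colon_span:
  assumes "upset V U"
  shows "colon V (mono_span U :: 'k::field pol set) (mono_of e) = mono_span {u \<in> monomials V. u + e \<in> U}"
  by (auto simp: colon_def mono_span_def keys_mult_mono)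

lemma colon_plus_vars_span:
  assumes "upset V U" "{1..c} \<times> {j + 1} \<subseteq> V"
  shows "colon_plus_vars V c j e (mono_span U :: 'k::field pol set) =
    mono_span {u \<in> monomials V. (\<exists>k\<in>{1..c}. (k, j + 1) \<in> keys u) \<or> u + level_mono c j e \<in> U}"
proof -
  define A where "A = {u \<in> monomials V. u + level_mono c j e \<in> U}"
  define M where "M = A \<union> {single (k, j + 1) 1 |k. k \<in> {1..c}}"
  have A: "upset V A" unfolding upset_def
  proof (intro conjI ballI)
    fix u v assume "u \<in> A" "v \<in> monomials V"
    then have "(u + level_mono c j e) + v \<in> U" using assms(1) by (auto simp: A_def upset_def)
    then show "u + v \<in> A" using \<open>u \<in> A\<close> \<open>v \<in> monomials V\<close> by (simp add: A_def ac_simps)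
  qed (auto simp: A_def)
  have MV: "M \<subseteq> monomials V" using assms(2) by (auto simp: M_def A_def monomials_def)
  have sub: "mono_of ` M \<subseteq> mono_span A \<union> {var_of k (j + 1) |k. k \<in> {1..c}}"
    by (auto simp: M_def var_of_def)
  have sup: "mono_span A \<union> {var_of k (j + 1) |k. k \<in> {1..c}} \<subseteq> (mono_span (upclose V M) :: 'k pol set)"
    using subset_upclose[of M V] by (auto simp: M_def var_of_def mono_span_def mono_of_def)
  have "upclose V M = {u \<in> monomials V. (\<exists>k\<in>{1..c}. (k, j + 1) \<in> keys u) \<or> u + level_mono c j e \<in> U}"
    (is "_ = ?B")
  proof (intro equalityI subsetI)
    fix u assume "u \<in> upclose V M"
    then obtain m v where m: "u = m + v" "m \<in> M" "v \<in> monomials V" by (auto simp: upclose_def)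
    then show "u \<in> ?B"
    proof (cases "m \<in> A")
      case True
      then have "u \<in> A" using A m by (auto simp: upset_def)
      then show ?thesis by (auto simp: A_def)
    next
      case False
      then show ?thesis using m MV by (auto simp: M_def keys_plus_expo)
    qed
  next
    fix u assume u: "u \<in> ?B"
    show "u \<in> upclose V M"
    proof (cases "u \<in> A")
      case True
      then show ?thesis using subset_upclose[of M V] by (auto simp: M_def)
    next
      case False
      then obtain k where k: "k \<in> {1..c}" "(k, j + 1) \<in> keys u" using u by (auto simp: A_def)
      note split = expo_split_var[OF k(2)]
      then have "u - single (k, j + 1) 1 \<in> monomials V" using u by (auto simp: monomials_def)
      then show ?thesis unfolding upclose_def M_def using split(1) k(1) by blast
    qed
  qed
  then show ?thesis
    unfolding colon_plus_vars_def colon_span[OF assms(1)] A_def[symmetric]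
    using genideal_mono[OF MV sub sup] by simp
qed

lemma keys_level_mono: "keys (level_mono c j e) \<subseteq> {1..c} \<times> {j + 1}"
proof -
  have "lookup (level_mono c j e) x = 0" if "x \<notin> {1..c} \<times> {j + 1}" for x
    using that by (auto simp: level_mono_def lookup_sum lookup_single when_def intro!: sum.neutral)
  then show ?thesis by (auto simp: in_keys_iff)
qed

text \<open>The exponent set of \<open>chain_e\<close>. In levels \<open>n \<le> j\<close> nothing
  happens: the level monomial involves no variable of the ring, so extending, dividing and
  restricting gives back \<open>U n\<close>.\<close>

definition step_e :: "nat \<Rightarrow> nat \<Rightarrow> (nat \<Rightarrow> nat) \<Rightarrow> (nat \<Rightarrow> expo set) \<Rightarrow> nat \<Rightarrow> expo set" where
  "step_e c j e U n = (if j + 1 \<le> n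
     then {u \<in> monomials (vars_upto c n). (\<exists>k\<in>{1..c}. (k, j + 1) \<in> keys u) \<or> u + level_mono c j e \<in> U n}
     else U n)"

lemma chain_e_span:
  assumes "upset (vars_upto c n) (U n)" "(J n :: 'k::field pol set) = mono_span (U n)"
  shows "chain_e c j e J n = mono_span (step_e c j e U n)"
proof (cases "j + 1 \<le> n")
  case True
  then have "{1..c} \<times> {j + 1} \<subseteq> vars_upto c n" by (auto simp: vars_upto_def)
  then show ?thesis using True assms by (simp add: chain_e_def step_e_def colon_plus_vars_span)
next
  case False
  let ?V = "vars_all c" and ?W = "vars_upto c n" and ?m = "level_mono c j e"
  have WV: "?W \<subseteq> ?V" by (auto simp: vars_all_def vars_upto_def)
  then have UV: "U n \<subseteq> monomials ?V" using assms by (auto simp: upset_def monomials_def)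
  have gen: "genideal (Rinf c) (J n) = mono_span (upclose ?V (U n))"
    using subset_upclose[of "U n" ?V] by (intro genideal_mono UV) (auto simp: assms(2), auto simp: mono_span_def)
  have "{u \<in> monomials ?V. (\<exists>k\<in>{1..c}. (k, j + 1) \<in> keys u) \<or> u + ?m \<in> upclose ?V (U n)} \<inter> monomials ?W = U n"
    (is "?A = _")
  proof (intro equalityI subsetI)
    fix u assume "u \<in> ?A"
    then have u: "u \<in> monomials ?W" and *: "(\<exists>k\<in>{1..c}. (k, j + 1) \<in> keys u) \<or> u + ?m \<in> upclose ?V (U n)" by auto
    have "(k, j + 1) \<notin> keys u" for k using u False by (auto simp: monomials_def vars_upto_def)
    then obtain m v where m: "u + ?m = m + v" "m \<in> U n" using * by (auto simp: upclose_def)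
    \<comment> \<open>The divisor \<open>m\<close> uses only columns up to \<open>n \<le> j\<close>,
      where the level monomial has exponent zero, so it already divides \<open>u\<close>.\<close>
    have "lookup m x \<le> lookup u x" for x
    proof (cases "x \<in> ?W")
      case True
      then have "x \<notin> keys ?m" using keys_level_mono[of c j e] False by (auto simp: vars_upto_def)
      then have "lookup ?m x = 0" by (simp add: in_keys_iff)
      then show ?thesis using arg_cong[OF m(1), of "\<lambda>f. lookup f x"] by (simp add: lookup_add)
    next
      case False
      then have "x \<notin> keys m" using m(2) assms(1) by (auto simp: upset_def monomials_def)
      then show ?thesis by (simp add: in_keys_iff)
    qed
    from expo_diff[OF this] have "u = m + (u - m)" "keys (u - m) \<subseteq> keys u" by auto
    then have "u - m \<in> monomials ?W" using u by (auto simp: monomials_def)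
    then show "u \<in> U n" using \<open>u = m + (u - m)\<close> m(2) assms(1) unfolding upset_def by metis
  next
    fix u assume u: "u \<in> U n"
    have "keys ?m \<subseteq> ?V" using keys_level_mono[of c j e] by (auto simp: vars_all_def)
    then have "u + ?m \<in> upclose ?V (U n)" using u by (auto simp: upclose_def monomials_def)
    then show "u \<in> ?A" using u UV assms(1) by (auto simp: upset_def)
  qed
  moreover have "{1..c} \<times> {j + 1} \<subseteq> ?V" by (auto simp: vars_all_def)
  ultimately show ?thesis using False gen UV
    by (simp add: chain_e_def step_e_def colon_plus_vars_span upset_upclose mono_span_Int)
qed

lemma keys_inc_act: "keys (inc_act p f) \<subseteq> act_expo p ` keys f"
proof -
  have "inc_act p f \<in> mono_span (act_expo p ` keys f)"
    unfolding inc_act_def by (intro mono_span_sum single_mem_span) auto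
  then show ?thesis by (simp add: mono_span_def)
qed

lemma inc_act_mono: "inc_act p (mono_of u :: 'k::field pol) = mono_of (act_expo p u)"
  by (simp add: inc_act_def mono_of_def)

section \<open>Regular sequences of variables\<close>

lemma Rmod_minus:
  fixes a b :: "'k::field pol"
  assumes "a \<in> mono_span (monomials V)" "b \<in> mono_span (monomials V)"
  shows "a \<ominus>\<^bsub>ideal_module (var_poly_ring V) (mono_span (monomials V))\<^esub> b = a - b"
proof -
  interpret R: cring "var_poly_ring V :: 'k pol ring" by (rule cring_var_poly_ring)
  interpret M: Module.module "var_poly_ring V :: 'k pol ring"
    "ideal_module (var_poly_ring V :: 'k pol ring) (mono_span (monomials V))"
    using ideal_module_module[OF cring_var_poly_ring R.oneideal] by simp
  have "\<ominus>\<^bsub>ideal_module (var_poly_ring V) (mono_span (monomials V))\<^esub> b = - b"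
    using assms by (intro M.M.minus_equality) (auto simp: mono_span_uminus)
  then show ?thesis by (simp add: a_minus_def)
qed

lemma seq_mult_vars:
  assumes "set xs \<subseteq> V"
  shows "seq_mult (ideal_module (var_poly_ring V) (mono_span (monomials V)))
      (map (\<lambda>x. mono_of (single x 1)) xs) =
    (mono_span {u \<in> monomials V. keys u \<inter> set xs \<noteq> {}} :: 'k::field pol set)"
  using assms
proof (induction xs)
  case Nil
  then show ?case by (auto simp: mono_span_def)
next
  case (Cons x xs)
  let ?X = "mono_of (single x 1) :: 'k pol" and ?S = "\<lambda>xs. {u \<in> monomials V. keys u \<inter> set xs \<noteq> {}}"
  have x: "x \<in> V" using Cons by simp
  have X: "?X \<in> mono_span (monomials V)" using x by (simp add: monomials_def)
  have ups: "upset V (?S ys)" for ys by (auto simp: upset_def keys_plus_expo)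
  have IH: "seq_mult (ideal_module (var_poly_ring V) (mono_span (monomials V)))
      (map (\<lambda>x. mono_of (single x 1)) xs) = (mono_span (?S xs) :: 'k pol set)" using Cons by simp
  have min: "a \<ominus>\<^bsub>ideal_module (var_poly_ring V) (mono_span (monomials V))\<^esub> (?X * b) = a - ?X * b"
    if "a \<in> mono_span (monomials V)" "b \<in> mono_span (monomials V)" for a b :: "'k pol"
    using that X mono_span_mult[OF upset_monomials X] by (simp add: Rmod_minus)
  have eq: "(a \<in> mono_span (monomials V) \<and> (\<exists>b\<in>mono_span (monomials V). a - ?X * b \<in> mono_span (?S xs))) \<longleftrightarrow>
    a \<in> mono_span (?S (x # xs))" for a :: "'k pol"
  proof
    assume "a \<in> mono_span (monomials V) \<and> (\<exists>b\<in>mono_span (monomials V). a - ?X * b \<in> mono_span (?S xs))"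
    then obtain b where b: "b \<in> mono_span (monomials V)" "a - ?X * b \<in> mono_span (?S xs)" by auto
    have "a - ?X * b \<in> mono_span (?S (x # xs))" using b by (auto simp: mono_span_def)
    moreover have "?X * b \<in> mono_span (?S (x # xs))"
      using b x by (intro mono_span_mult[OF ups]) (auto simp: monomials_def)
    ultimately show "a \<in> mono_span (?S (x # xs))" using mono_span_add by fastforce
  next
    assume a: "a \<in> mono_span (?S (x # xs))"
    \<comment> \<open>The part of \<open>a\<close> divisible by \<open>x\<close> is divided by
      \<open>x\<close> to give \<open>b\<close>; the monomials left over contain a variable of the
      tail.\<close>
    define K where "K = {u \<in> keys a. x \<in> keys u}"
    define b where "b = (\<Sum>u\<in>K. single (u - single x 1) (lookup a u))"
    have K: "finite K" "K \<subseteq> keys a" by (auto simp: K_def)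
    have kV: "keys u \<subseteq> V" if "u \<in> keys a" for u using a that by (auto simp: mono_span_def monomials_def)
    have bV: "b \<in> mono_span (monomials V)" unfolding b_def
    proof (intro mono_span_sum single_mem_span K)
      fix u assume "u \<in> K"
      then show "u - single x 1 \<in> monomials V"
        using expo_split_var(2)[of x u] kV[of u] by (auto simp: K_def monomials_def)
    qed
    have "?X * b = (\<Sum>u\<in>K. single u (lookup a u))"
      unfolding b_def sum_distrib_left
    proof (intro sum.cong refl)
      fix u assume "u \<in> K"
      then show "?X * single (u - single x 1) (lookup a u) = single u (lookup a u)"
        using expo_split_var(1)[of x u] by (simp add: K_def mono_of_def mult_single)
    qed
    moreover have "a = (\<Sum>u\<in>keys a - K. single u (lookup a u)) + (\<Sum>u\<in>K. single u (lookup a u))"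
      using pol_sum_monomials[of a] sum.subset_diff[OF K(2), of "\<lambda>u. single u (lookup a u)"]
      by (rule trans) (rule finite_keys)
    ultimately have "a - ?X * b = (\<Sum>u\<in>keys a - K. single u (lookup a u))"
      by (simp only: diff_eq_eq)
    moreover have "(\<Sum>u\<in>keys a - K. single u (lookup a u)) \<in> mono_span (?S xs)"
      using a by (intro mono_span_sum single_mem_span) (auto simp: K_def mono_span_def)
    moreover have "a \<in> mono_span (monomials V)" using a by (auto simp: mono_span_def)
    ultimately show "a \<in> mono_span (monomials V) \<and> (\<exists>b\<in>mono_span (monomials V). a - ?X * b \<in> mono_span (?S xs))"
      using bV by (intro conjI bexI[of _ b]) simp_all
  qed
  show ?case unfolding list.map seq_mult.simps IH
    using eq min by (simp add: set_eq_iff del: One_nat_def cong: conj_cong bex_cong)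
qed

text \<open>The terms of \<open>x b\<close> are those of \<open>b\<close> shifted by
  \<open>x\<close>. As \<open>x\<close> does not occur in the tail, a tail variable dividing a
  shifted term divides the original one.\<close>

lemma weakly_regular_vars:
  assumes "set xs \<subseteq> V" "distinct xs"
  shows "weakly_regular (ideal_module (var_poly_ring V) (mono_span (monomials V)))
      (map (\<lambda>x. mono_of (single x 1) :: 'k::field pol) xs)"
  using assms
proof (induction xs)
  case (Cons x xs)
  have "b \<in> mono_span {u \<in> monomials V. keys u \<inter> set xs \<noteq> {}}"
    if b: "b \<in> mono_span (monomials V)" "mono_of (single x 1) * b \<in> mono_span {u \<in> monomials V. keys u \<inter> set xs \<noteq> {}}"
    for b :: "'k pol"
  proof -
    have "u \<in> monomials V \<and> keys u \<inter> set xs \<noteq> {}" if "u \<in> keys b" for u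
    proof -
      have "u + single x 1 \<in> keys (b * mono_of (single x 1))" using that by (auto simp: keys_mult_mono)
      then have "u + single x 1 \<in> {u \<in> monomials V. keys u \<inter> set xs \<noteq> {}}"
        using b(2) by (auto simp: mono_span_def mult.commute)
      then show ?thesis using Cons.prems by (auto simp: keys_plus_expo)
    qed
    then show ?thesis by (auto simp: mono_span_def)
  qed
  then show ?case using Cons by (simp add: seq_mult_vars del: One_nat_def)
qed simp

lemma proj_dim_monomial_ge:
  assumes "upset V U" "w \<in> monomials V" "w \<notin> U" "finite T" "T \<subseteq> V" "\<And>x. x \<in> T \<Longrightarrow> w + single x 1 \<in> U"
  shows "proj_dim (var_poly_ring V) (ideal_module (var_poly_ring V) (mono_span U :: 'k::field pol set))
    \<ge> ereal (real (card T)) - 1"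
proof -
  obtain xs where xs: "set xs = T" "distinct xs" using finite_distinct_list[OF assms(4)] by blast
  let ?xs = "map (\<lambda>x. mono_of (single x 1) :: 'k pol) xs"
  have "ereal (real (length ?xs)) - 1 \<le>
    proj_dim (var_poly_ring V) (ideal_module (var_poly_ring V) (mono_span U :: 'k pol set))"
  proof (rule proj_dim_ge[where w = "mono_of w"])
    have prod: "mono_of (single x 1) * mono_of w = (mono_of (w + single x 1) :: 'k pol)" for x
      by (simp add: mono_of_def mult_single add.commute)
    show "x \<otimes>\<^bsub>var_poly_ring V\<^esub> mono_of w \<in> mono_span U" if "x \<in> set ?xs" for x
      using that assms(6) xs(1) prod by auto
    show "x \<otimes>\<^bsub>var_poly_ring V\<^esub> mono_of w \<noteq> \<zero>\<^bsub>var_poly_ring V\<^esub>" if "x \<in> set ?xs" for x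
      using that by (auto simp: prod mono_of_nonzero simp del: One_nat_def)
    show "weakly_regular (ideal_module (var_poly_ring V) (carrier (var_poly_ring V))) ?xs"
      using weakly_regular_vars[of xs V] xs assms(5) by simp
  qed (use assms xs in \<open>auto simp: cring_var_poly_ring ideal_mono_span monomials_def\<close>)
  then show ?thesis using distinct_card[OF xs(2)] xs(1) by simp
qed


section \<open>Higman's lemma and chains of monomial ideals\<close>

lemma mono_subsequence:
  fixes f :: "nat \<Rightarrow> nat"
  shows "\<exists>\<phi>::nat \<Rightarrow> nat. strict_mono \<phi> \<and> (\<forall>i j. i \<le> j \<longrightarrow> f (\<phi> i) \<le> f (\<phi> j))"
proof -
  \<comment> \<open>Take a position where \<open>f\<close> attains its minimum beyond
    \<open>N\<close>; along a sequence of such positions the values do not decrease.\<close>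
  have ex: "\<exists>x\<ge>N. \<forall>m\<ge>x. f x \<le> f m" for N
  proof -
    obtain x where "x \<ge> N" "\<And>m. m \<ge> N \<Longrightarrow> f x \<le> f m"
      using ex_has_least_nat[of "\<lambda>x. x \<ge> N" N f] by auto
    then show ?thesis by (meson le_trans)
  qed
  have "\<exists>\<phi>::nat \<Rightarrow> nat. \<forall>n. (\<forall>m\<ge>\<phi> n. f (\<phi> n) \<le> f m) \<and> \<phi> n < \<phi> (Suc n)"
  proof (rule dependent_nat_choice)
    show "\<exists>x. \<forall>m\<ge>x. f x \<le> f m" using ex by blast
    show "\<exists>y. (\<forall>m\<ge>y. f y \<le> f m) \<and> x < y" for x and n :: nat
      using ex[of "Suc x"] by (meson Suc_le_lessD)
  qed
  then obtain \<phi> :: "nat \<Rightarrow> nat" where \<phi>: "\<And>n m. m \<ge> \<phi> n \<Longrightarrow> f (\<phi> n) \<le> f m" "\<And>n. \<phi> n < \<phi> (Suc n)" by auto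
  then have "strict_mono \<phi>" by (simp add: strict_mono_Suc_iff)
  then show ?thesis using \<phi>(1) by (auto simp: strict_mono_less_eq intro!: exI[of _ \<phi>])
qed

lemma dickson:
  fixes e :: "nat \<Rightarrow> 'b \<Rightarrow> nat"
  assumes "finite S"
  shows "\<exists>\<phi>::nat \<Rightarrow> nat. strict_mono \<phi> \<and> (\<forall>k\<in>S. \<forall>i j. i \<le> j \<longrightarrow> e (\<phi> i) k \<le> e (\<phi> j) k)"
  using assms
proof (induction S rule: finite_induct)
  case empty
  show ?case by (auto intro!: exI[of _ id] simp: strict_mono_def)
next
  case (insert x S)
  then obtain \<phi> :: "nat \<Rightarrow> nat"
    where \<phi>: "strict_mono \<phi>" "\<And>k i j. k \<in> S \<Longrightarrow> i \<le> j \<Longrightarrow> e (\<phi> i) k \<le> e (\<phi> j) k" by auto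
  obtain \<psi> :: "nat \<Rightarrow> nat"
    where \<psi>: "strict_mono \<psi>" "\<And>i j. i \<le> j \<Longrightarrow> e (\<phi> (\<psi> i)) x \<le> e (\<phi> (\<psi> j)) x"
    using mono_subsequence[of "\<lambda>n. e (\<phi> n) x"] by auto
  have "strict_mono (\<lambda>n. \<phi> (\<psi> n))" using \<phi> \<psi> by (auto simp: strict_mono_def)
  then show ?case using \<phi> \<psi>
    by (intro exI[of _ "\<lambda>n. \<phi> (\<psi> n)"]) (auto simp: strict_mono_less_eq)
qed

text \<open>Nash-Williams' minimal bad sequence argument. The hypothesis is the Ramsey form of a
  well-quasi-order: every sequence of letters has an infinite \<open>P\<close>-increasing
  subsequence.\<close>

theorem higman:
  fixes P :: "'a \<Rightarrow> 'a \<Rightarrow> bool" and f :: "nat \<Rightarrow> 'a list"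
  assumes P: "\<And>h :: nat \<Rightarrow> 'a. (\<And>n. h n \<in> A) \<Longrightarrow>
      \<exists>\<phi>::nat \<Rightarrow> nat. strict_mono \<phi> \<and> (\<forall>i j. i < j \<longrightarrow> P (h (\<phi> i)) (h (\<phi> j)))"
    and f: "\<And>n. set (f n) \<subseteq> A"
  shows "\<exists>i j. i < j \<and> list_emb P (f i) (f j)"
proof (rule ccontr)
  assume notgood: "\<not> (\<exists>i j. i < j \<and> list_emb P (f i) (f j))"
  define bad where "bad h \<longleftrightarrow> (\<forall>n. set (h n) \<subseteq> A) \<and> (\<forall>i j. i < j \<longrightarrow> \<not> list_emb P (h i) (h j))"
    for h :: "nat \<Rightarrow> 'a list"
  have bad_f: "bad f" using notgood f by (auto simp: bad_def)
  \<comment> \<open>Entry \<open>n\<close> is as short as possible among the bad sequences sharing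
    the first \<open>n\<close> entries. The diagonal of the sequences \<open>H n\<close> is then bad
    and minimal at every position.\<close>
  define least where "least n h \<longleftrightarrow> bad h \<and>
    (\<forall>h'. bad h' \<longrightarrow> (\<forall>k<n. h' k = h k) \<longrightarrow> length (h n) \<le> length (h' n))" for n h
  have ex: "\<exists>h'. least n h' \<and> (\<forall>k<n. h' k = h k)" if h: "bad h" for n h
  proof -
    obtain h' where "bad h' \<and> (\<forall>k<n. h' k = h k)"
      "\<And>y. bad y \<and> (\<forall>k<n. y k = h k) \<Longrightarrow> length (h' n) \<le> length (y n)"
      using ex_has_least_nat[of "\<lambda>h'. bad h' \<and> (\<forall>k<n. h' k = h k)" h "\<lambda>h'. length (h' n)"] h by blast
    then show ?thesis by (auto simp: least_def intro!: exI[of _ h'])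
  qed
  have "\<exists>H. \<forall>n. least n (H n) \<and> (\<forall>k<Suc n. H (Suc n) k = H n k)"
  proof (rule dependent_nat_choice)
    show "\<exists>h. least 0 h" using ex[OF bad_f] by auto
    show "\<exists>h'. least (Suc n) h' \<and> (\<forall>k<Suc n. h' k = h k)" if "least n h" for h n
      using ex that by (simp add: least_def)
  qed
  then obtain H where H: "\<And>n. least n (H n)" "\<And>n k. k \<le> n \<Longrightarrow> H (Suc n) k = H n k"
    by (auto simp: less_Suc_eq_le)
  define g where "g n = H n n" for n
  have gH: "H n k = g k" if "k \<le> n" for n k
    using that by (induction n rule: dec_induct) (auto simp: g_def H(2))
  have bad_g: "bad g"
  proof -
    have "set (g n) \<subseteq> A" for n using H(1)[of n] by (auto simp: g_def least_def bad_def)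
    moreover have "\<not> list_emb P (g i) (g j)" if "i < j" for i j
    proof -
      have "bad (H j)" using H(1)[of j] by (simp add: least_def)
      then have "\<not> list_emb P (H j i) (H j j)" using that by (simp add: bad_def)
      then show ?thesis using gH[of i j] gH[of j j] that by simp
    qed
    ultimately show ?thesis by (auto simp: bad_def)
  qed
  have min_g: "length (g n) \<le> length (h n)" if "bad h" "\<And>k. k < n \<Longrightarrow> h k = g k" for h n
  proof -
    have "\<forall>k<n. h k = H n k" using that(2) gH by simp
    then show ?thesis using H(1)[of n] that(1) unfolding least_def g_def by blast
  qed
  have ne: "g n \<noteq> []" for n
  proof
    assume "g n = []"
    then have "list_emb P (g n) (g (Suc n))" by simp
    then show False using bad_g by (auto simp: bad_def)
  qed
  have "hd (g n) \<in> A" for n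
    using bad_g list.set_sel(1)[OF ne[of n]] unfolding bad_def by blast
  then obtain \<phi> :: "nat \<Rightarrow> nat"
    where \<phi>: "strict_mono \<phi>" "\<And>i j. i < j \<Longrightarrow> P (hd (g (\<phi> i))) (hd (g (\<phi> j)))"
    using P[of "\<lambda>n. hd (g n)"] by auto
  \<comment> \<open>The competitor: \<open>g\<close> before position \<open>\<phi> 0\<close>, then
    the tails of the words selected by \<open>\<phi>\<close>. A good pair in it would give one in
    \<open>g\<close>, since the removed first letters are \<open>P\<close>-increasing.\<close>
  define h where "h k = (if k < \<phi> 0 then g k else tl (g (\<phi> (k - \<phi> 0))))" for k
  have emb_tl: "list_emb P xs (g n)" if "list_emb P xs (tl (g n))" for xs n
    using that ne[of n] by (cases "g n") auto
  have "\<not> list_emb P (h i) (h j)" if ij: "i < j" for i j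
  proof
    assume emb: "list_emb P (h i) (h j)"
    consider "j < \<phi> 0" | "i < \<phi> 0" "\<phi> 0 \<le> j" | "\<phi> 0 \<le> i" using ij by linarith
    then show False
    proof cases
      case 1
      then show False using emb ij bad_g by (auto simp: h_def bad_def)
    next
      case 2
      then have "list_emb P (g i) (g (\<phi> (j - \<phi> 0)))" using emb emb_tl by (simp add: h_def)
      moreover have "i < \<phi> (j - \<phi> 0)" using 2 \<phi>(1) by (meson le0 less_le_trans strict_mono_less_eq)
      ultimately show False using bad_g by (auto simp: bad_def)
    next
      case 3
      let ?a = "\<phi> (i - \<phi> 0)" and ?b = "\<phi> (j - \<phi> 0)"
      have "list_emb P (hd (g ?a) # tl (g ?a)) (hd (g ?b) # tl (g ?b))"
        using 3 emb ij \<phi>(2)[of "i - \<phi> 0" "j - \<phi> 0"] by (simp add: h_def)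
      then have "list_emb P (g ?a) (g ?b)" using ne by simp
      moreover have "?a < ?b" using 3 ij \<phi>(1) by (simp add: strict_mono_less)
      ultimately show False using bad_g by (auto simp: bad_def)
    qed
  qed
  moreover have "set (h n) \<subseteq> A" for n
    using bad_g by (auto simp: h_def bad_def dest!: list.set_sel(2)[OF ne])
  ultimately have "bad h" by (auto simp: bad_def)
  then have "length (g (\<phi> 0)) \<le> length (h (\<phi> 0))" by (rule min_g) (simp add: h_def)
  then show False using ne[of "\<phi> 0"] by (cases "g (\<phi> 0)") (auto simp: h_def)
qed

lemma list_emb_strict_mono:
  assumes "list_emb P xs ys"
  shows "\<exists>f. strict_mono_on {..<length xs} f \<and> (\<forall>a<length xs. f a < length ys \<and> P (xs ! a) (ys ! f a))"
  using assms
proof (induction rule: list_emb.induct)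
  case (list_emb_Nil ys)
  then show ?case by (auto simp: strict_mono_on_def)
next
  case (list_emb_Cons xs ys y)
  then obtain f where "strict_mono_on {..<length xs} f"
    "\<forall>a<length xs. f a < length ys \<and> P (xs ! a) (ys ! f a)" by auto
  then show ?case by (intro exI[of _ "Suc \<circ> f"]) (auto simp: strict_mono_on_def)
next
  case (list_emb_Cons2 x y xs ys)
  then obtain f where "strict_mono_on {..<length xs} f"
    "\<forall>a<length xs. f a < length ys \<and> P (xs ! a) (ys ! f a)" by auto
  then show ?case using list_emb_Cons2(1)
    by (intro exI[of _ "\<lambda>a. case a of 0 \<Rightarrow> 0 | Suc b \<Rightarrow> Suc (f b)"])
      (auto simp: strict_mono_on_def split: nat.splits)
qed

section \<open>The monoids of increasing maps and their action on exponents\<close>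

lemma Inc_inj: "p \<in> Inc i \<Longrightarrow> inj p"
  by (auto simp: Inc_def strict_mono_imp_inj_on)

lemma Inc_zero: "p \<in> Inc i \<Longrightarrow> p 0 = 0" by (auto simp: Inc_def)

lemma Inc_mono: "i \<le> j \<Longrightarrow> Inc j \<subseteq> Inc i" by (auto simp: Inc_def)

lemma Inc_le: "p \<in> Inc i \<Longrightarrow> l \<le> m \<Longrightarrow> p l \<le> p m"
  by (auto simp: Inc_def strict_mono_less_eq)

lemma Inc_ge: "p \<in> Inc i \<Longrightarrow> l \<le> p l"
  by (auto simp: Inc_def strict_mono_imp_increasing)

lemma id_Inc_mn: "m \<le> n \<Longrightarrow> (\<lambda>x. x) \<in> Inc_mn i m n"
  by (auto simp: Inc_def Inc_mn_def strict_mono_def)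

text \<open>With \<open>d = q - m\<close>, take \<open>\<rho> l = min (p l) (l + d)\<close> and \<open>\<sigma> y = max y (p (y - d))\<close>
  (truncated subtraction).\<close>

lemma Inc_factor:
  assumes "p \<in> Inc_mn i m n" "m \<le> q" "q \<le> n"
  obtains \<rho> \<sigma> where "\<rho> \<in> Inc_mn i m q" "\<sigma> \<in> Inc_mn i q n" "\<And>l. \<sigma> (\<rho> l) = p l"
proof -
  define d where "d = q - m"
  have p: "strict_mono p" "\<And>j. j \<le> i \<Longrightarrow> p j = j" "p m \<le> n" using assms by (auto simp: Inc_mn_def Inc_def)
  have p0: "p 0 = 0" using p(2)[of 0] by simp
  have ple: "p a \<le> p b" if "a \<le> b" for a b using that p(1) by (simp add: strict_mono_less_eq)
  define \<rho> where "\<rho> l = min (p l) (l + d)" for l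
  define \<sigma> where "\<sigma> y = max y (p (y - d))" for y
  have ps: "p l < p (Suc l)" for l using p(1) by (simp add: strict_mono_Suc_iff)
  have "strict_mono \<rho>" unfolding strict_mono_Suc_iff \<rho>_def using ps by (auto simp: min_def less_Suc_eq_le)
      (metis Suc_leI le_less_trans less_Suc_eq_le not_less_eq_eq)
  moreover have "\<rho> j = j" if "j \<le> i" for j using p(2)[OF that] by (simp add: \<rho>_def)
  moreover have "\<rho> m \<le> q" using assms by (simp add: \<rho>_def d_def)
  ultimately have 1: "\<rho> \<in> Inc_mn i m q" by (auto simp: Inc_mn_def Inc_def)
  have "\<sigma> y < \<sigma> (Suc y)" for y
  proof (cases "d \<le> y")
    case True
    then show ?thesis using ps[of "y - d"] by (auto simp: \<sigma>_def Suc_diff_le)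
  next
    case False
    then show ?thesis using p0 by (simp add: \<sigma>_def)
  qed
  moreover have "\<sigma> j = j" if "j \<le> i" for j
    using p(2)[of "j - d"] that by (simp add: \<sigma>_def)
  moreover have "\<sigma> q \<le> n" using assms p(3) by (simp add: \<sigma>_def d_def)
  ultimately have 2: "\<sigma> \<in> Inc_mn i q n" by (auto simp: Inc_mn_def Inc_def strict_mono_Suc_iff)
  have "\<sigma> (\<rho> l) = p l" for l
  proof (cases "p l \<le> l + d")
    case True
    then have "p (p l - d) \<le> p l" by (intro ple) simp
    then show ?thesis using True by (simp add: \<rho>_def \<sigma>_def min_def max_def)
  next
    case False
    then show ?thesis by (simp add: \<rho>_def \<sigma>_def)
  qed
  then show ?thesis using that 1 2 by blast
qed

lemma act_expo_lookup:
  assumes "inj p" shows "lookup (act_expo p u) (k, p l) = lookup u (k, l)"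
proof -
  have "lookup (act_expo p u) (k, p l) = (\<Sum>v\<in>keys u. if v = (k, l) then lookup u v else 0)"
    unfolding act_expo_def lookup_sum
    using assms by (intro sum.cong) (auto simp: lookup_single when_def inj_eq)
  then show ?thesis by (auto simp: in_keys_iff)
qed

lemma act_expo_keys:
  assumes "inj p" shows "keys (act_expo p u) = (\<lambda>v. (fst v, p (snd v))) ` keys u"
proof (intro equalityI subsetI)
  fix y assume "y \<in> keys (act_expo p u)"
  then have "(\<Sum>v\<in>keys u. lookup (single (fst v, p (snd v)) (lookup u v)) y) \<noteq> 0"
    by (simp add: in_keys_iff act_expo_def lookup_sum)
  then obtain v where "v \<in> keys u" "lookup (single (fst v, p (snd v)) (lookup u v)) y \<noteq> 0"
    by (metis (no_types, lifting) sum.neutral)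
  then show "y \<in> (\<lambda>v. (fst v, p (snd v))) ` keys u" by (auto simp: lookup_single when_def split: if_splits)
next
  fix y assume "y \<in> (\<lambda>v. (fst v, p (snd v))) ` keys u"
  then show "y \<in> keys (act_expo p u)" using act_expo_lookup[OF assms] by (auto simp: in_keys_iff)
qed

lemma expo_eqI_image:
  assumes "\<And>k l. lookup u (k, p l) = lookup (v :: expo) (k, p l)"
    "\<And>k l. l \<notin> range p \<Longrightarrow> (k, l) \<notin> keys u" "\<And>k l. l \<notin> range p \<Longrightarrow> (k, l) \<notin> keys v"
  shows "u = v"
proof (rule poly_mapping_eqI)
  fix y :: "nat \<times> nat"
  obtain k l where y: "y = (k, l)" by (cases y)
  show "lookup u y = lookup v y"
    using assms unfolding y by (cases "l \<in> range p") (auto simp: in_keys_iff)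
qed

lemma act_expo_plus: "inj p \<Longrightarrow> act_expo p (u + v) = act_expo p u + act_expo p v"
  by (rule expo_eqI_image[of _ p]) (auto simp: act_expo_lookup lookup_add act_expo_keys keys_plus_expo)

lemma act_expo_cong:
  "(\<And>k l. (k, l) \<in> keys u \<Longrightarrow> p l = q l) \<Longrightarrow> act_expo p u = act_expo q u"
  unfolding act_expo_def by (intro sum.cong) auto

lemma act_expo_id: "act_expo (\<lambda>x. x) u = u"
  using act_expo_lookup[of "\<lambda>x. x" u] by (intro poly_mapping_eqI) (metis inj_on_id2 surj_pair)

lemma act_expo_comp:
  assumes "inj p" "inj q" shows "act_expo p (act_expo q u) = act_expo (\<lambda>x. p (q x)) u"
proof -
  have i: "inj (\<lambda>x. p (q x))" by (intro injI) (meson assms injD)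
  show ?thesis
  proof (rule expo_eqI_image[of _ "\<lambda>x. p (q x)"])
    show "lookup (act_expo p (act_expo q u)) (k, p (q l)) = lookup (act_expo (\<lambda>x. p (q x)) u) (k, p (q l))"
      for k l using act_expo_lookup[OF assms(1)] act_expo_lookup[OF assms(2)] act_expo_lookup[OF i] by simp
  qed (auto simp: act_expo_keys assms i)
qed

lemma act_expo_vars:
  assumes "p \<in> Inc_mn i m n" "u \<in> monomials (vars_upto c m)"
  shows "act_expo p u \<in> monomials (vars_upto c n)"
proof -
  have p: "p \<in> Inc i" "p m \<le> n" using assms by (auto simp: Inc_mn_def)
  have "(k, p l) \<in> vars_upto c n" if "(k, l) \<in> keys u" for k l
  proof -
    have l: "k \<in> {1..c}" "1 \<le> l" "l \<le> m"
      using that assms(2) by (auto simp: monomials_def vars_upto_def)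
    have "1 \<le> p l" using l(2) Inc_ge[OF p(1)] by (rule le_trans)
    moreover have "p l \<le> n" using Inc_le[OF p(1) l(3)] p(2) by (rule le_trans)
    ultimately show ?thesis using l(1) unfolding vars_upto_def by simp
  qed
  then show ?thesis
    unfolding monomials_def mem_Collect_eq act_expo_keys[OF Inc_inj[OF p(1)], of u] by auto
qed

section \<open>Chains of exponent sets and their finite generation\<close>

definition mono_chain :: "nat \<Rightarrow> nat \<Rightarrow> (nat \<Rightarrow> expo set) \<Rightarrow> bool" where
  "mono_chain c i U \<longleftrightarrow> (\<forall>n\<ge>1. upset (vars_upto c n) (U n)) \<and>
    (\<forall>m n. 1 \<le> m \<longrightarrow> m \<le> n \<longrightarrow> (\<forall>u\<in>U m. \<forall>p\<in>Inc_mn i m n. act_expo p u \<in> U n))"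

definition orbit :: "nat \<Rightarrow> (nat \<Rightarrow> expo set) \<Rightarrow> nat \<Rightarrow> nat \<Rightarrow> expo set" where
  "orbit i U r n = {act_expo p u |p u. u \<in> U r \<and> p \<in> Inc_mn i r n}"

definition gen_from :: "nat \<Rightarrow> nat \<Rightarrow> (nat \<Rightarrow> expo set) \<Rightarrow> nat \<Rightarrow> bool" where
  "gen_from c i U r \<longleftrightarrow> 1 \<le> r \<and> (\<forall>n\<ge>r. U n = upclose (vars_upto c n) (orbit i U r n))"

lemma mono_chain_upset: "mono_chain c i U \<Longrightarrow> 1 \<le> n \<Longrightarrow> upset (vars_upto c n) (U n)"
  by (auto simp: mono_chain_def)

lemma mono_chain_act: "mono_chain c i U \<Longrightarrow> 1 \<le> m \<Longrightarrow> m \<le> n \<Longrightarrow> u \<in> U m \<Longrightarrow> p \<in> Inc_mn i m n \<Longrightarrow>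
    act_expo p u \<in> U n"
  unfolding mono_chain_def by blast

lemma upclose_orbit_subset:
  assumes "mono_chain c i U" "1 \<le> r" "r \<le> n"
  shows "upclose (vars_upto c n) (orbit i U r n) \<subseteq> U n"
proof -
  have "orbit i U r n \<subseteq> U n" using mono_chain_act[OF assms] by (auto simp: orbit_def)
  then show ?thesis using mono_chain_upset[OF assms(1), of n] assms by (auto simp: upset_def upclose_def)
qed

text \<open>Every map used to generate level \<open>n\<close> from level \<open>r\<close> factors
  through the intermediate level \<open>r'\<close>. Hence any integer above the index is again a
  generating level.\<close>

lemma gen_from_mono:
  assumes "mono_chain c i U" "gen_from c i U r" "r \<le> r'"
  shows "gen_from c i U r'"
proof -
  have r: "1 \<le> r" using assms by (simp add: gen_from_def)
  have "U n \<subseteq> upclose (vars_upto c n) (orbit i U r' n)" if n: "r' \<le> n" for n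
  proof
    fix x assume "x \<in> U n"
    moreover have "U n = upclose (vars_upto c n) (orbit i U r n)"
      using assms(2,3) n by (simp add: gen_from_def)
    ultimately obtain p u v where x: "x = act_expo p u + v" "v \<in> monomials (vars_upto c n)" "u \<in> U r" "p \<in> Inc_mn i r n"
      by (auto simp: upclose_def orbit_def)
    obtain \<rho> \<sigma> where f: "\<rho> \<in> Inc_mn i r r'" "\<sigma> \<in> Inc_mn i r' n" "\<And>l. \<sigma> (\<rho> l) = p l"
      using Inc_factor[OF x(4) assms(3) n] by blast
    have "act_expo \<sigma> (act_expo \<rho> u) = act_expo p u"
      using f by (subst act_expo_comp) (auto simp: Inc_mn_def Inc_inj)
    moreover have "act_expo \<rho> u \<in> U r'" using mono_chain_act[OF assms(1) r assms(3) x(3) f(1)] .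
    ultimately show "x \<in> upclose (vars_upto c n) (orbit i U r' n)"
      using x(1,2) f(2) unfolding upclose_def orbit_def mem_Collect_eq by metis
  qed
  moreover have "1 \<le> r'" using r assms(3) by simp
  ultimately show ?thesis
    using upclose_orbit_subset[OF assms(1), of r'] unfolding gen_from_def by blast
qed

lemma Inc_extend:
  assumes f: "strict_mono_on {1..m} f" "\<And>l. 1 \<le> l \<Longrightarrow> l \<le> m \<Longrightarrow> 1 \<le> f l \<and> f l \<le> n"
    "\<And>l. 1 \<le> l \<Longrightarrow> l \<le> m \<Longrightarrow> l \<le> i \<Longrightarrow> f l = l" and m: "1 \<le> m"
  obtains p where "p \<in> Inc_mn i m n" "\<And>l. 1 \<le> l \<Longrightarrow> l \<le> m \<Longrightarrow> p l = f l"
proof -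
  \<comment> \<open>Beyond \<open>m\<close> the map continues by translation; if
    \<open>m \<le> i\<close>, then \<open>f m = m\<close> makes this translation the identity, so
    columns between \<open>m\<close> and \<open>i\<close> stay fixed.\<close>
  define p where "p l = (if l = 0 then 0 else if l \<le> m then f l else f m + (l - m))" for l
  have "p l < p (Suc l)" for l
  proof -
    consider "l = 0" | "1 \<le> l" "Suc l \<le> m" | "l = m" | "m < l" by linarith
    then show ?thesis
    proof cases
      case 1
      then show ?thesis using f(2)[of 1] m by (auto simp: p_def)
    next
      case 2
      then show ?thesis using strict_mono_onD[OF f(1), of l "Suc l"] by (auto simp: p_def)
    qed (use m in \<open>auto simp: p_def\<close>)
  qed
  moreover have "p l = l" if "l \<le> i" for l
    using f(3)[of l] f(3)[of m] that m by (auto simp: p_def)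
  ultimately have "p \<in> Inc_mn i m n"
    using f(2)[of m] m by (auto simp: Inc_mn_def Inc_def strict_mono_Suc_iff p_def)
  then show ?thesis using that[of p] by (auto simp: p_def)
qed

text \<open>Column \<open>l\<close> of a monomial becomes a letter; the tag \<open>min l (i + 1)\<close> forces embeddings of words
  to fix the first \<open>i\<close> positions.\<close>

definition column_word :: "nat \<Rightarrow> nat \<Rightarrow> expo \<Rightarrow> (nat \<times> (nat \<Rightarrow> nat)) list" where
  "column_word i n u = map (\<lambda>a. (min (Suc a) (i + 1), \<lambda>k. lookup u (k, Suc a))) [0..<n]"

definition letter_le :: "nat \<Rightarrow> nat \<times> (nat \<Rightarrow> nat) \<Rightarrow> nat \<times> (nat \<Rightarrow> nat) \<Rightarrow> bool" where
  "letter_le c x y \<longleftrightarrow> fst x = fst y \<and> (\<forall>k\<in>{1..c}. snd x k \<le> snd y k)"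

lemma letter_le_subsequence:
  fixes h :: "nat \<Rightarrow> nat \<times> (nat \<Rightarrow> nat)"
  assumes "\<And>n. fst (h n) \<le> b"
  shows "\<exists>\<phi>::nat \<Rightarrow> nat. strict_mono \<phi> \<and> (\<forall>i j. i < j \<longrightarrow> letter_le c (h (\<phi> i)) (h (\<phi> j)))"
proof -
  \<comment> \<open>The coordinates \<open>0\<close> and \<open>c + 1\<close>, free because the rows
    are \<open>1..c\<close>, carry the tag and its complement to \<open>b\<close>. Both are
    non-decreasing along the subsequence, so the tag is constant.\<close>
  define e where "e n k = (if k = 0 then fst (h n) else if k = c + 1 then b - fst (h n) else snd (h n) k)"
    for n k
  obtain \<phi> :: "nat \<Rightarrow> nat"
    where \<phi>: "strict_mono \<phi>" "\<And>k i j. k \<le> c + 1 \<Longrightarrow> i \<le> j \<Longrightarrow> e (\<phi> i) k \<le> e (\<phi> j) k"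
    using dickson[of "{..c + 1}" e] by auto
  have "letter_le c (h (\<phi> i)) (h (\<phi> j))" if "i < j" for i j
  proof -
    have "fst (h (\<phi> i)) = fst (h (\<phi> j))"
      using \<phi>(2)[of 0 i j] \<phi>(2)[of "c + 1" i j] that assms[of "\<phi> i"] assms[of "\<phi> j"] by (simp add: e_def)
    moreover have "snd (h (\<phi> i)) k \<le> snd (h (\<phi> j)) k" if "k \<in> {1..c}" for k
      using \<phi>(2)[of k i j] that \<open>i < j\<close> by (simp add: e_def)
    ultimately show ?thesis by (simp add: letter_le_def)
  qed
  then show ?thesis using \<phi>(1) by blast
qed

lemma column_word_emb:
  assumes "list_emb (letter_le c) (column_word i m u) (column_word i n v)" "1 \<le> m"
    "u \<in> monomials (vars_upto c m)"
  obtains p where "p \<in> Inc_mn i m n" "\<exists>w. v = act_expo p u + w \<and> keys w \<subseteq> keys v"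
proof -
  obtain f where f: "strict_mono_on {..<m} f" "\<And>a. a < m \<Longrightarrow> f a < n"
    "\<And>a. a < m \<Longrightarrow> letter_le c (column_word i m u ! a) (column_word i n v ! f a)"
    using list_emb_strict_mono[OF assms(1)] unfolding column_word_def length_map length_upt minus_nat.diff_0
    by blast
  define g where "g l = Suc (f (l - 1))" for l
  have tag: "min (Suc a) (i + 1) = min (Suc (f a)) (i + 1)" if "a < m" for a
    using f(3)[OF that] f(2)[OF that] that by (simp add: column_word_def letter_le_def)
  have le: "lookup u (k, Suc a) \<le> lookup v (k, Suc (f a))" if "a < m" "k \<in> {1..c}" for a k
    using f(3)[OF that(1)] f(2)[OF that(1)] that by (simp add: column_word_def letter_le_def)
  have "strict_mono_on {1..m} g"
  proof (rule strict_mono_onI)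
    fix a b assume "a \<in> {1..m}" "b \<in> {1..m}" "a < b"
    then have "f (a - 1) < f (b - 1)" by (intro strict_mono_onD[OF f(1)]) auto
    then show "g a < g b" by (simp add: g_def)
  qed
  moreover have "1 \<le> g l \<and> g l \<le> n" if "1 \<le> l" "l \<le> m" for l
  proof -
    have "f (l - 1) < n" using that by (intro f(2)) auto
    then show ?thesis by (simp add: g_def)
  qed
  moreover have "g l = l" if "1 \<le> l" "l \<le> m" "l \<le> i" for l
  proof -
    \<comment> \<open>For \<open>l \<le> i\<close> the tag is \<open>l\<close> itself, and no other
      column carries it.\<close>
    have "min (Suc (l - 1)) (i + 1) = min (Suc (f (l - 1))) (i + 1)" using that by (intro tag) auto
    then show ?thesis using that by (auto simp: g_def min_def split: if_splits)
  qed
  ultimately obtain p where p: "p \<in> Inc_mn i m n" "\<And>l. 1 \<le> l \<Longrightarrow> l \<le> m \<Longrightarrow> p l = g l"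
    using Inc_extend[of m g n i] assms(2) by blast
  have inj: "inj p" using p(1) by (auto simp: Inc_mn_def Inc_inj)
  have "lookup (act_expo p u) y \<le> lookup v y" for y
  proof (cases "y \<in> keys (act_expo p u)")
    case True
    then obtain k l where kl: "(k, l) \<in> keys u" "y = (k, p l)" using act_expo_keys[OF inj, of u] by auto
    then have "k \<in> {1..c}" "1 \<le> l" "l \<le> m" using assms(3) by (auto simp: monomials_def vars_upto_def)
    then show ?thesis using le[of "l - 1" k] p(2)[of l] kl(2) act_expo_lookup[OF inj, of u k l] by (simp add: g_def)
  next
    case False
    then show ?thesis by (simp add: in_keys_iff)
  qed
  from expo_diff[OF this] show ?thesis using that[OF p(1)] by blast
qed

text \<open>If every level \<open>r\<close> fails to generate some \<open>v r\<close> at level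
  \<open>N r\<close>, iterating \<open>N\<close> yields a sequence in which Higman's lemma finds
  \<open>v (s a)\<close> dividing \<open>v (s b)\<close> up to a shift, with \<open>a < b\<close>.
  Since \<open>v (s a)\<close> lives at level \<open>s (Suc a) \<le> s b\<close>, the shift factors
  through level \<open>s b\<close>, from which \<open>v (s b)\<close> is then generated after
  all.\<close>

lemma gen_from_exists:
  assumes U: "mono_chain c i U"
  shows "\<exists>r. gen_from c i U r"
proof (rule ccontr)
  assume no: "\<not> (\<exists>r. gen_from c i U r)"
  have "\<exists>n v. r \<le> n \<and> v \<in> U n \<and> v \<notin> upclose (vars_upto c n) (orbit i U r n)" if "1 \<le> r" for r
    using no that upclose_orbit_subset[OF U that] unfolding gen_from_def by blast
  then obtain N v where N: "\<And>r. 1 \<le> r \<Longrightarrow> r \<le> N r" "\<And>r. 1 \<le> r \<Longrightarrow> v r \<in> U (N r)"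
    "\<And>r. 1 \<le> r \<Longrightarrow> v r \<notin> upclose (vars_upto c (N r)) (orbit i U r (N r))" by metis
  define s where "s t = (N ^^ t) 1" for t
  have s1: "1 \<le> s t" for t
    by (induction t) (use N(1) in \<open>auto simp: s_def intro: le_trans\<close>)
  have sSuc: "s (Suc t) = N (s t)" for t by (simp add: s_def)
  have smono: "s a \<le> s b" if "a \<le> b" for a b
    using lift_Suc_mono_le[of s, OF _ that] N(1)[OF s1] sSuc by metis
  define w where "w t = column_word i (s (Suc t)) (v (s t))" for t
  have "\<exists>a b. a < b \<and> list_emb (letter_le c) (w a) (w b)"
  proof (rule higman)
    show "set (w t) \<subseteq> {x. fst x \<le> i + 1}" for t by (auto simp: w_def column_word_def)
    show "\<exists>\<phi>::nat \<Rightarrow> nat. strict_mono \<phi> \<and> (\<forall>a b. a < b \<longrightarrow> letter_le c (h (\<phi> a)) (h (\<phi> b)))"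
      if "\<And>n. h n \<in> {x. fst x \<le> i + 1}" for h using that by (intro letter_le_subsequence) auto
  qed
  then obtain a b where ab: "a < b" "list_emb (letter_le c) (w a) (w b)" by auto
  have u: "v (s a) \<in> U (s (Suc a))" and vb: "v (s b) \<in> U (s (Suc b))" using N(2) s1 sSuc by auto
  then have um: "v (s a) \<in> monomials (vars_upto c (s (Suc a)))"
    and vm: "v (s b) \<in> monomials (vars_upto c (s (Suc b)))"
    using mono_chain_upset[OF U s1] by (auto simp: upset_def)
  obtain p x where p: "p \<in> Inc_mn i (s (Suc a)) (s (Suc b))"
    and x: "v (s b) = act_expo p (v (s a)) + x" "keys x \<subseteq> keys (v (s b))"
    using column_word_emb[of c i "s (Suc a)" "v (s a)" "s (Suc b)" "v (s b)"] ab(2) s1 um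
    unfolding w_def by metis
  have le: "s (Suc a) \<le> s b" "s b \<le> s (Suc b)" using ab smono by auto
  obtain \<rho> \<sigma> where f: "\<rho> \<in> Inc_mn i (s (Suc a)) (s b)" "\<sigma> \<in> Inc_mn i (s b) (s (Suc b))" "\<And>l. \<sigma> (\<rho> l) = p l"
    using Inc_factor[OF p le] by blast
  have "act_expo \<sigma> (act_expo \<rho> (v (s a))) = act_expo p (v (s a))"
    using f by (subst act_expo_comp) (auto simp: Inc_mn_def Inc_inj)
  moreover have "act_expo \<rho> (v (s a)) \<in> U (s b)" using mono_chain_act[OF U s1 le(1) u f(1)] .
  ultimately have "act_expo p (v (s a)) \<in> orbit i U (s b) (s (Suc b))"
    using f(2) unfolding orbit_def by (metis (mono_tags, lifting) mem_Collect_eq)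
  moreover have "x \<in> monomials (vars_upto c (s (Suc b)))" using x(2) vm by (auto simp: monomials_def)
  ultimately have "v (s b) \<in> upclose (vars_upto c (s (Suc b))) (orbit i U (s b) (s (Suc b)))"
    using x(1) unfolding upclose_def by blast
  then show False using N(3)[OF s1] sSuc by metis
qed


section \<open>Cover numbers, minimal primes and hitting sets\<close>

lemma act_expo_fix:
  assumes "p \<in> Inc j" "keys u \<subseteq> UNIV \<times> {..j}"
  shows "act_expo p u = u"
proof -
  have "act_expo p u = act_expo (\<lambda>x. x) u"
    using assms by (intro act_expo_cong) (auto simp: Inc_def)
  then show ?thesis by (simp add: act_expo_id)
qed

lemma level_mono_act: "p \<in> Inc (j + 1) \<Longrightarrow> act_expo p (level_mono c j e) = level_mono c j e"
  using keys_level_mono[of c j e] by (intro act_expo_fix) auto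

lemma step_e_chain:
  assumes U: "mono_chain c j U"
  shows "mono_chain c (j + 1) (step_e c j e U)"
proof -
  let ?L = "level_mono c j e"
  have ups: "upset (vars_upto c n) (step_e c j e U n)" if "1 \<le> n" for n
  proof -
    have Un: "upset (vars_upto c n) (U n)" using U that by (rule mono_chain_upset)
    have "u + v + ?L \<in> U n" if "u + ?L \<in> U n" "v \<in> monomials (vars_upto c n)" for u v
    proof -
      have "(u + ?L) + v \<in> U n" using Un that by (simp add: upset_def)
      then show ?thesis by (simp add: ac_simps)
    qed
    then show ?thesis using Un by (auto simp: step_e_def upset_def keys_plus_expo)
  qed
  have act: "act_expo p u \<in> step_e c j e U n"
    if mn: "1 \<le> m" "m \<le> n" and u: "u \<in> step_e c j e U m" and p: "p \<in> Inc_mn (j + 1) m n" for m n u p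
  proof -
    have pj: "p \<in> Inc_mn j m n" "p \<in> Inc (j + 1)" "p \<in> Inc j"
      using p Inc_mono[of j "j + 1"] by (auto simp: Inc_mn_def)
    have inj: "inj p" using pj(2) by (rule Inc_inj)
    have Un: "upset (vars_upto c n) (U n)" using U mn by (intro mono_chain_upset) auto
    have UmV: "U m \<subseteq> monomials (vars_upto c m)"
      using mono_chain_upset[OF U mn(1)] by (simp add: upset_def)
    have uV: "act_expo p u \<in> monomials (vars_upto c n)"
      using u UmV by (intro act_expo_vars[OF p]) (auto simp: step_e_def split: if_splits)
    \<comment> \<open>Only levels from \<open>j + 1\<close> on are altered, so source and target are
      treated alike except when \<open>m < j + 1 \<le> n\<close>; there \<open>U n\<close> is closed
      under multiplication by the level monomial.\<close>
    consider "j + 1 \<le> m" | "m < j + 1" "j + 1 \<le> n" | "n < j + 1" by linarith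
    then show ?thesis
    proof cases
      case 1
      then have "(\<exists>k\<in>{1..c}. (k, j + 1) \<in> keys u) \<or> u + ?L \<in> U m" using u by (simp add: step_e_def)
      then show ?thesis
      proof
        assume "\<exists>k\<in>{1..c}. (k, j + 1) \<in> keys u"
        then obtain k where k: "k \<in> {1..c}" "(k, j + 1) \<in> keys u" by auto
        have "p (j + 1) = j + 1" using pj(2) by (simp add: Inc_def)
        then have "(k, j + 1) \<in> keys (act_expo p u)" using k act_expo_keys[OF inj, of u] by force
        then show ?thesis using k(1) uV 1 mn by (auto simp: step_e_def)
      next
        assume "u + ?L \<in> U m"
        then have "act_expo p (u + ?L) \<in> U n" using mono_chain_act[OF U mn _ pj(1)] by blast
        then have "act_expo p u + ?L \<in> U n"
          using act_expo_plus[OF inj] level_mono_act[OF pj(2)] by simp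
        then show ?thesis using uV 1 mn by (simp add: step_e_def)
      qed
    next
      case 2
      then have "act_expo p u \<in> U n" using mono_chain_act[OF U mn _ pj(1)] u by (simp add: step_e_def)
      moreover have "?L \<in> monomials (vars_upto c n)"
        using keys_level_mono[of c j e] 2 by (auto simp: monomials_def vars_upto_def)
      ultimately have "act_expo p u + ?L \<in> U n" using Un by (simp add: upset_def)
      then show ?thesis using uV 2 by (simp add: step_e_def)
    next
      case 3
      then show ?thesis using mono_chain_act[OF U mn _ pj(1)] u mn by (simp add: step_e_def)
    qed
  qed
  show ?thesis unfolding mono_chain_def using ups act by blast
qed

fun steps :: "nat \<Rightarrow> nat \<Rightarrow> (nat \<Rightarrow> nat) list \<Rightarrow> (nat \<Rightarrow> expo set) \<Rightarrow> nat \<Rightarrow> expo set" where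
  "steps c i [] U = U"
| "steps c i (e # es) U = steps c (i + 1) es (step_e c i e U)"

fun es_mono :: "nat \<Rightarrow> nat \<Rightarrow> (nat \<Rightarrow> nat) list \<Rightarrow> expo" where
  "es_mono c i [] = 0"
| "es_mono c i (e # es) = level_mono c i e + es_mono c (i + 1) es"

lemma steps_chain: "mono_chain c i U \<Longrightarrow> mono_chain c (i + length es) (steps c i es U)"
proof (induction es arbitrary: i U)
  case (Cons e es)
  then have "mono_chain c (i + 1 + length es) (steps c (i + 1) es (step_e c i e U))"
    using step_e_chain by blast
  then show ?case by simp
qed simp

lemma chain_es_span:
  assumes "mono_chain c i U" "\<And>n. 1 \<le> n \<Longrightarrow> (I n :: 'k::field pol set) = mono_span (U n)" "1 \<le> n"
  shows "chain_es c i es I n = mono_span (steps c i es U n)"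
  using assms
proof (induction es arbitrary: i U I n)
  case (Cons e es)
  have "chain_e c i e I n = mono_span (step_e c i e U n)" if "1 \<le> n" for n
    using Cons.prems that by (intro chain_e_span mono_chain_upset) auto
  then show ?case using Cons.IH[OF step_e_chain[OF Cons.prems(1)]] Cons.prems(3) by simp
qed simp

lemma keys_es_mono: "keys (es_mono c i es) \<subseteq> {1..c} \<times> {i + 1..i + length es}"
proof (induction es arbitrary: i)
  case (Cons e es)
  show ?case using Cons.IH[of "i + 1"] keys_level_mono[of c i e] by (fastforce simp: keys_plus_expo)
qed simp

text \<open>The level monomials of different steps use different columns. A variable added in one
  column therefore never divides the remaining monomial, and all steps merge into one colon by
  \<open>es_mono\<close>.\<close>

lemma steps_iff:
  assumes "i + length es \<le> n" "U n \<subseteq> monomials (vars_upto c n)"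
  shows "u \<in> steps c i es U n \<longleftrightarrow> u \<in> monomials (vars_upto c n) \<and>
    ((\<exists>k\<in>{1..c}. \<exists>l\<in>{i + 1..i + length es}. (k, l) \<in> keys u) \<or> u + es_mono c i es \<in> U n)"
  using assms
proof (induction es arbitrary: i U u)
  case (Cons e es)
  let ?m = "es_mono c (i + 1) es" and ?L = "level_mono c i e" and ?M = "monomials (vars_upto c n)"
  have sub: "step_e c i e U n \<subseteq> ?M" using Cons.prems by (auto simp: step_e_def)
  have m: "?m \<in> ?M"
    using keys_es_mono[of c "i + 1" es] Cons.prems by (fastforce simp: monomials_def vars_upto_def)
  have nohit: "(k, i + 1) \<notin> keys ?m" for k using keys_es_mono[of c "i + 1" es] by auto
  have "u + ?m \<in> step_e c i e U n \<longleftrightarrow>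
    u \<in> ?M \<and> ((\<exists>k\<in>{1..c}. (k, i + 1) \<in> keys u) \<or> u + es_mono c i (e # es) \<in> U n)"
    using Cons.prems(1) m nohit by (simp add: step_e_def keys_plus_expo ac_simps)
  moreover have "{i + 1..i + length (e # es)} = insert (i + 1) {i + 1 + 1..i + 1 + length es}" by auto
  ultimately show ?case using Cons.IH[of "i + 1" "step_e c i e U" u] Cons.prems(1) sub
    by (simp del: es_mono.simps) blast
qed auto

section \<open>Index and cover number of a chain\<close>

lemma genideal_orbit:
  assumes U: "mono_chain c i U" and J: "\<And>n. 1 \<le> n \<Longrightarrow> (J n :: 'k::field pol set) = mono_span (U n)"
    and r: "1 \<le> r" "r \<le> n"
  shows "genideal (Rn c n) {inc_act p f |p f. f \<in> J r \<and> p \<in> Inc_mn i r n} =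
    mono_span (upclose (vars_upto c n) (orbit i U r n))"
proof (rule genideal_mono)
  have "U r \<subseteq> monomials (vars_upto c r)" using mono_chain_upset[OF U r(1)] by (simp add: upset_def)
  then show sub: "orbit i U r n \<subseteq> monomials (vars_upto c n)"
    using act_expo_vars unfolding orbit_def by blast
  show "mono_of ` orbit i U r n \<subseteq> {inc_act p f |p f. f \<in> J r \<and> p \<in> Inc_mn i r n}"
  proof
    fix x :: "'k pol" assume "x \<in> mono_of ` orbit i U r n"
    then obtain p u where "x = mono_of (act_expo p u)" "u \<in> U r" "p \<in> Inc_mn i r n"
      by (auto simp: orbit_def)
    then show "x \<in> {inc_act p f |p f. f \<in> J r \<and> p \<in> Inc_mn i r n}"
      unfolding mem_Collect_eq J[OF r(1)]
      by (intro exI[of _ p] exI[of _ "mono_of u"] conjI) (simp_all add: inc_act_mono)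
  qed
  have "keys (inc_act p f) \<subseteq> orbit i U r n" if "f \<in> J r" "p \<in> Inc_mn i r n" for p f
    using that keys_inc_act[of p f] J[OF r(1)] by (fastforce simp: orbit_def mono_span_def)
  then show "{inc_act p f |p f. f \<in> J r \<and> p \<in> Inc_mn i r n} \<subseteq>
    mono_span (upclose (vars_upto c n) (orbit i U r n))"
    using subset_upclose[of "orbit i U r n" "vars_upto c n"] by (auto simp: mono_span_def)
qed

lemma gen_from_chain_ind:
  assumes U: "mono_chain c i U" and J: "\<And>n. 1 \<le> n \<Longrightarrow> (J n :: 'k::field pol set) = mono_span (U n)"
  shows "gen_from c i U (chain_ind c i J)"
proof -
  have "(1 \<le> r \<and> (\<forall>n\<ge>r. J n = genideal (Rn c n) {inc_act p f |p f. f \<in> J r \<and> p \<in> Inc_mn i r n}))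
    \<longleftrightarrow> gen_from c i U r" for r
  proof (cases "1 \<le> r")
    case True
    have "J n = genideal (Rn c n) {inc_act p f |p f. f \<in> J r \<and> p \<in> Inc_mn i r n} \<longleftrightarrow>
        U n = upclose (vars_upto c n) (orbit i U r n)" if "r \<le> n" for n
      using genideal_orbit[OF U J True that] J[of n] True that by (simp add: mono_span_inj)
    then show ?thesis using True by (auto simp: gen_from_def)
  qed (simp add: gen_from_def)
  then have "chain_ind c i J = (LEAST r. gen_from c i U r)" unfolding chain_ind_def by simp
  then show ?thesis using gen_from_exists[OF U] LeastI_ex by metis
qed

lemma min_index_gt:
  assumes "u \<noteq> 0" shows "min_index u > j \<longleftrightarrow> keys u \<subseteq> UNIV \<times> {j<..}"
proof -
  obtain k l where kl: "(k, l) \<in> keys u" using assms by (metis all_not_in_conv keys_eq_empty surj_pair)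
  have 1: "\<exists>k. (k, min_index u) \<in> keys u"
    unfolding min_index_def by (rule LeastI) (use kl in blast)
  have 2: "min_index u \<le> l" if "(k, l) \<in> keys u" for k l
    unfolding min_index_def by (rule Least_le) (use that in blast)
  show ?thesis
  proof
    assume "min_index u > j"
    then show "keys u \<subseteq> UNIV \<times> {j<..}" using 2 by (fastforce dest: less_le_trans)
  next
    assume "keys u \<subseteq> UNIV \<times> {j<..}"
    then show "min_index u > j" using 1 by auto
  qed
qed

lemma covers_plus: "covers C u \<Longrightarrow> covers C (u + v)"
  by (auto simp: covers_def keys_plus_expo)

text \<open>A divisor of a monomial supported beyond column \<open>j\<close> is supported there too,
  and covering passes to multiples, so minimal generators may be traded for all exponents. Excluding
  \<open>0\<close> avoids \<open>min_index 0\<close>, a \<open>LEAST\<close> without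
  witness.\<close>

lemma is_cover_iff:
  assumes "upset (vars_upto c n) U" "0 \<notin> U"
  shows "is_cover c n j (mono_span U :: 'k::field pol set) C \<longleftrightarrow>
    C \<subseteq> {1..c} \<and> (\<forall>u\<in>U. keys u \<subseteq> UNIV \<times> {j<..} \<longrightarrow> covers C u)"
proof -
  have G: "u \<in> Gplus (vars_upto c n) j (mono_span U :: 'k pol set) \<longleftrightarrow>
      u \<in> minimals U \<and> keys u \<subseteq> UNIV \<times> {j<..}" for u
  proof -
    have "u \<noteq> 0" if "u \<in> minimals U" using that assms(2) by (auto simp: minimals_def)
    then show ?thesis using min_index_gt[of u j] by (auto simp: Gplus_def min_gens_span[OF assms(1)])
  qed
  have "covers C u" if C: "\<forall>u\<in>minimals U. keys u \<subseteq> UNIV \<times> {j<..} \<longrightarrow> covers C u"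
    and u: "u \<in> U" "keys u \<subseteq> UNIV \<times> {j<..}" for u
  proof -
    obtain v w where v: "v \<in> minimals U" "u = v + w" using minimals_below[OF u(1)] by auto
    then have "keys v \<subseteq> UNIV \<times> {j<..}" using u(2) by (simp add: keys_plus_expo)
    then show ?thesis using C v covers_plus by blast
  qed
  moreover have "minimals U \<subseteq> U" by (auto simp: minimals_def)
  ultimately show ?thesis unfolding is_cover_def using G by blast
qed

lemma full_upset: "upset V U \<Longrightarrow> U = monomials V \<longleftrightarrow> 0 \<in> U"
proof
  assume U: "upset V U" and "0 \<in> U"
  then have "0 + v \<in> U" if "v \<in> monomials V" for v using that unfolding upset_def by blast
  then show "U = monomials V" using U by (auto simp: upset_def)
qed simp

lemma covers_act:
  assumes "p \<in> Inc i" shows "covers C (act_expo p u) \<longleftrightarrow> covers C u"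
proof -
  have "(k, l) \<in> keys (act_expo p u) \<longleftrightarrow> (\<exists>l'. l = p l' \<and> (k, l') \<in> keys u)" for k l
    using act_expo_keys[OF Inc_inj[OF assms], of u] by force
  moreover have "1 \<le> p l \<longleftrightarrow> 1 \<le> l" for l
    using Inc_ge[OF assms, of l] Inc_zero[OF assms] by (cases l) auto
  ultimately show ?thesis unfolding covers_def by metis
qed

text \<open>Shifts move columns and keep rows, so they respect covering. Maps in
  \<open>Inc j\<close> fix the columns up to \<open>j\<close>; hence a shifted generator supported
  beyond \<open>j\<close> comes from a generator supported beyond \<open>j\<close>, and higher
  levels impose no new condition.\<close>

lemma cover_number_stable:
  assumes U: "mono_chain c j U" and q: "gen_from c j U q" and n: "q \<le> n"
  shows "cover_number c n j (mono_span (U n) :: 'k::field pol set) =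
    cover_number c q j (mono_span (U q) :: 'k pol set)"
proof -
  have q1: "1 \<le> q" using q by (simp add: gen_from_def)
  have Un: "upset (vars_upto c n) (U n)" and Uq: "upset (vars_upto c q) (U q)"
    using mono_chain_upset[OF U] q1 n by auto
  have gen: "\<exists>p u v. x = act_expo p u + v \<and> u \<in> U q \<and> p \<in> Inc_mn j q n" if "x \<in> U n" for x
  proof -
    have "U n = upclose (vars_upto c n) (orbit j U q n)" using q n by (simp add: gen_from_def)
    then show ?thesis using that by (auto simp: upclose_def orbit_def)
  qed
  have sub: "U q \<subseteq> U n"
    using mono_chain_act[OF U q1 n _ id_Inc_mn[OF n]] by (auto simp: act_expo_id)
  have zero: "0 \<in> U n \<longleftrightarrow> 0 \<in> U q"
  proof
    assume "0 \<in> U n"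
    then obtain p u v where puv: "0 = act_expo p u + v" "u \<in> U q" "p \<in> Inc_mn j q n" using gen by blast
    have "keys (act_expo p u) = {}" using arg_cong[OF puv(1), of keys] by (auto simp: keys_plus_expo)
    then have "keys u = {}" using act_expo_keys[of p u] puv(3) by (auto simp: Inc_mn_def Inc_inj)
    then show "0 \<in> U q" using puv(2) by simp
  qed (use sub in auto)
  show ?thesis
  proof (cases "0 \<in> U q")
    case True
    then show ?thesis using zero full_upset[OF Un] full_upset[OF Uq]
      by (simp add: cover_number_def)
  next
    case False
    have "is_cover c n j (mono_span (U n) :: 'k pol set) C \<longleftrightarrow>
        is_cover c q j (mono_span (U q) :: 'k pol set) C" for C
    proof -
      have "covers C x" if C: "\<forall>u\<in>U q. keys u \<subseteq> UNIV \<times> {j<..} \<longrightarrow> covers C u"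
        and x: "x \<in> U n" "keys x \<subseteq> UNIV \<times> {j<..}" for x
      proof -
        obtain p u v where puv: "x = act_expo p u + v" "u \<in> U q" "p \<in> Inc_mn j q n" using gen x(1) by blast
        have p: "p \<in> Inc j" using puv(3) by (simp add: Inc_mn_def)
        have "keys (act_expo p u) \<subseteq> UNIV \<times> {j<..}" using puv(1) x(2) by (simp add: keys_plus_expo)
        then have gt: "p l > j" if "(k, l) \<in> keys u" for k l
          using that act_expo_keys[OF Inc_inj[OF p], of u] by fastforce
        have "l > j" if "(k, l) \<in> keys u" for k l
        proof (rule ccontr)
          assume "\<not> l > j"
          then have "p l = l" using p by (simp add: Inc_def)
          then show False using gt[OF that] \<open>\<not> l > j\<close> by simp
        qed
        then have "keys u \<subseteq> UNIV \<times> {j<..}" by auto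
        then have "covers C u" using C puv(2) by blast
        then show ?thesis using puv(1) covers_act[OF p] covers_plus by blast
      qed
      then have "(\<forall>x\<in>U n. keys x \<subseteq> UNIV \<times> {j<..} \<longrightarrow> covers C x) \<longleftrightarrow>
        (\<forall>u\<in>U q. keys u \<subseteq> UNIV \<times> {j<..} \<longrightarrow> covers C u)"
        using sub by (meson subsetD)
      moreover have z: "0 \<notin> U n" using False zero by simp
      ultimately show ?thesis by (simp only: is_cover_iff[OF Un z] is_cover_iff[OF Uq False])
    qed
    then show ?thesis using zero full_upset[OF Un] full_upset[OF Uq]
      by (simp add: cover_number_def mono_span_inj)
  qed
qed

lemma cover_number_chain_eq:
  assumes U: "mono_chain c j U" and J: "\<And>n. 1 \<le> n \<Longrightarrow> (J n :: 'k::field pol set) = mono_span (U n)"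
    and n: "chain_ind c j J \<le> n"
  shows "cover_number_chain c j J = cover_number c n j (J n)"
proof -
  let ?q = "chain_ind c j J"
  have q: "gen_from c j U ?q" using gen_from_chain_ind[OF U J] .
  then have q1: "1 \<le> ?q" by (simp add: gen_from_def)
  have st: "cover_number c n j (J n) = cover_number c ?q j (J ?q)" if "?q \<le> n" for n
    using cover_number_stable[OF U q that, where 'k = 'k] J that q1 by simp
  have "cover_number_chain c j J = cover_number c ?q j (J ?q)"
    unfolding cover_number_chain_def
  proof (rule the_equality)
    show "\<forall>n\<ge>?q. cover_number c n j (J n) = cover_number c ?q j (J ?q)" using st by blast
  qed blast
  then show ?thesis using st[OF n] by simp
qed

text \<open>In a proper ideal every monomial involves some variable, so all rows together form a
  cover and the minimum exists. Below the minimum every row set leaves a monomial uncovered, which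
  is the form needed for counting.\<close>

lemma cover_number_proper:
  assumes U: "upset (vars_upto c n) U" and "0 \<notin> U"
  obtains g where "cover_number c n j (mono_span U :: 'k::field pol set) = enat g" "g \<le> c"
    "\<And>C. C \<subseteq> {1..c} \<Longrightarrow> card C < g \<Longrightarrow> \<exists>u\<in>U. keys u \<subseteq> UNIV \<times> {j<..} \<and> \<not> covers C u"
proof -
  let ?S = "{card C |C. is_cover c n j (mono_span U :: 'k pol set) C}"
  note iff = is_cover_iff[OF assms, where 'k = 'k and j = j]
  have "covers {1..c} u" if "u \<in> U" for u
  proof -
    have "u \<noteq> 0" using that assms(2) by auto
    then obtain k l where kl: "(k, l) \<in> keys u" by (metis all_not_in_conv keys_eq_empty surj_pair)
    then have "(k, l) \<in> vars_upto c n" using U that by (auto simp: upset_def monomials_def)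
    then show ?thesis using kl by (auto simp: covers_def vars_upto_def)
  qed
  then have "is_cover c n j (mono_span U :: 'k pol set) {1..c}" using iff by blast
  then have c: "c \<in> ?S" by (auto intro!: exI[of _ "{1..c}"])
  have "?S \<subseteq> card ` Pow {1..c}" using iff by auto
  then have fin: "finite ?S" by (rule finite_subset) simp
  have "cover_number c n j (mono_span U :: 'k pol set) = enat (Min ?S)"
    using full_upset[OF U] assms(2) by (auto simp: cover_number_def mono_span_inj)
  moreover have "Min ?S \<le> c" using c fin by (rule Min_le[rotated])
  moreover have "\<exists>u\<in>U. keys u \<subseteq> UNIV \<times> {j<..} \<and> \<not> covers C u" if C: "C \<subseteq> {1..c}" "card C < Min ?S" for C
  proof (rule ccontr)
    assume "\<not> (\<exists>u\<in>U. keys u \<subseteq> UNIV \<times> {j<..} \<and> \<not> covers C u)"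
    then have "is_cover c n j (mono_span U :: 'k pol set) C" using iff C(1) by blast
    then have "Min ?S \<le> card C" using fin by (intro Min_le) auto
    then show False using C(2) by simp
  qed
  ultimately show ?thesis using that by blast
qed

section \<open>Associated primes of monomial ideals\<close>

definition pure_power :: "(nat \<times> nat) set \<Rightarrow> nat \<Rightarrow> expo" where
  "pure_power F N = (\<Sum>x\<in>F. single x N)"

lemma lookup_pure_power: "finite F \<Longrightarrow> lookup (pure_power F N) x = (if x \<in> F then N else 0)"
  by (simp add: pure_power_def lookup_sum lookup_single when_def)

lemma keys_pure_power: "finite F \<Longrightarrow> keys (pure_power F N) \<subseteq> F"
  by (auto simp: in_keys_iff lookup_pure_power split: if_splits)

lemma upset_le:
  assumes "upset V U" "u \<in> U" "v \<in> monomials V" "\<And>x. lookup u x \<le> lookup v x"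
  shows "v \<in> U"
proof -
  note d = expo_diff[of u v, OF assms(4)]
  then have "v - u \<in> monomials V" using assms(3) by (auto simp: monomials_def)
  then have "u + (v - u) \<in> U" using assms(1,2) by (simp add: upset_def)
  then show ?thesis using d(1) by simp
qed

lemma lookup_le_deg: "lookup u x \<le> expo_deg u"
proof (cases "x \<in> keys u")
  case True
  then show ?thesis unfolding expo_deg_def by (intro member_le_sum) auto
qed (simp add: in_keys_iff)

lemma expo_deg_single: "expo_deg (single x 1) = 1"
  by (simp add: expo_deg_def)

text \<open>The set \<open>T\<close> generates a minimal prime of the colon ideal by \<open>m\<close>, and \<open>w\<close> exhibits it as an
  associated prime of the ideal spanned by \<open>U\<close>.\<close>

lemma minimal_prime_of_colon:
  assumes V: "finite V" and U: "upset V U" and m: "m \<in> monomials V" "m \<notin> U"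
  obtains w T where "w \<in> monomials V" "w \<notin> U" "T \<subseteq> V" "\<And>x. x \<in> T \<Longrightarrow> w + single x 1 \<in> U"
    "\<And>u. u \<in> monomials V \<Longrightarrow> u + m \<in> U \<Longrightarrow> keys u \<inter> T \<noteq> {}"
proof -
  \<comment> \<open>\<open>sat F\<close> says that \<open>m\<close> stays outside the ideal after
    inverting the variables in \<open>F\<close>. The set \<open>T\<close> will be the complement of
    a maximal such \<open>F\<close>.\<close>
  define sat where "sat F \<longleftrightarrow> (\<forall>N. m + pure_power F N \<notin> U)" for F
  let ?S = "{F. F \<subseteq> V \<and> sat F}"
  have finS: "finite ?S" using V by simp
  have "{} \<in> ?S" using m by (simp add: sat_def pure_power_def)
  then have "?S \<noteq> {}" by blast
  then obtain F where "F \<in> ?S" "\<forall>F'\<in>?S. F \<subseteq> F' \<longrightarrow> F = F'"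
    using finite_has_maximal[OF finS] by meson
  then have F: "F \<subseteq> V" "sat F" "\<And>F'. F' \<subseteq> V \<Longrightarrow> sat F' \<Longrightarrow> F \<subseteq> F' \<Longrightarrow> F = F'" by simp_all
  have finF: "finite F" using F(1) V finite_subset by blast
  have pF: "pure_power F N \<in> monomials V" for N
    using keys_pure_power[OF finF] F(1) by (auto simp: monomials_def)
  define T where "T = V - F"
  have finT: "finite T" using V by (simp add: T_def)
  have "\<exists>N. m + pure_power (insert x F) N \<in> U" if "x \<in> T" for x
    using F(1) F(3)[of "insert x F"] that by (auto simp: T_def sat_def)
  then obtain Nf where Nf: "\<And>x. x \<in> T \<Longrightarrow> m + pure_power (insert x F) (Nf x) \<in> U" by metis
  define N where "N = sum Nf T"
  have NN: "Nf x \<le> N" if "x \<in> T" for x unfolding N_def using that finT by (intro member_le_sum) auto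
  \<comment> \<open>A monomial \<open>a\<close> in the variables of \<open>T\<close> is good if
    \<open>m a\<close> remains outside after inverting \<open>F\<close>. Maximality of
    \<open>F\<close> bounds its exponents by \<open>N\<close>, so a good \<open>a\<close> of largest
    degree exists, and multiplying it by a variable of \<open>T\<close> makes it bad.\<close>
  define good where "good a \<longleftrightarrow> a \<in> monomials T \<and> (\<forall>M. m + a + pure_power F M \<notin> U)" for a
  have TV: "a \<in> monomials V" if "a \<in> monomials T" for a using that by (auto simp: monomials_def T_def)
  have "good 0" using F(2) by (simp add: good_def sat_def)
  moreover have "expo_deg a \<le> card T * N" if a: "good a" for a
  proof -
    have "lookup a x \<le> N" if x: "x \<in> T" for x
    proof (rule ccontr)
      assume "\<not> lookup a x \<le> N"
      then have "Nf x \<le> lookup a x" using NN[OF x] by simp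
      then have "lookup (m + pure_power (insert x F) (Nf x)) y \<le> lookup (m + a + pure_power F (Nf x)) y" for y
        using finF by (simp add: lookup_add lookup_pure_power)
      then have "m + a + pure_power F (Nf x) \<in> U"
        using a m(1) pF TV by (intro upset_le[OF U Nf[OF x]]) (auto simp: good_def)
      then show False using a by (simp add: good_def)
    qed
    moreover have "keys a \<subseteq> T" using a by (simp add: good_def monomials_def)
    ultimately have "expo_deg a \<le> (\<Sum>x\<in>keys a. N)" unfolding expo_deg_def by (intro sum_mono) auto
    also have "\<dots> \<le> card T * N" using card_mono[OF finT \<open>keys a \<subseteq> T\<close>] by simp
    finally show ?thesis .
  qed
  ultimately have "\<exists>a. good a \<and> (\<forall>b. good b \<longrightarrow> expo_deg b \<le> expo_deg a)"
    by (intro ex_has_greatest_nat[of good 0 expo_deg "Suc (card T * N)"])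
      (simp_all add: less_Suc_eq_le)
  then obtain a where a: "good a" "\<And>b. good b \<Longrightarrow> expo_deg b \<le> expo_deg a" by blast
  have "\<exists>M. m + (a + single x 1) + pure_power F M \<in> U" if "x \<in> T" for x
  proof (rule ccontr)
    assume "\<not> ?thesis"
    moreover have "a + single x 1 \<in> monomials T" using a(1) that by (simp add: good_def monomials_def keys_plus_expo)
    ultimately have "good (a + single x 1)" by (simp add: good_def)
    then have "expo_deg (a + single x 1) \<le> expo_deg a" by (rule a(2))
    then show False by (simp only: expo_deg_plus expo_deg_single)
  qed
  then obtain Mf where Mf: "\<And>x. x \<in> T \<Longrightarrow> m + (a + single x 1) + pure_power F (Mf x) \<in> U" by metis
  \<comment> \<open>One power \<open>M\<close> of the inverted variables serves all of the finitely
    many \<open>x \<in> T\<close> and turns the maximal \<open>a\<close> into the monomial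
    \<open>w\<close>.\<close>
  define M where "M = sum Mf T"
  have MM: "Mf x \<le> M" if "x \<in> T" for x unfolding M_def using that finT by (intro member_le_sum) auto
  define w where "w = m + a + pure_power F M"
  have aV: "a \<in> monomials V" using a(1) TV by (simp add: good_def)
  show ?thesis
  proof (rule that[of w T])
    show "w \<in> monomials V" using m(1) aV pF by (simp add: w_def)
    show "w \<notin> U" using a(1) by (simp add: good_def w_def)
    show "T \<subseteq> V" by (auto simp: T_def)
    show "w + single x 1 \<in> U" if x: "x \<in> T" for x
    proof (rule upset_le[OF U Mf[OF x]])
      show "w + single x 1 \<in> monomials V" using m(1) aV pF x by (auto simp: w_def monomials_def T_def keys_plus_expo)
      show "lookup (m + (a + single x 1) + pure_power F (Mf x)) y \<le> lookup (w + single x 1) y" for y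
        using MM[OF x] finF by (simp add: w_def lookup_add lookup_pure_power)
    qed
    show "keys u \<inter> T \<noteq> {}" if u: "u \<in> monomials V" "u + m \<in> U" for u
    proof
      assume "keys u \<inter> T = {}"
      then have uF: "keys u \<subseteq> F" using u(1) by (auto simp: T_def monomials_def)
      \<comment> \<open>A monomial \<open>u\<close> in the variables of \<open>F\<close> divides a
        pure power over \<open>F\<close>, so \<open>u m\<close> in the ideal would contradict
        \<open>sat F\<close>.\<close>
      have "lookup u x \<le> lookup (pure_power F (expo_deg u)) x" for x
        using uF finF lookup_le_deg[of u x] by (auto simp: lookup_pure_power in_keys_iff)
      then have "m + pure_power F (expo_deg u) \<in> U"
        using m(1) pF by (intro upset_le[OF U u(2)]) (auto simp: lookup_add add.commute)
      then show False using F(2) by (simp add: sat_def)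
    qed
  qed
qed

section \<open>Counting hitting sets column by column\<close>

lemma embed_columns:
  assumes B: "B \<subseteq> {j<..n}" "Q \<le> card B" and Q: "1 \<le> Q"
  obtains p where "p \<in> Inc_mn j Q n" "\<And>l. j < l \<Longrightarrow> l \<le> Q \<Longrightarrow> p l \<in> B"
proof -
  have finB: "finite B" using B(1) finite_subset by blast
  obtain h where h: "bij_betw h {..<card B} B" "strict_mono_on {..<card B} h"
    using ex_bij_betw_strict_mono_card[OF finB] by blast
  have hB: "h a \<in> B" if "a < Q" for a using h(1) that B(2) by (auto simp: bij_betw_def)
  have jn: "j < n" using hB[of 0] Q B(1) by auto
  \<comment> \<open>Columns up to \<open>j\<close> stay, later ones go to the elements of
    \<open>B\<close> in increasing order; for \<open>j < l \<le> Q\<close> the position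
    \<open>l - j - 1\<close> is below \<open>Q \<le> card B\<close>.\<close>
  define f where "f l = (if l \<le> j then l else h (l - j - 1))" for l
  have fB: "f l \<in> B" if "j < l" "l \<le> Q" for l
  proof -
    have "l - j - 1 < Q" using that by linarith
    then show ?thesis using hB that(1) by (simp add: f_def)
  qed
  have "strict_mono_on {1..Q} f"
  proof (rule strict_mono_onI)
    fix a b assume ab: "a \<in> {1..Q}" "b \<in> {1..Q}" "a < b"
    consider "b \<le> j" | "a \<le> j" "j < b" | "j < a" by linarith
    then show "f a < f b"
    proof cases
      case 2
      then have "f b \<in> B" using fB ab by auto
      then show ?thesis using 2 B(1) by (auto simp: f_def)
    next
      case 3
      then have "h (a - j - 1) < h (b - j - 1)"
        using ab B(2) by (intro strict_mono_onD[OF h(2)]) auto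
      then show ?thesis using 3 ab by (simp add: f_def)
    qed (use ab in \<open>simp add: f_def\<close>)
  qed
  moreover have "1 \<le> f l \<and> f l \<le> n" if "1 \<le> l" "l \<le> Q" for l
  proof (cases "l \<le> j")
    case False
    then have "f l \<in> B" using fB that by simp
    then show ?thesis using B(1) by auto
  qed (use that jn in \<open>simp add: f_def\<close>)
  ultimately obtain p where p: "p \<in> Inc_mn j Q n" "\<And>l. 1 \<le> l \<Longrightarrow> l \<le> Q \<Longrightarrow> p l = f l"
    using Inc_extend[of Q f n j] Q by (auto simp: f_def)
  then show ?thesis using that[OF p(1)] fB by auto
qed

lemma hitting_set_card:
  assumes T: "T \<subseteq> vars_upto c n" and Q: "1 \<le> Q"
    and hit: "\<And>C. C \<subseteq> {1..c} \<Longrightarrow> card C < g \<Longrightarrow>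
      \<exists>u\<in>monomials (vars_upto c Q). keys u \<subseteq> UNIV \<times> {j<..} \<and> \<not> covers C u \<and>
        (\<forall>p\<in>Inc_mn j Q n. keys (act_expo p u) \<inter> T \<noteq> {})"
  shows "g * n \<le> card T + g * (j + 2 ^ c * Q)"
proof -
  define row where "row l = {k \<in> {1..c}. (k, l) \<in> T}" for l
  define B where "B C = {l \<in> {j<..n}. row l = C}" for C
  have cardB: "card (B C) \<le> Q" if C: "C \<subseteq> {1..c}" "card C < g" for C
  proof (rule ccontr)
    assume "\<not> card (B C) \<le> Q"
    moreover have "B C \<subseteq> {j<..n}" by (auto simp: B_def)
    ultimately obtain p where p: "p \<in> Inc_mn j Q n" "\<And>l. j < l \<Longrightarrow> l \<le> Q \<Longrightarrow> p l \<in> B C"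
      using embed_columns[of "B C" j n Q] Q by auto
    obtain u where u: "u \<in> monomials (vars_upto c Q)" "keys u \<subseteq> UNIV \<times> {j<..}" "\<not> covers C u"
      "keys (act_expo p u) \<inter> T \<noteq> {}" using hit[OF C] p(1) by blast
    have "inj p" using p(1) by (auto simp: Inc_mn_def Inc_inj)
    then obtain k l where kl: "(k, l) \<in> keys u" "(k, p l) \<in> T"
      using u(4) act_expo_keys[of p u] by auto
    then have l: "k \<in> {1..c}" "1 \<le> l" "j < l" "l \<le> Q"
      using u(1,2) by (auto simp: monomials_def vars_upto_def)
    \<comment> \<open>A variable of the shifted monomial in \<open>T\<close> sits in a column whose
      trace is exactly \<open>C\<close>, so its row lies in \<open>C\<close>, although
      \<open>C\<close> contains no row of \<open>u\<close>.\<close>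
    then have "p l \<in> B C" using p(2) by blast
    then have "k \<in> C" using kl(2) l(1) by (auto simp: B_def row_def)
    then show False using u(3) kl(1) l(2) by (auto simp: covers_def)
  qed
  define Bad where "Bad = {l \<in> {j<..n}. card (row l) < g}"
  have "Bad \<subseteq> (\<Union>C\<in>{C \<in> Pow {1..c}. card C < g}. B C)"
    by (auto simp: Bad_def B_def row_def)
  moreover have finP: "finite {C \<in> Pow {1..c}. card C < g}" by simp
  ultimately have "card Bad \<le> card (\<Union>C\<in>{C \<in> Pow {1..c}. card C < g}. B C)"
    by (intro card_mono finite_UN_I) (auto simp: B_def)
  also have "\<dots> \<le> (\<Sum>C\<in>{C \<in> Pow {1..c}. card C < g}. card (B C))"
    by (rule card_UN_le[OF finP])
  also have "\<dots> \<le> (\<Sum>C\<in>{C \<in> Pow {1..c}. card C < g}. Q)"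
    using cardB by (intro sum_mono) auto
  also have "\<dots> \<le> (\<Sum>C\<in>Pow {1..c}. Q)" by (intro sum_mono2) auto
  also have "\<dots> = 2 ^ c * Q" by (simp add: card_Pow)
  finally have bad: "card Bad \<le> 2 ^ c * Q" .
  have "Bad \<subseteq> {j<..n}" by (auto simp: Bad_def)
  then have good: "card ({j<..n} - Bad) = (n - j) - card Bad"
    by (subst card_Diff_subset) (auto intro: finite_subset)
  have finT: "finite T" using T by (rule finite_subset) (simp add: vars_upto_def)
  have "g * card ({j<..n} - Bad) = (\<Sum>l\<in>{j<..n} - Bad. g)" by simp
  also have "\<dots> \<le> (\<Sum>l\<in>{j<..n} - Bad. card (row l))" by (intro sum_mono) (auto simp: Bad_def)
  also have "\<dots> = card (Sigma ({j<..n} - Bad) row)" by (subst card_SigmaI) (auto simp: row_def)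
  also have "\<dots> \<le> card T"
    using finT by (intro card_inj_on_le[of "\<lambda>(l, k). (k, l)"]) (auto simp: inj_on_def row_def)
  finally have "g * ((n - j) - card Bad) \<le> card T" using good by simp
  moreover have "n \<le> ((n - j) - card Bad) + (j + 2 ^ c * Q)" using bad by linarith
  then have "g * n \<le> g * ((n - j - card Bad) + (j + 2 ^ c * Q))" by (rule mult_le_mono2)
  ultimately show ?thesis unfolding distrib_left[of g "n - j - card Bad"] by linarith
qed


section \<open>The lower bound along an invariant chain\<close>

lemma monomial_chain_exists:
  assumes "invariant_chain c i (I :: nat \<Rightarrow> 'k::field pol set)"
    "\<forall>n\<ge>1. monomial_ideal (vars_upto c n) (I n)"
  obtains U where "mono_chain c i U" "\<And>n. 1 \<le> n \<Longrightarrow> I n = mono_span (U n)"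
proof (rule that[of "\<lambda>n. {u. mono_of u \<in> I n}"])
  have act: "act_expo p u \<in> {u. mono_of u \<in> I n}"
    if "1 \<le> m" "m \<le> n" "u \<in> {u. mono_of u \<in> I m}" "p \<in> Inc_mn i m n" for m n u p
  proof -
    have "inc_act p (mono_of u) \<in> I n" using assms(1) that unfolding invariant_chain_def by blast
    then show ?thesis by (simp add: inc_act_mono)
  qed
  show "mono_chain c i (\<lambda>n. {u. mono_of u \<in> I n})"
    unfolding mono_chain_def using monomial_ideal_span(1) assms(2) act by blast
  show "I n = mono_span {u. mono_of u \<in> I n}" if "1 \<le> n" for n
    using monomial_ideal_span(2) assms(2) that by blast
qed

text \<open>Dividing by the trivial monomial keeps ideals proper. The zero vectors thus give
  admissible lists of every length, and the maxima defining \<open>\<Gamma>\<close> range over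
  nonempty sets.\<close>

lemma steps_proper_zero:
  assumes "\<And>n. 1 \<le> n \<Longrightarrow> 0 \<notin> U n" "1 \<le> n"
  shows "0 \<notin> steps c i (replicate k (\<lambda>_. 0)) U n"
  using assms(1)
proof (induction k arbitrary: i U)
  case (Suc k)
  have "level_mono c i (\<lambda>_. 0) = 0" by (simp add: level_mono_def)
  then have "0 \<notin> step_e c i (\<lambda>_. 0) U n" if "1 \<le> n" for n
    using Suc.prems that by (simp add: step_e_def)
  then show ?case using Suc.IH by simp
qed (use assms(2) in simp)

context
  fixes c i r :: nat and I :: "nat \<Rightarrow> 'k::field pol set" and U :: "nat \<Rightarrow> expo set"
  assumes U: "mono_chain c i U" and I: "\<And>n. 1 \<le> n \<Longrightarrow> I n = mono_span (U n)"
    and proper: "\<And>n. 1 \<le> n \<Longrightarrow> 0 \<notin> U n" and r: "chain_ind c i I \<le> r"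
begin

lemma carrier_iff: "1 \<le> n \<Longrightarrow> chain_es c i es I n \<noteq> carrier (Rn c n) \<longleftrightarrow> 0 \<notin> steps c i es U n"
  using chain_es_span[OF U I] full_upset[OF mono_chain_upset[OF steps_chain[OF U]], of n es]
  by (simp add: mono_span_inj)

lemma generated: "gen_from c i U r"
  using gen_from_mono[OF U gen_from_chain_ind[OF U I] r] .

lemma r_pos: "1 \<le> r" using generated by (simp add: gen_from_def)

lemma admissible_zero: "admissible c i r I (replicate k (\<lambda>_. 0))"
proof -
  have "replicate k (\<lambda>_. 0) ! l \<in> Eset c i r I (take l (replicate k (\<lambda>_. 0)))" if l: "l < k" for l
  proof -
    have "take l (replicate k (\<lambda>_. 0)) @ [replicate k (\<lambda>_. 0) ! l] = replicate (Suc l) (\<lambda>_::nat. 0::nat)"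
      using l by (simp add: replicate_append_same min_def)
    then show ?thesis
      using l r_pos steps_proper_zero[OF proper, where n = "r + Suc l" and k = "Suc l" and c = c and i = i] carrier_iff[of "r + Suc l"]
      by (simp add: Eset_def min_def del: replicate.simps)
  qed
  then show ?thesis by (simp add: admissible_def)
qed

text \<open>The map \<open>\<lambda>l. min (p l) (l + length es)\<close> agrees with \<open>p\<close> on the columns that \<open>p\<close> sends into the
  support of \<open>es_mono c i es\<close>, and it maps \<open>r\<close> below \<open>r + length es\<close>.\<close>

lemma es_mono_notin:
  assumes adm: "admissible c i r I es" "es \<noteq> []" and n: "r + length es \<le> n" "i + length es \<le> n"
  shows "es_mono c i es \<notin> U n"
proof
  let ?m = "es_mono c i es" and ?k = "length es"
  assume "?m \<in> U n"
  moreover have "U n = upclose (vars_upto c n) (orbit i U r n)"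
    using generated n by (simp add: gen_from_def)
  ultimately obtain p u v where m: "?m = act_expo p u + v" "u \<in> U r" "p \<in> Inc_mn i r n"
    by (auto simp: upclose_def orbit_def)
  have p: "p \<in> Inc i" using m(3) by (simp add: Inc_mn_def)
  have col: "i + 1 \<le> p l" "p l \<le> i + ?k" if "(a, l) \<in> keys u" for a l
  proof -
    have "(a, p l) \<in> keys ?m"
      using that act_expo_keys[OF Inc_inj[OF p], of u] by (force simp: m(1) keys_plus_expo)
    then show "i + 1 \<le> p l" "p l \<le> i + ?k" using keys_es_mono[of c i es] by auto
  qed
  have gt: "i < l" if "(a, l) \<in> keys u" for a l
  proof (rule ccontr)
    assume "\<not> i < l"
    then have "p l = l" using p by (simp add: Inc_def)
    then show False using col(1)[OF that] \<open>\<not> i < l\<close> by simp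
  qed
  have uV: "u \<in> monomials (vars_upto c r)" using mono_chain_upset[OF U r_pos] m(2) by (auto simp: upset_def)
  have "keys u \<noteq> {}" using proper[OF r_pos] m(2) by auto
  then obtain a l where "(a, l) \<in> keys u" by (metis all_not_in_conv surj_pair)
  \<comment> \<open>Some column of \<open>u\<close> lies between \<open>i + 1\<close> and
    \<open>r\<close>. Consequently the columns of \<open>es_mono\<close>, ending at
    \<open>i + length es\<close>, fit into level \<open>r + length es\<close>.\<close>
  then have ir: "i \<le> r" using gt uV by (fastforce simp: monomials_def vars_upto_def)
  define q where "q l = min (p l) (l + ?k)" for l
  have "q \<in> Inc i"
    using p by (auto simp: Inc_def strict_mono_def q_def min_def) (meson add_less_mono1 less_le_trans not_le le_less_trans order.strict_trans)+
  then have q: "q \<in> Inc_mn i r (r + ?k)" by (simp add: Inc_mn_def q_def)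
  have "act_expo p u = act_expo q u"
    using col gt by (intro act_expo_cong) (fastforce simp: q_def)
  moreover have "act_expo q u \<in> U (r + ?k)" using mono_chain_act[OF U r_pos _ m(2) q] by simp
  moreover have "?m \<in> monomials (vars_upto c (r + ?k))"
    using keys_es_mono[of c i es] ir by (fastforce simp: monomials_def vars_upto_def)
  ultimately have "?m \<in> U (r + ?k)"
    using mono_chain_upset[OF U, of "r + ?k"] r_pos by (simp add: m(1) upset_def)
  \<comment> \<open>Level \<open>r + length es\<close> is where \<open>Eset\<close> tests the last
    vector; the iterated ideal would now contain \<open>1\<close> there.\<close>
  then have "0 \<in> steps c i es U (r + ?k)"
    using steps_iff[of i es "r + ?k" U c 0] mono_chain_upset[OF U, of "r + ?k"] r_pos ir
    by (simp add: upset_def)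
  moreover obtain es' e where e: "es = es' @ [e]" using adm(2) by (metis append_butlast_last_id)
  then have "e \<in> Eset c i r I es'"
    using adm(1) by (auto simp: admissible_def dest!: spec[of _ "length es'"])
  then have "chain_es c i es I (r + ?k) \<noteq> carrier (Rn c (r + ?k))"
    by (simp add: Eset_def Let_def e)
  ultimately show False using carrier_iff[of "r + ?k" es] r_pos by simp
qed

lemma admissible_cover:
  assumes adm: "admissible c i r I es" "es \<noteq> []"
  obtains g Q where "cover_number_chain c (i + length es) (chain_es c i es I) = enat g" "g \<le> c"
    "1 \<le> Q" "i + length es \<le> Q" "r + length es \<le> Q"
    "\<And>C. C \<subseteq> {1..c} \<Longrightarrow> card C < g \<Longrightarrow>
      \<exists>u\<in>steps c i es U Q. keys u \<subseteq> UNIV \<times> {i + length es<..} \<and> \<not> covers C u"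
proof -
  let ?j = "i + length es" and ?J = "chain_es c i es I" and ?W = "steps c i es U"
  have W: "mono_chain c ?j ?W" using steps_chain[OF U] .
  have J: "?J n = mono_span (?W n)" if "1 \<le> n" for n using chain_es_span[OF U I that] .
  \<comment> \<open>\<open>Q\<close> lies beyond the index of the iterated chain, so the cover
    number may be computed at this level, and beyond the bounds in \<open>es_mono_notin\<close>, so
    the ideal is proper and the number finite.\<close>
  define Q where "Q = chain_ind c ?j ?J + r + ?j"
  have Q: "1 \<le> Q" "?j \<le> Q" "r + length es \<le> Q" using r_pos by (auto simp: Q_def)
  have UQ: "U Q \<subseteq> monomials (vars_upto c Q)" using mono_chain_upset[OF U Q(1)] by (simp add: upset_def)
  have "0 \<notin> ?W Q" using steps_iff[where U = U, OF Q(2) UQ, of 0] es_mono_notin[OF adm Q(3,2)] by simp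
  then obtain g where g: "cover_number c Q ?j (mono_span (?W Q) :: 'k pol set) = enat g" "g \<le> c"
    "\<And>C. C \<subseteq> {1..c} \<Longrightarrow> card C < g \<Longrightarrow>
      \<exists>u\<in>?W Q. keys u \<subseteq> UNIV \<times> {?j<..} \<and> \<not> covers C u"
    using cover_number_proper[OF mono_chain_upset[OF W Q(1)], where 'k = 'k and j = ?j] by blast
  have "cover_number_chain c ?j ?J = cover_number c Q ?j (?J Q)"
    by (rule cover_number_chain_eq[OF W J]) (simp_all add: Q_def)
  then show ?thesis using that[OF _ g(2) Q g(3)] g(1) J[OF Q(1)] by simp
qed

text \<open>An uncovered \<open>u\<close> has no variable in the columns
  \<open>i + 1..i + length es\<close>, so its membership in the iterated ideal means that
  \<open>u m\<close> lies in \<open>U Q\<close>. Maps in \<open>Inc (i + length es)\<close> fix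
  \<open>m\<close>; hence \<open>m\<close> multiplies each shift of \<open>u\<close> into
  \<open>U n\<close>, and the shift must meet \<open>T\<close>.\<close>

lemma proj_dim_admissible:
  assumes adm: "admissible c i r I es" "es \<noteq> []"
    and g: "cover_number_chain c (i + length es) (chain_es c i es I) = enat g"
  obtains D Q where "\<And>n. Q \<le> n \<Longrightarrow> proj_dim (Rn c n) (ideal_module (Rn c n) (I n)) \<ge>
    ereal (real g * real n - real D)"
proof -
  let ?j = "i + length es" and ?m = "es_mono c i es"
  obtain Q where Q: "1 \<le> Q" "?j \<le> Q" "r + length es \<le> Q"
    and cov: "\<And>C. C \<subseteq> {1..c} \<Longrightarrow> card C < g \<Longrightarrow>
      \<exists>u\<in>steps c i es U Q. keys u \<subseteq> UNIV \<times> {?j<..} \<and> \<not> covers C u"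
  proof (rule admissible_cover[OF adm])
    fix g' Q
    assume "cover_number_chain c (i + length es) (chain_es c i es I) = enat g'"
      and *: "1 \<le> Q" "?j \<le> Q" "r + length es \<le> Q"
      "\<And>C. C \<subseteq> {1..c} \<Longrightarrow> card C < g' \<Longrightarrow>
        \<exists>u\<in>steps c i es U Q. keys u \<subseteq> UNIV \<times> {?j<..} \<and> \<not> covers C u"
    then have "g' = g" using g by simp
    then show thesis using that * by blast
  qed
  have UQ: "U Q \<subseteq> monomials (vars_upto c Q)" using mono_chain_upset[OF U Q(1)] by (simp add: upset_def)
  let ?D = "g * (?j + 2 ^ c * Q) + 1"
  have "proj_dim (Rn c n) (ideal_module (Rn c n) (I n)) \<ge> ereal (real g * real n - real ?D)"
    if n: "Q \<le> n" for n
  proof -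
    let ?V = "vars_upto c n"
    have n1: "1 \<le> n" using Q n by simp
    have V: "finite ?V" by (simp add: vars_upto_def)
    have Un: "upset ?V (U n)" using mono_chain_upset[OF U n1] .
    have mV: "?m \<in> monomials ?V"
      using keys_es_mono[of c i es] Q n by (fastforce simp: monomials_def vars_upto_def)
    have mU: "?m \<notin> U n" using es_mono_notin[OF adm] Q n by simp
    obtain w T where wT: "w \<in> monomials ?V" "w \<notin> U n" "T \<subseteq> ?V" "\<And>x. x \<in> T \<Longrightarrow> w + single x 1 \<in> U n"
      "\<And>u. u \<in> monomials ?V \<Longrightarrow> u + ?m \<in> U n \<Longrightarrow> keys u \<inter> T \<noteq> {}"
      using minimal_prime_of_colon[OF V Un mV mU] by blast
    have "g * n \<le> card T + g * (?j + 2 ^ c * Q)"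
    proof (rule hitting_set_card[OF wT(3) Q(1)])
      fix C assume "C \<subseteq> {1..c}" "card C < g"
      then obtain u where u: "u \<in> steps c i es U Q" "keys u \<subseteq> UNIV \<times> {?j<..}" "\<not> covers C u"
        using cov by blast
      have uQ: "u \<in> monomials (vars_upto c Q)" and um: "u + ?m \<in> U Q"
        using u(1,2) steps_iff[where U = U, OF Q(2) UQ, of u] by auto
      have "keys (act_expo p u) \<inter> T \<noteq> {}" if p: "p \<in> Inc_mn ?j Q n" for p
      proof (rule wT(5))
        have pj: "p \<in> Inc ?j" and pi: "p \<in> Inc_mn i Q n"
          using p Inc_mono[of i ?j] by (auto simp: Inc_mn_def)
        show "act_expo p u \<in> monomials ?V" using act_expo_vars[OF p uQ] .
        have "act_expo p ?m = ?m" using keys_es_mono[of c i es] by (intro act_expo_fix[OF pj]) auto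
        then show "act_expo p u + ?m \<in> U n"
          using mono_chain_act[OF U Q(1) n um pi] act_expo_plus[OF Inc_inj[OF pj]] by simp
      qed
      then show "\<exists>u\<in>monomials (vars_upto c Q). keys u \<subseteq> UNIV \<times> {?j<..} \<and> \<not> covers C u \<and>
          (\<forall>p\<in>Inc_mn ?j Q n. keys (act_expo p u) \<inter> T \<noteq> {})"
        using uQ u by blast
    qed
    then have "real (g * n) \<le> real (card T + g * (?j + 2 ^ c * Q))" by (simp only: of_nat_le_iff)
    then have le: "real g * real n - real ?D \<le> real (card T) - 1" by simp
    have finT: "finite T" using wT(3) V finite_subset by blast
    have "ereal (real (card T)) - 1 \<le> proj_dim (Rn c n) (ideal_module (Rn c n) (I n))"
      using proj_dim_monomial_ge[OF Un wT(1,2) finT wT(3,4), where 'k = 'k] I[OF n1] by simp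
    moreover have "ereal (real g * real n - real ?D) \<le> ereal (real (card T)) - 1"
      using le by (simp add: one_ereal_def)
    ultimately show ?thesis by (rule order_trans[rotated])
  qed
  then show ?thesis using that by blast
qed

text \<open>There are infinitely many levels and infinitely many candidate lists, but all values lie
  in \<open>{0..c}\<close>. Both maxima are therefore taken over finite nonempty sets and are
  attained.\<close>

lemma Gamma_chain_attained:
  obtains es g where "admissible c i r I es" "es \<noteq> []" "g \<le> c" "Gamma_chain c i r I = enat g"
    "cover_number_chain c (i + length es) (chain_es c i es I) = enat g"
proof -
  let ?S = "\<lambda>k. {cover_number_chain c (i + k) (chain_es c i es I) |es. length es = k \<and> admissible c i r I es}"
  have Sc: "?S k \<subseteq> enat ` {..c}" if k: "1 \<le> k" for k
  proof
    fix x assume "x \<in> ?S k"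
    then obtain es where es: "length es = k" "admissible c i r I es"
      "x = cover_number_chain c (i + length es) (chain_es c i es I)" by auto
    then have "es \<noteq> []" using k by auto
    then show "x \<in> enat ` {..c}" using admissible_cover[OF es(2)] es(3) by (metis atMost_iff image_eqI)
  qed
  have Max_S: "Max (?S k) \<in> ?S k" if k: "1 \<le> k" for k
  proof (rule Max_in)
    show "finite (?S k)" using Sc[OF k] by (rule finite_subset) simp
    show "?S k \<noteq> {}" using admissible_zero[of k] by (auto intro!: exI[of _ "replicate k (\<lambda>_. 0)"])
  qed
  let ?G = "{gamma_max_level c i r I k |k. 1 \<le> k}"
  have Gc: "?G \<subseteq> enat ` {..c}"
  proof
    fix x assume "x \<in> ?G"
    then obtain k where k: "1 \<le> k" "x = Max (?S k)" unfolding gamma_max_level_def by blast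
    show "x \<in> enat ` {..c}" unfolding k(2) by (rule subsetD[OF Sc[OF k(1)] Max_S[OF k(1)]])
  qed
  have "Max ?G \<in> ?G"
  proof (rule Max_in)
    show "finite ?G" using Gc by (rule finite_subset) simp
    show "?G \<noteq> {}" by auto
  qed
  then obtain k where k: "1 \<le> k" "Gamma_chain c i r I = Max (?S k)"
    by (auto simp: Gamma_chain_def gamma_max_level_def)
  obtain g where g: "g \<le> c" "Max (?S k) = enat g" using Max_S[OF k(1)] Sc[OF k(1)] by auto
  obtain es where es: "length es = k" "admissible c i r I es"
    "cover_number_chain c (i + k) (chain_es c i es I) = enat g"
    using Max_S[OF k(1)] unfolding g(2) by auto
  have "es \<noteq> []" using es(1) k(1) by auto
  then show ?thesis using that[of es g] es k(2) g by simp
qed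

end

theorem theorem4p6:
  fixes I :: "nat \<Rightarrow> 'k::field pol set" and c i r :: nat
  assumes "1 \<le> c"
    and "invariant_chain c i I"
    and "\<forall>n\<ge>1. monomial_ideal (vars_upto c n) (I n)"
    and "\<forall>n\<ge>1. I n \<noteq> carrier (Rn c n)"
    and "chain_ind c i I \<le> r"
  shows "\<exists>D::int. \<forall>\<^sub>F n in sequentially.
           proj_dim (Rn c n) (ideal_module (Rn c n) (I n))
             \<ge> ereal_of_enat (Gamma_chain c i r I) * ereal (real n) + ereal (real_of_int D)"
proof -
  obtain U where U: "mono_chain c i U" and I: "\<And>n. 1 \<le> n \<Longrightarrow> I n = mono_span (U n)"
    using monomial_chain_exists[OF assms(2,3)] by blast
  have proper: "0 \<notin> U n" if "1 \<le> n" for n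
    using assms(4) I[OF that] full_upset[OF mono_chain_upset[OF U that]] that by auto
  obtain es g where es: "admissible c i r I es" "es \<noteq> []" "Gamma_chain c i r I = enat g"
    "cover_number_chain c (i + length es) (chain_es c i es I) = enat g"
    using Gamma_chain_attained[OF U I proper assms(5)] by blast
  obtain D Q where DQ: "\<And>n. Q \<le> n \<Longrightarrow> proj_dim (Rn c n) (ideal_module (Rn c n) (I n)) \<ge>
      ereal (real g * real n - real D)"
    using proj_dim_admissible[OF U I proper assms(5) es(1,2,4)] by blast
  show ?thesis
  proof (intro exI[of _ "- int D"] eventually_sequentiallyI[of Q])
    fix n assume "Q \<le> n"
    then show "proj_dim (Rn c n) (ideal_module (Rn c n) (I n)) \<ge>
        ereal_of_enat (Gamma_chain c i r I) * ereal (real n) + ereal (real_of_int (- int D))"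
      using DQ[of n] by (simp add: es(3))
  qed
qed

end
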